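(* For each $n\ge 1$ let $X_{n1},X_{n2},\dots,X_{nk_n}$ be independent, centered, square integrable real random variables, with $s_n^2=\sum_{j=1}^{k_n}\mathrm{Var}(X_{nj})>0$. Let $(a_n)$ be a sequence of positive numbers with $a_n\to 0$. Assume that for every $\beta>0$ $$\limsup_{n\to\infty} a_n\sum_{j=1}^{k_n}\mathbf{E}\Big[\exp\Big(\beta\frac{|X_{nj}|}{\sqrt{a_n}\,s_n}\Big)\,I\big(\sqrt{a_n}\,s_n<|X_{nj}|<s_n/\sqrt{a_n}\big)\Big]=0,$$ that $$\limsup_{n\to\infty} a_n\log\mathbf{P}\Big(\max_{1\le j\le k_n}|X_{nj}|\ge s_n/\sqrt{a_n}\Big)=-\infty,$$ and that for every $\epsilon>0$ $$\frac{1}{s_n^2}\sum_{j=1}^{k_n}\mathbf{E}\big[X_{nj}^2\,I(|X_{nj}|\ge\epsilon s_n\sqrt{a_n})\big]\to 0\quad\text{as } n\to\infty.$$ Then $\{W_n\}$ satisfies the functional moderate deviation principle in $D[0,1]$ (uniform topology) with speed $a_n$ and good rate function $$I(z)=\tfrac12\int_0^1 (z'(u))^2\,du\ \text{ if } z(0)=0 \text{ and } z \text{ is absolutely continuous},\qquad I(z)=\infty\ \text{ otherwise.}$$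
   Context: $(k_n)$ is a sequence of positive integers; $I(A)$ also denotes the indicator of an event $A$; $\log 0=-\infty$. Independence is within each row $n$. Notation: $S_{n,0}=0$, $S_{nl}=\sum_{j=1}^{l}X_{nj}$, $S_n=S_{nk_n}$, $s_{ni}^2=\sum_{j=1}^{i}\mathrm{Var}(X_{nj})$ (with $s_{n,0}^2=0$), $s_n^2=s_{nk_n}^2$. The process $W_n$ is the random element of $D[0,1]$ (càdlàg functions on $[0,1]$) given by $W_n(t)=S_{n,i-1}/s_n$ for $t\in[s_{n,i-1}^2/s_n^2,\ s_{ni}^2/s_n^2)$, $1\le i\le k_n$, and $W_n(1)=S_n/s_n$. Functional moderate deviation principle: a family $\{W_n\}$ of random elements of $D[0,1]$, endowed with the uniform topology, satisfies the functional MDP with speed $a_n\to0$ and good rate function $I$ if the level sets $\{x: I(x)\le\alpha\}$ are compact for all $\alpha<\infty$ and for every Borel set $\Gamma\subset D[0,1]$, with interior $\Gamma^0$ and closure $\bar\Gamma$, $$-\inf_{z\in\Gamma^0}I(z)\le\liminf_n a_n\log\mathbf{P}(\sqrt{a_n}\,W_n\in\Gamma)\le\limsup_n a_n\log\mathbf{P}(\sqrt{a_n}\,W_n\in\Gamma)\le-\inf_{z\in\bar\Gamma}I(z).$$ *)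

theory Defs
  imports "HOL-Probability.Probability"
begin

section \<open>The space \<open>D[0,1]\<close> with the uniform topology\<close>

definition is_cadlag :: "(real \<Rightarrow> real) \<Rightarrow> bool" where
  "is_cadlag f \<longleftrightarrow>
     (\<forall>t\<in>{0..<1}. (f \<longlongrightarrow> f t) (at_right t)) \<and>
     (\<forall>t\<in>{0<..1}. \<exists>l. (f \<longlongrightarrow> l) (at_left t))"

text \<open>A cadlag function on \<open>[0,1]\<close> is represented by its extension by zero to the whole
  real line, so that equality of elements is equality on \<open>[0,1]\<close>.  The value outside
  \<open>[0,1]\<close> enters neither \<^const>\<open>is_cadlag\<close> nor the norm below.\<close>

typedef cadlag = "{f :: real \<Rightarrow> real. is_cadlag f \<and> (\<forall>t. t \<notin> {0..1} \<longrightarrow> f t = 0)}"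
  morphisms apply_cadlag Cadlag
  by (rule exI[of _ "\<lambda>_. 0"]) (auto simp: is_cadlag_def)

setup_lifting type_definition_cadlag

lemma is_cadlag_lin:
  assumes "is_cadlag f" "is_cadlag g"
  shows "is_cadlag (\<lambda>t. a * f t + b * g t)"
  unfolding is_cadlag_def
proof (intro conjI ballI)
  fix t :: real assume "t \<in> {0..<1}"
  then show "((\<lambda>t. a * f t + b * g t) \<longlongrightarrow> a * f t + b * g t) (at_right t)"
    using assms by (auto simp: is_cadlag_def intro!: tendsto_intros)
next
  fix t :: real assume "t \<in> {0<..1}"
  then obtain l m where "(f \<longlongrightarrow> l) (at_left t)" "(g \<longlongrightarrow> m) (at_left t)"
    using assms unfolding is_cadlag_def by blast
  then have "((\<lambda>t. a * f t + b * g t) \<longlongrightarrow> a * l + b * m) (at_left t)"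
    by (intro tendsto_intros)
  then show "\<exists>l. ((\<lambda>t. a * f t + b * g t) \<longlongrightarrow> l) (at_left t)" ..
qed

lemma is_cadlag_cmult: "is_cadlag f \<Longrightarrow> is_cadlag (\<lambda>t. a * f t)"
  using is_cadlag_lin[of f f a 0] by simp

lemma is_cadlag_sum:
  assumes "\<And>i. i \<in> A \<Longrightarrow> is_cadlag (f i)"
  shows "is_cadlag (\<lambda>t. \<Sum>i\<in>A. f i t)"
  using assms
proof (induction A rule: infinite_finite_induct)
  case (insert x F)
  then show ?case using is_cadlag_lin[of "f x" "\<lambda>t. \<Sum>i\<in>F. f i t" 1 1] by simp
qed (auto simp: is_cadlag_def)

lemma is_cadlag_indicator: "is_cadlag (indicator {a..<b})"
  unfolding is_cadlag_def
proof (intro conjI ballI)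
  fix t :: real assume "t \<in> {0..<1}"
  have "\<forall>\<^sub>F x in at_right t. indicator {a..<b} x = (indicator {a..<b} t :: real)"
  proof -
    consider "t < a" | "a \<le> t" "t < b" | "b \<le> t" by linarith
    then show ?thesis
    proof cases
      case 1
      then show ?thesis
        by (intro eventually_at_rightI[of t a]) (auto simp: indicator_def)
    next
      case 2
      then show ?thesis
        by (intro eventually_at_rightI[of t b]) (auto simp: indicator_def)
    next
      case 3
      then show ?thesis
        by (intro eventually_at_rightI[of t "t + 1"]) (auto simp: indicator_def)
    qed
  qed
  then show "(indicator {a..<b} \<longlongrightarrow> (indicator {a..<b} t :: real)) (at_right t)"
    by (rule tendsto_eventually)
next
  fix t :: real assume "t \<in> {0<..1}"
  have "\<exists>c. \<forall>\<^sub>F x in at_left t. indicator {a..<b} x = (c :: real)"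
  proof -
    consider "t \<le> a" | "a < t" "t \<le> b" | "b < t" by linarith
    then show ?thesis
    proof cases
      case 1
      then show ?thesis
        by (intro exI[of _ 0] eventually_at_leftI[of "t - 1"]) (auto simp: indicator_def)
    next
      case 2
      then show ?thesis
        by (intro exI[of _ 1] eventually_at_leftI[of a]) (auto simp: indicator_def)
    next
      case 3
      then show ?thesis
        by (intro exI[of _ 0] eventually_at_leftI[of b]) (auto simp: indicator_def)
    qed
  qed
  then show "\<exists>l. (indicator {a..<b} \<longlongrightarrow> (l :: real)) (at_left t)"
    using tendsto_eventually by blast
qed

lemma is_cadlag_upd_1:
  assumes "is_cadlag f"
  shows "is_cadlag (f(1 := c))"
  unfolding is_cadlag_def
proof (intro conjI ballI)
  fix t :: real assume t: "t \<in> {0..<1}"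
  have "\<forall>\<^sub>F x in at_right t. f x = (f(1 := c)) x"
    using t by (intro eventually_at_rightI[of t 1]) auto
  moreover have "(f \<longlongrightarrow> f t) (at_right t)"
    using assms t by (auto simp: is_cadlag_def)
  ultimately have "(f(1 := c) \<longlongrightarrow> f t) (at_right t)"
    by (rule Lim_transform_eventually[rotated])
  then show "(f(1 := c) \<longlongrightarrow> (f(1 := c)) t) (at_right t)"
    using t by simp
next
  fix t :: real assume t: "t \<in> {0<..1}"
  have ev: "\<forall>\<^sub>F x in at_left t. f x = (f(1 := c)) x"
    using t by (intro eventually_at_leftI[of 0]) auto
  from assms t obtain l where "(f \<longlongrightarrow> l) (at_left t)"
    unfolding is_cadlag_def by blast
  then show "\<exists>l. (f(1 := c) \<longlongrightarrow> l) (at_left t)"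
    using ev by (blast intro: Lim_transform_eventually)
qed

lemma is_cadlag_bounded:
  assumes "is_cadlag f"
  shows "bounded (f ` {0..1})"
proof -
  define P where "P a b \<longleftrightarrow> bounded (f ` ({a..b} \<inter> {0..1}))" for a b
  have "P 0 1"
  proof (rule Bolzano)
    fix a b c :: real assume "P a b" "P b c" "a \<le> b" "b \<le> c"
    moreover have "{a..c} \<inter> {0..1} \<subseteq> ({a..b} \<inter> {0..1}) \<union> ({b..c} \<inter> {0..1})"
      by auto
    then have "f ` ({a..c} \<inter> {0..1}) \<subseteq> f ` ({a..b} \<inter> {0..1}) \<union> f ` ({b..c} \<inter> {0..1})"
      unfolding image_Un[symmetric] by (rule image_mono)
    ultimately show "P a c"
      unfolding P_def by (meson bounded_Un bounded_subset)
  next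
    fix x :: real assume x: "0 \<le> x" "x \<le> 1"
    have ev: "\<exists>B. \<forall>\<^sub>F y in F. \<bar>f y\<bar> \<le> B" if "(f \<longlongrightarrow> l) F" for l F
    proof -
      have "\<forall>\<^sub>F y in F. dist (f y) l < 1" using that by (rule tendstoD) simp
      then have "\<forall>\<^sub>F y in F. \<bar>f y\<bar> \<le> \<bar>l\<bar> + 1"
        by eventually_elim (auto simp: dist_real_def)
      then show ?thesis ..
    qed
    have r: "\<exists>d>0. \<exists>B. \<forall>y. x < y \<and> y < x + d \<and> y \<le> 1 \<longrightarrow> \<bar>f y\<bar> \<le> B"
    proof (cases "x < 1")
      case True
      then have "(f \<longlongrightarrow> f x) (at_right x)" using assms x by (auto simp: is_cadlag_def)
      then obtain B where "\<forall>\<^sub>F y in at_right x. \<bar>f y\<bar> \<le> B" using ev by blast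
      then obtain b where "b > x" "\<forall>y>x. y < b \<longrightarrow> \<bar>f y\<bar> \<le> B"
        unfolding eventually_at_right_field by blast
      then show ?thesis by (intro exI[of _ "b - x"]) auto
    next
      case False
      then show ?thesis by (intro exI[of _ 1]) auto
    qed
    have l: "\<exists>d>0. \<exists>B. \<forall>y. x - d < y \<and> y < x \<and> 0 \<le> y \<longrightarrow> \<bar>f y\<bar> \<le> B"
    proof (cases "x > 0")
      case True
      then have "x \<in> {0<..1}" using x by simp
      then obtain l where "(f \<longlongrightarrow> l) (at_left x)"
        using assms unfolding is_cadlag_def by blast
      then obtain B where "\<forall>\<^sub>F y in at_left x. \<bar>f y\<bar> \<le> B" using ev by blast
      then obtain b where "b < x" "\<forall>y>b. y < x \<longrightarrow> \<bar>f y\<bar> \<le> B"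
        unfolding eventually_at_left_field by blast
      then show ?thesis by (intro exI[of _ "x - b"]) auto
    next
      case False
      then show ?thesis by (intro exI[of _ 1]) auto
    qed
    from r obtain d1 B1
      where 1: "d1 > 0" "\<And>y. x < y \<Longrightarrow> y < x + d1 \<Longrightarrow> y \<le> 1 \<Longrightarrow> \<bar>f y\<bar> \<le> B1" by blast
    from l obtain d2 B2
      where 2: "d2 > 0" "\<And>y. x - d2 < y \<Longrightarrow> y < x \<Longrightarrow> 0 \<le> y \<Longrightarrow> \<bar>f y\<bar> \<le> B2" by blast
    have "P a b" if ab: "a \<le> x" "x \<le> b" "b - a < min d1 d2" for a b
      unfolding P_def
    proof (rule boundedI)
      fix z assume "z \<in> f ` ({a..b} \<inter> {0..1})"
      then obtain y where y: "z = f y" "a \<le> y" "y \<le> b" "0 \<le> y" "y \<le> 1" by auto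
      consider "y < x" | "y = x" | "x < y" by linarith
      then show "norm z \<le> max \<bar>f x\<bar> (max B1 B2)"
      proof cases
        case 1
        then show ?thesis using 2(2)[of y] y ab by auto
      next
        case 2
        then show ?thesis using y by auto
      next
        case 3
        then show ?thesis using 1(2)[of y] y ab by auto
      qed
    qed
    then show "\<exists>d>0. \<forall>a b. a \<le> x \<and> x \<le> b \<and> b - a < d \<longrightarrow> P a b"
      using 1(1) 2(1) by (intro exI[of _ "min d1 d2"]) auto
  qed simp
  then show ?thesis by (simp add: P_def)
qed

lemma cadlag_eqI: "(\<And>t. t \<in> {0..1} \<Longrightarrow> apply_cadlag f t = apply_cadlag g t) \<Longrightarrow> f = g"
  by transfer (metis ext)

instantiation cadlag :: real_vector
begin

lift_definition zero_cadlag :: cadlag is "\<lambda>_. 0"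
  by (auto simp: is_cadlag_def)

lift_definition plus_cadlag :: "cadlag \<Rightarrow> cadlag \<Rightarrow> cadlag" is "\<lambda>f g t. f t + g t"
  using is_cadlag_lin[of _ _ 1 1] by auto

lift_definition minus_cadlag :: "cadlag \<Rightarrow> cadlag \<Rightarrow> cadlag" is "\<lambda>f g t. f t - g t"
  using is_cadlag_lin[of _ _ 1 "-1"] by auto

lift_definition uminus_cadlag :: "cadlag \<Rightarrow> cadlag" is "\<lambda>f t. - f t"
  using is_cadlag_cmult[of _ "-1"] by auto

lift_definition scaleR_cadlag :: "real \<Rightarrow> cadlag \<Rightarrow> cadlag" is "\<lambda>c f t. c * f t"
  using is_cadlag_cmult by auto

instance
  by standard (transfer; auto simp: algebra_simps)+

end

instantiation cadlag :: real_normed_vector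
begin

lift_definition norm_cadlag :: "cadlag \<Rightarrow> real" is "\<lambda>f. SUP t\<in>{0..1}. \<bar>f t\<bar>" .

definition dist_cadlag :: "cadlag \<Rightarrow> cadlag \<Rightarrow> real"
  where "dist_cadlag f g = norm (f - g)"

definition sgn_cadlag :: "cadlag \<Rightarrow> cadlag"
  where "sgn_cadlag f = f /\<^sub>R norm f"

definition uniformity_cadlag :: "(cadlag \<times> cadlag) filter"
  where "uniformity_cadlag = (INF e\<in>{0 <..}. principal {(x, y). dist x y < e})"

definition open_cadlag :: "cadlag set \<Rightarrow> bool"
  where "open_cadlag S = (\<forall>x\<in>S. \<forall>\<^sub>F (x', y) in uniformity. x' = x \<longrightarrow> y \<in> S)"

lemma cadlag_abs_le_norm: "t \<in> {0..1} \<Longrightarrow> \<bar>apply_cadlag f t\<bar> \<le> norm f"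
proof transfer
  fix t :: real and f :: "real \<Rightarrow> real"
  assume t: "t \<in> {0..1}" and f: "is_cadlag f \<and> (\<forall>t. t \<notin> {0..1} \<longrightarrow> f t = 0)"
  have "\<exists>B. \<forall>x\<in>{0..1}. \<bar>f x\<bar> \<le> B"
    using is_cadlag_bounded[of f] f by (simp add: bounded_iff)
  then obtain B where "\<And>x. x \<in> {0..1} \<Longrightarrow> \<bar>f x\<bar> \<le> B"
    by blast
  then have "bdd_above ((\<lambda>t. \<bar>f t\<bar>) ` {0..1})"
    by (intro bdd_aboveI2[where M = B])
  then show "\<bar>f t\<bar> \<le> (SUP t\<in>{0..1}. \<bar>f t\<bar>)"
    using t by (intro cSUP_upper)
qed

lemma cadlag_norm_leI: "(\<And>t. t \<in> {0..1} \<Longrightarrow> \<bar>apply_cadlag f t\<bar> \<le> b) \<Longrightarrow> norm f \<le> b"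
  by transfer (auto intro!: cSUP_least)

lemma cadlag_norm_nonneg: "0 \<le> norm (f :: cadlag)"
  using cadlag_abs_le_norm[of 0 f] by simp

instance
proof
  fix a :: real and f g :: cadlag
  show "norm (f + g) \<le> norm f + norm g"
  proof (rule cadlag_norm_leI)
    fix t :: real assume "t \<in> {0..1}"
    then show "\<bar>apply_cadlag (f + g) t\<bar> \<le> norm f + norm g"
      using cadlag_abs_le_norm[of t f] cadlag_abs_le_norm[of t g]
      by (simp add: plus_cadlag.rep_eq)
  qed
  show "norm f = 0 \<longleftrightarrow> f = 0"
  proof
    assume "norm f = 0"
    then have "apply_cadlag f t = 0" if "t \<in> {0..1}" for t
      using cadlag_abs_le_norm[OF that, of f] by simp
    then show "f = 0"
      by (intro cadlag_eqI) (simp add: zero_cadlag.rep_eq)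
  next
    assume "f = 0"
    then show "norm f = 0"
      by (simp add: norm_cadlag.rep_eq zero_cadlag.rep_eq)
  qed
  have le: "norm (a *\<^sub>R f) \<le> \<bar>a\<bar> * norm f" for a and f :: cadlag
    by (rule cadlag_norm_leI)
       (simp add: scaleR_cadlag.rep_eq abs_mult mult_left_mono cadlag_abs_le_norm)
  show "norm (a *\<^sub>R f) = \<bar>a\<bar> * norm f"
  proof (cases "a = 0")
    case True
    then show ?thesis using le[of 0 f] cadlag_norm_nonneg[of "0 *\<^sub>R f"] by simp
  next
    case False
    have "norm f \<le> \<bar>inverse a\<bar> * norm (a *\<^sub>R f)"
      using le[of "inverse a" "a *\<^sub>R f"] False by simp
    then have "\<bar>a\<bar> * norm f \<le> norm (a *\<^sub>R f)"
      using False by (simp add: field_simps)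
    then show ?thesis using le[of a f] by simp
  qed
qed (auto simp: dist_cadlag_def sgn_cadlag_def uniformity_cadlag_def open_cadlag_def)

end


section \<open>The partial sum process\<close>

definition partial_sum :: "(nat \<Rightarrow> 'a \<Rightarrow> real) \<Rightarrow> nat \<Rightarrow> 'a \<Rightarrow> real" where
  "partial_sum X l \<omega> = (\<Sum>j=1..l. X j \<omega>)"

definition var_sum :: "'a measure \<Rightarrow> (nat \<Rightarrow> 'a \<Rightarrow> real) \<Rightarrow> nat \<Rightarrow> real" where
  "var_sum M X i = (\<Sum>j=1..i. prob_space.variance M (X j))"

definition sd_sum :: "'a measure \<Rightarrow> (nat \<Rightarrow> 'a \<Rightarrow> real) \<Rightarrow> nat \<Rightarrow> real" where
  "sd_sum M X i = sqrt (var_sum M X i)"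

lemma var_sum_0 [simp]: "var_sum M X 0 = 0"
  by (simp add: var_sum_def)

lemma var_sum_mono: "i \<le> j \<Longrightarrow> var_sum M X i \<le> var_sum M X j"
  unfolding var_sum_def by (intro sum_mono2) auto

lemma var_sum_nonneg: "0 \<le> var_sum M X i"
  using var_sum_mono[of 0 i M X] by simp

lemma var_sum_ratio_mono:
  "i \<le> j \<Longrightarrow> var_sum M X i / var_sum M X k \<le> var_sum M X j / var_sum M X k"
  by (intro divide_right_mono var_sum_mono var_sum_nonneg)

lemma var_sum_ratio_le_1: "i \<le> k \<Longrightarrow> var_sum M X i / var_sum M X k \<le> 1"
  using var_sum_mono[of i k M X] var_sum_nonneg[of M X k] by (simp add: divide_le_eq)

lemma var_sum_intervals_cover:
  assumes pos: "var_sum M X k > 0" and t: "0 \<le> t" "t < 1"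
  obtains i where "1 \<le> i" "i \<le> k"
    "t \<in> {var_sum M X (i - 1) / var_sum M X k ..< var_sum M X i / var_sum M X k}"
proof -
  define v where "v i = var_sum M X i / var_sum M X k" for i
  define i where "i = (LEAST i. t < v i)"
  have vk: "t < v k" and v0: "v 0 = 0" using pos t by (simp_all add: v_def)
  from vk have less: "t < v i" unfolding i_def by (rule LeastI)
  from vk have le: "i \<le> k" unfolding i_def by (rule Least_le)
  have "i \<noteq> 0" using less v0 t by (intro notI) simp
  then have "\<not> t < v (i - 1)" unfolding i_def by (intro not_less_Least) simp
  with less le \<open>i \<noteq> 0\<close> show ?thesis by (intro that[of i]) (simp_all add: v_def)
qed

text \<open>The half-open intervals in the sum are pairwise disjoint and, if \<open>var_sum M X k > 0\<close>, they
  cover \<open>[0,1)\<close> by \<open>var_sum_intervals_cover\<close>; on the \<open>i\<close>-th one the process equals \<open>S\<^bsub>i-1\<^esub> / s\<close>, see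
  \<open>partial_sum_process_interval\<close> below.\<close>

lift_definition partial_sum_process ::
    "'a measure \<Rightarrow> (nat \<Rightarrow> 'a \<Rightarrow> real) \<Rightarrow> nat \<Rightarrow> 'a \<Rightarrow> cadlag" is
  "\<lambda>M X k \<omega>.
     (\<lambda>t. \<Sum>i=1..k. partial_sum X (i - 1) \<omega> / sd_sum M X k *
            indicator {var_sum M X (i - 1) / var_sum M X k ..< var_sum M X i / var_sum M X k} t)
     (1 := partial_sum X k \<omega> / sd_sum M X k)"
proof (intro conjI allI impI is_cadlag_upd_1 is_cadlag_sum is_cadlag_cmult is_cadlag_indicator)
  fix M :: "'a measure" and X :: "nat \<Rightarrow> 'a \<Rightarrow> real" and k \<omega> and t :: real
  assume t: "t \<notin> {0..1}"
  have "t \<notin> {var_sum M X (i - 1) / var_sum M X k ..< var_sum M X i / var_sum M X k}"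
    if "i \<in> {1..k}" for i
    using t that var_sum_ratio_le_1[of i k M X] var_sum_ratio_mono[of 0 "i - 1" M X k]
    by auto
  then show "((\<lambda>t. \<Sum>i=1..k. partial_sum X (i - 1) \<omega> / sd_sum M X k *
            indicator {var_sum M X (i - 1) / var_sum M X k ..< var_sum M X i / var_sum M X k} t)
     (1 := partial_sum X k \<omega> / sd_sum M X k)) t = 0"
    using t by (auto intro!: sum.neutral)
qed

lemma partial_sum_process_1:
  "apply_cadlag (partial_sum_process M X k \<omega>) 1 = partial_sum X k \<omega> / sd_sum M X k"
  by (simp add: partial_sum_process.rep_eq)

lemma partial_sum_process_interval:
  assumes i: "1 \<le> i" "i \<le> k"
    and t: "t \<in> {var_sum M X (i - 1) / var_sum M X k ..< var_sum M X i / var_sum M X k}"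
  shows "apply_cadlag (partial_sum_process M X k \<omega>) t = partial_sum X (i - 1) \<omega> / sd_sum M X k"
proof -
  define J where
    "J j = {var_sum M X (j - 1) / var_sum M X k ..< var_sum M X j / var_sum M X k}" for j
  have J: "t \<notin> J j" if "j \<noteq> i" for j
  proof (cases "j < i")
    case True
    then have "var_sum M X j / var_sum M X k \<le> var_sum M X (i - 1) / var_sum M X k"
      by (intro var_sum_ratio_mono) auto
    with t show ?thesis by (simp add: J_def)
  next
    case False
    with that have "var_sum M X i / var_sum M X k \<le> var_sum M X (j - 1) / var_sum M X k"
      by (intro var_sum_ratio_mono) auto
    with t show ?thesis by (simp add: J_def)
  qed
  have "t \<noteq> 1" using t var_sum_ratio_le_1[OF i(2), of M X] by auto
  then have "apply_cadlag (partial_sum_process M X k \<omega>) t =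
      (\<Sum>j=1..k. partial_sum X (j - 1) \<omega> / sd_sum M X k * indicator (J j) t)"
    by (simp add: partial_sum_process.rep_eq J_def)
  also have "\<dots> = (\<Sum>j\<in>{i}. partial_sum X (j - 1) \<omega> / sd_sum M X k * indicator (J j) t)"
    using i J by (intro sum.mono_neutral_right) auto
  also have "\<dots> = partial_sum X (i - 1) \<omega> / sd_sum M X k"
    using t by (simp add: J_def)
  finally show ?thesis .
qed


section \<open>The moderate deviation principle\<close>

definition log_prob :: "real \<Rightarrow> ereal" where
  "log_prob p = (if p = 0 then - \<infinity> else ereal (ln p))"

definition good_rate_function :: "('b::topological_space \<Rightarrow> ereal) \<Rightarrow> bool" where
  "good_rate_function I \<longleftrightarrow> (\<forall>\<alpha>::real. compact {x. I x \<le> ereal \<alpha>})"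

text \<open>The rows are indexed by \<open>n \<ge> 1\<close> and may live on different probability spaces.\<close>

definition moderate_deviation_principle ::
    "(nat \<Rightarrow> 'a measure) \<Rightarrow> (nat \<Rightarrow> 'a \<Rightarrow> 'b::real_normed_vector) \<Rightarrow> (nat \<Rightarrow> real) \<Rightarrow>
      ('b \<Rightarrow> ereal) \<Rightarrow> bool" where
  "moderate_deviation_principle M W a I \<longleftrightarrow>
     (\<forall>n\<ge>1. W n \<in> borel_measurable (M n)) \<and>
     good_rate_function I \<and>
     (\<forall>\<Gamma>\<in>sets borel.
        let L = (\<lambda>n. ereal (a n) *
                   log_prob (measure (M n) {\<omega> \<in> space (M n). sqrt (a n) *\<^sub>R W n \<omega> \<in> \<Gamma>}))
        in - (INF z\<in>interior \<Gamma>. I z) \<le> liminf L \<and>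
           liminf L \<le> limsup L \<and>
           limsup L \<le> - (INF z\<in>closure \<Gamma>. I z))"

definition absolutely_continuous_fun :: "real \<Rightarrow> real \<Rightarrow> (real \<Rightarrow> real) \<Rightarrow> bool" where
  "absolutely_continuous_fun a b f \<longleftrightarrow>
     (\<forall>\<epsilon>>0. \<exists>\<delta>>0. \<forall>(m::nat) u v.
        (\<forall>i<m. a \<le> u i \<and> u i \<le> v i \<and> v i \<le> b) \<and>
        (\<forall>i<m. \<forall>j<m. i \<noteq> j \<longrightarrow> {u i<..<v i} \<inter> {u j<..<v j} = {}) \<and>
        (\<Sum>i<m. v i - u i) < \<delta> \<longrightarrow>
        (\<Sum>i<m. \<bar>f (v i) - f (u i)\<bar>) < \<epsilon>)"

text \<open>An absolutely continuous function is differentiable almost everywhere, so the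
  unspecified value of \<^const>\<open>deriv\<close> at the exceptional points does not affect the integral,
  which may be infinite.\<close>

definition mdp_rate :: "cadlag \<Rightarrow> ereal" where
  "mdp_rate z =
     (if apply_cadlag z 0 = 0 \<and> absolutely_continuous_fun 0 1 (apply_cadlag z)
      then 1 / 2 * enn2ereal (\<integral>\<^sup>+u\<in>{0..1}. ennreal ((deriv (apply_cadlag z) u)\<^sup>2) \<partial>lebesgue)
      else \<infinity>)"

end

theory Submission
  imports Defs "HOL-Complex_Analysis.Great_Picard"
begin

text \<open>Truncating the normalised variables at \<open>1 / a\<close> changes the process only on an event of superexponentially
  small probability, and the two remaining hypotheses say that the logarithmic moment generating functions of the
  truncated block sums are asymptotically Gaussian, uniformly over blocks. Chernoff bounds, a tilting argument and
  Etemadi's maximal inequality then control the increments over a uniform grid and the oscillation between grid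
  points. For the upper bound, the process is close to its polygonal interpolation \<open>p\<close>, whose rate is half of the
  sum of \<open>(\<Delta>p)\<^sup>2 / \<Delta>t\<close> over the grid; this is a sum of independent variables with exponential tails of rate
  one, so it exceeds \<open>\<alpha>\<close> with probability of order \<open>exp (- \<alpha> / a)\<close>. A closed set on which the rate exceeds \<open>\<alpha>\<close> has
  positive distance from the compact level set. For the lower bound it suffices that all grid increments are close
  to those of a target function. On the analytic side, the rate equals the supremum of the sums
  \<open>(\<Delta>z)\<^sup>2 / (2 \<Delta>t)\<close> over disjoint intervals, which rests on the almost everywhere differentiability
  of absolutely continuous functions and on the fundamental theorem of calculus for them.\<close>

section \<open>Absolutely continuous functions\<close>

text \<open>In the units \<open>b n = sqrt (a n) * s n\<close> the scaled process is
  \<open>a n\<close> times a sum of variables whose variances add up to \<open>1 / a n\<close>; the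
  cut becomes \<open>1 / a n\<close> and the Lindeberg level becomes a constant. Cutting destroys
  centring, but the mean lost by one summand is at most \<open>a n\<close> times its Lindeberg term,
  hence negligible in the sum. Moment bounds are required for all subsets of a row at once, because
  the maximal inequality needs the tails of all remainders of a block simultaneously. The upper
  bound uses no convex duality: one real variable, the energy of the polygon, bounds the rate of the
  polygon. Chernoff's bound gives each of its summands the right rate, and the linear rate
  \<open>x\<close> is reproduced under independent addition because every way of splitting
  \<open>x\<close> between two summands costs \<open>x\<close>. The rate is handled through sums
  over increments because these depend continuously on finitely many values of the path:
  semicontinuity follows directly, and the grid sums are what the probability estimates
  control.\<close>

lemma absolutely_continuous_fun_family:
  fixes f :: "real \<Rightarrow> real"
  assumes "absolutely_continuous_fun a b f" "\<epsilon> > 0"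
  shows "\<exists>\<delta>>0. \<forall>(I :: 'i set) u v. finite I \<and> (\<forall>i\<in>I. a \<le> u i \<and> u i \<le> v i \<and> v i \<le> b) \<and>
      (\<forall>i\<in>I. \<forall>j\<in>I. i \<noteq> j \<longrightarrow> {u i<..<v i} \<inter> {u j<..<v j} = {}) \<and>
      (\<Sum>i\<in>I. v i - u i) < \<delta> \<longrightarrow> (\<Sum>i\<in>I. \<bar>f (v i) - f (u i)\<bar>) < \<epsilon>"
proof -
  from assms obtain \<delta> where "\<delta> > 0" and \<delta>: "\<And>(m::nat) u v.
        (\<forall>i<m. a \<le> u i \<and> u i \<le> v i \<and> v i \<le> b) \<and>
        (\<forall>i<m. \<forall>j<m. i \<noteq> j \<longrightarrow> {u i<..<v i} \<inter> {u j<..<v j} = {}) \<and>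
        (\<Sum>i<m. v i - u i) < \<delta> \<Longrightarrow> (\<Sum>i<m. \<bar>f (v i) - f (u i)\<bar>) < \<epsilon>"
    unfolding absolutely_continuous_fun_def by blast
  show ?thesis
  proof (intro exI[of _ \<delta>] conjI allI impI \<open>\<delta> > 0\<close>, elim conjE)
    fix I :: "'i set" and u v :: "'i \<Rightarrow> real"
    assume I: "finite I" and uv: "\<forall>i\<in>I. a \<le> u i \<and> u i \<le> v i \<and> v i \<le> b"
      and disj: "\<forall>i\<in>I. \<forall>j\<in>I. i \<noteq> j \<longrightarrow> {u i<..<v i} \<inter> {u j<..<v j} = {}"
      and small: "(\<Sum>i\<in>I. v i - u i) < \<delta>"
    obtain h where h: "bij_betw h {..<card I} I"
      using ex_bij_betw_nat_finite[OF I] by (auto simp: atLeast0LessThan)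
    have inI: "h i \<in> I" if "i < card I" for i
      using h that by (auto simp: bij_betw_def)
    have inj: "h i \<noteq> h j" if "i < card I" "j < card I" "i \<noteq> j" for i j
      using h that by (auto simp: bij_betw_def inj_on_def)
    have "(\<Sum>i<card I. \<bar>f (v (h i)) - f (u (h i))\<bar>) < \<epsilon>"
    proof (rule \<delta>[of "card I" "\<lambda>i. u (h i)" "\<lambda>i. v (h i)"], intro conjI allI impI)
      show "(\<Sum>i<card I. v (h i) - u (h i)) < \<delta>"
        using small sum.reindex_bij_betw[OF h, of "\<lambda>i. v i - u i"] by simp
    qed (use uv inI inj disj in auto)
    then show "(\<Sum>i\<in>I. \<bar>f (v i) - f (u i)\<bar>) < \<epsilon>"
      using sum.reindex_bij_betw[OF h, of "\<lambda>i. \<bar>f (v i) - f (u i)\<bar>"] by simp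
  qed
qed

lemma absolutely_continuous_fun_continuous_on:
  assumes "absolutely_continuous_fun a b f"
  shows "continuous_on {a..b} f"
  unfolding continuous_on_iff
proof (intro ballI allI impI)
  fix x e :: real assume x: "x \<in> {a..b}" and "0 < e"
  obtain \<delta> where "\<delta> > 0" and \<delta>: "\<And>(m::nat) u v.
        (\<forall>i<m. a \<le> u i \<and> u i \<le> v i \<and> v i \<le> b) \<and>
        (\<forall>i<m. \<forall>j<m. i \<noteq> j \<longrightarrow> {u i<..<v i} \<inter> {u j<..<v j} = {}) \<and>
        (\<Sum>i<m. v i - u i) < \<delta> \<Longrightarrow> (\<Sum>i<m. \<bar>f (v i) - f (u i)\<bar>) < e"
    using assms \<open>0 < e\<close> unfolding absolutely_continuous_fun_def by blast
  have *: "\<bar>f w - f u\<bar> < e" if "a \<le> u" "u \<le> w" "w \<le> b" "w - u < \<delta>" for u w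
    using \<delta>[of 1 "\<lambda>_. u" "\<lambda>_. w"] that by simp
  have "dist (f y) (f x) < e" if "y \<in> {a..b}" "dist y x < \<delta>" for y
    using *[of x y] *[of y x] that x by (cases "x \<le> y") (auto simp: dist_real_def)
  then show "\<exists>d>0. \<forall>x'\<in>{a..b}. dist x' x < d \<longrightarrow> dist (f x') (f x) < e"
    using \<open>\<delta> > 0\<close> by blast
qed

text \<open>A finite form of Vitali's theorem: on the line closed intervals are balls, so the
  covering theorem for balls yields a countable disjoint family that misses only a null set of
  \<open>S\<close>, and continuity from above cuts it down to finitely many. \<open>P\<close> later
  carries a condition on the difference quotient. The intervals need only straddle the point, they
  are not centred at it.\<close>

lemma Vitali_covering_intervals:
  fixes S :: "real set"
  assumes S: "S \<in> lmeasurable" and U: "open U" "S \<subseteq> U" and "e > 0"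
    and P: "\<And>x d. x \<in> S \<Longrightarrow> d > 0 \<Longrightarrow> \<exists>u v. P u v \<and> u < x \<and> x < v \<and> v - u < d"
  obtains D where "finite D"
    "\<And>u v. (u, v) \<in> D \<Longrightarrow> P u v \<and> u < v \<and> {u..v} \<subseteq> U"
    "pairwise (\<lambda>i j. disjnt {fst i..snd i} {fst j..snd j}) D"
    "measure lebesgue (S - (\<Union>(u, v)\<in>D. {u..v})) < e"
proof -
  define K where "K = {(u, v). P u v \<and> u < v \<and> {u..v} \<subseteq> U}"
  define c where "c i = (fst i + snd i) / 2" for i :: "real \<times> real"
  define r where "r i = (snd i - fst i) / 2" for i :: "real \<times> real"
  have cb: "cball (c i) (r i) = {fst i..snd i}" for i
    unfolding c_def r_def cball_eq_atLeastAtMost by (simp add: field_simps)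
  obtain C where C: "countable C" "C \<subseteq> K"
    "pairwise (\<lambda>i j. disjnt (cball (c i) (r i)) (cball (c j) (r j))) C"
    "negligible (S - (\<Union>i \<in> C. cball (c i) (r i)))"
  proof (rule Vitali_covering_theorem_cballs[of K r S c])
    show "\<And>i. i \<in> K \<Longrightarrow> 0 < r i" by (auto simp: K_def r_def)
    fix x d :: real assume x: "x \<in> S" "0 < d"
    then obtain e where e: "e > 0" "cball x e \<subseteq> U"
      using U by (meson open_contains_cball subsetD)
    obtain u v where uv: "P u v" "u < x" "x < v" "v - u < min d e"
      using P[of x "min d e"] x e by auto
    have "{u..v} \<subseteq> cball x e" using uv by (auto simp: cball_eq_atLeastAtMost)
    then show "\<exists>i. i \<in> K \<and> x \<in> cball (c i) (r i) \<and> r i < d"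
      using uv e unfolding cb by (intro exI[of _ "(u, v)"]) (auto simp: K_def r_def)
  qed
  \<comment> \<open>Finite initial pieces of the countable family; the uncovered remainders
    \<open>A n\<close> decrease to a null set.\<close>
  define Cn where "Cn n = {i \<in> C. to_nat_on C i < n}" for n
  define A where "A n = S - (\<Union>i \<in> Cn n. {fst i..snd i})" for n
  have fin: "finite (Cn n)" for n
  proof (rule inj_on_finite[of "to_nat_on C" _ "{..<n}"])
    show "inj_on (to_nat_on C) (Cn n)"
      using inj_on_to_nat_on[OF C(1)] by (rule inj_on_subset) (auto simp: Cn_def)
  qed (auto simp: Cn_def)
  have Am: "A n \<in> lmeasurable" for n
    unfolding A_def using S fin by (intro fmeasurable.Diff sets.finite_UN) auto
  have "(\<lambda>n. measure lebesgue (A n)) \<longlonglongrightarrow> measure lebesgue (\<Inter>n. A n)"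
  proof (rule Lim_measure_decseq)
    show "range A \<subseteq> sets lebesgue" using Am by auto
    show "decseq A" unfolding decseq_def A_def Cn_def by fastforce
    show "emeasure lebesgue (A i) \<noteq> \<infinity>" for i using fmeasurableD2[OF Am] by (simp add: top_unique)
  qed
  moreover have "(\<Inter>n. A n) = S - (\<Union>i \<in> C. cball (c i) (r i))"
    by (auto simp: A_def Cn_def cb)
  ultimately have "(\<lambda>n. measure lebesgue (A n)) \<longlonglongrightarrow> 0"
    using C(4) by (simp add: negligible_imp_measure0)
  then have "\<forall>\<^sub>F n in sequentially. measure lebesgue (A n) < e"
    using \<open>e > 0\<close> by (rule order_tendstoD(2))
  then obtain n where n: "measure lebesgue (A n) < e"
    using eventually_happens'[OF sequentially_bot] by blast
  show ?thesis
  proof (rule that[of "Cn n"])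
    show "measure lebesgue (S - (\<Union>(u, v)\<in>Cn n. {u..v})) < e"
      using n by (simp add: A_def case_prod_beta)
    show "pairwise (\<lambda>i j. disjnt {fst i..snd i} {fst j..snd j}) (Cn n)"
      using C(3) unfolding cb by (rule pairwise_subset) (auto simp: Cn_def)
    show "P u v \<and> u < v \<and> {u..v} \<subseteq> U" if "(u, v) \<in> Cn n" for u v
      using C(2) that by (auto simp: Cn_def K_def)
  qed (rule fin)
qed

section \<open>Nested families of disjoint intervals and exceptional sets of difference
  quotients\<close>

lemma measure_disjoint_intervals:
  fixes D :: "(real \<times> real) set"
  assumes "finite D" "\<And>u v. (u, v) \<in> D \<Longrightarrow> u < v"
    and "pairwise (\<lambda>i j. disjnt {fst i..snd i} {fst j..snd j}) D"
  shows "measure lebesgue (\<Union>(u, v)\<in>D. {u..v}) = (\<Sum>(u, v)\<in>D. v - u)"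
proof -
  have "measure lebesgue (\<Union>i\<in>D. {fst i..snd i}) = (\<Sum>i\<in>D. measure lebesgue {fst i..snd i})"
    using assms(1,3) by (intro measure_finite_Union)
      (auto simp: disjoint_family_on_def pairwise_def disjnt_def emeasure_lborel_Icc_eq)
  also have "\<dots> = (\<Sum>i\<in>D. snd i - fst i)"
    using assms(2) by (intro sum.cong) (auto simp: less_imp_le)
  finally show ?thesis by (simp add: case_prod_beta)
qed

text \<open>Tagging every cell with its left endpoint turns the division into a tagged one, for
  which increments telescope.\<close>

lemma sum_division_endpoint_diff:
  fixes f :: "real \<Rightarrow> real"
  assumes "d division_of {u..v}" "u \<le> v"
  shows "(\<Sum>K\<in>d. f (Sup K) - f (Inf K)) = f v - f u"
proof -
  let ?p = "(\<lambda>K. (Inf K, K)) ` d"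
  have ne: "Inf K \<in> K" if K: "K \<in> d" for K
  proof -
    obtain x y where "K = {x..y}" "x \<le> y"
      using division_ofD(3,4)[OF assms(1) K] by (auto simp: box_real)
    then show ?thesis by simp
  qed
  have "?p tagged_division_of {u..v}"
  proof (rule tagged_division_ofI)
    show "finite ?p" using assms(1) by blast
    show "\<Union>{K. \<exists>x. (x, K) \<in> ?p} = {u..v}"
      using division_ofD(6)[OF assms(1)] by (force simp: image_iff)
    fix x K assume xK: "(x, K) \<in> ?p"
    then show "x \<in> K" "K \<subseteq> {u..v}" "\<exists>a b. K = cbox a b"
      using division_ofD(2,4)[OF assms(1)] ne by auto
    fix y K' assume "(y, K') \<in> ?p" "(x, K) \<noteq> (y, K')"
    then show "interior K \<inter> interior K' = {}"
      using xK division_ofD(5)[OF assms(1), of K K'] by fastforce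
  qed
  from additive_tagged_division_1[OF assms(2) this, of f] show ?thesis
    by (simp add: sum.reindex inj_on_def)
qed

text \<open>The parts of \<open>C\<close> left over by \<open>D\<close> form finitely many intervals
  with disjoint interiors and total length below \<delta>, and their increments add up to the
  difference of the two sums; absolute continuity bounds them.\<close>

lemma absolutely_continuous_fun_subfamily:
  fixes f :: "real \<Rightarrow> real"
  assumes ac: "absolutely_continuous_fun a b f" and "\<epsilon> > 0"
  shows "\<exists>\<delta>>0. \<forall>C D. finite C \<and> finite D \<and>
      (\<forall>(u, v)\<in>C. a \<le> u \<and> u < v \<and> v \<le> b) \<and> (\<forall>(u, v)\<in>D. u < v) \<and>
      pairwise (\<lambda>i j. disjnt {fst i..snd i} {fst j..snd j}) C \<and>
      pairwise (\<lambda>i j. disjnt {fst i..snd i} {fst j..snd j}) D \<and>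
      (\<forall>j\<in>D. \<exists>i\<in>C. {fst j..snd j} \<subseteq> {fst i..snd i}) \<and>
      (\<Sum>(u, v)\<in>C. v - u) - (\<Sum>(u, v)\<in>D. v - u) < \<delta> \<longrightarrow>
      \<bar>(\<Sum>(u, v)\<in>C. f v - f u) - (\<Sum>(u, v)\<in>D. f v - f u)\<bar> < \<epsilon>"
proof -
  obtain \<delta> where "\<delta> > 0" and \<delta>: "\<And>(I :: ((real \<times> real) \<times> real set) set) u v. finite I \<and> 
      (\<forall>i\<in>I. a \<le> u i \<and> u i \<le> v i \<and> v i \<le> b) \<and>
      (\<forall>i\<in>I. \<forall>j\<in>I. i \<noteq> j \<longrightarrow> {u i<..<v i} \<inter> {u j<..<v j} = {}) \<and>
      (\<Sum>i\<in>I. v i - u i) < \<delta> \<Longrightarrow> (\<Sum>i\<in>I. \<bar>f (v i) - f (u i)\<bar>) < \<epsilon>"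
    using absolutely_continuous_fun_family[OF assms, where ?'i = "(real \<times> real) \<times> real set"] by blast
  show ?thesis
  proof (intro exI[of _ \<delta>] conjI allI impI \<open>\<delta> > 0\<close>, elim conjE)
    fix C D :: "(real \<times> real) set"
    assume fin: "finite C" "finite D" and C: "\<forall>(u, v)\<in>C. a \<le> u \<and> u < v \<and> v \<le> b"
      and D: "\<forall>(u, v)\<in>D. u < v"
      and dC: "pairwise (\<lambda>i j. disjnt {fst i..snd i} {fst j..snd j}) C"
      and dD: "pairwise (\<lambda>i j. disjnt {fst i..snd i} {fst j..snd j}) D"
      and sub: "\<forall>j\<in>D. \<exists>i\<in>C. {fst j..snd j} \<subseteq> {fst i..snd i}"
      and small: "(\<Sum>(u, v)\<in>C. v - u) - (\<Sum>(u, v)\<in>D. v - u) < \<delta>"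
    define J where "J i = {j \<in> D. {fst j..snd j} \<subseteq> {fst i..snd i}}" for i
    define p where "p i = (\<lambda>j. {fst j..snd j}) ` J i" for i
    have C': "a \<le> fst i" "fst i < snd i" "snd i \<le> b" if "i \<in> C" for i using C that by auto
    have D': "fst i < snd i" if "i \<in> D" for i using D that by auto
    have finJ: "finite (J i)" for i using fin by (simp add: J_def)
    have pdiv: "p i division_of (\<Union>(p i))" for i
    proof (rule division_ofI)
      show "finite (p i)" using finJ by (simp add: p_def)
      show "K \<noteq> {}" if "K \<in> p i" for K using that D' by (force simp: p_def J_def)
      show "\<exists>x y. K = cbox x y" if "K \<in> p i" for K using that by (auto simp: p_def box_real)
      fix K K' assume "K \<in> p i" "K' \<in> p i" "K \<noteq> K'"
      then obtain j j' where "j \<in> D" "j' \<in> D" "K = {fst j..snd j}" "K' = {fst j'..snd j'}" "j \<noteq> j'"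
        by (auto simp: p_def J_def)
      then have "K \<inter> K' = {}"
        using dD unfolding pairwise_def disjnt_def by blast
      then show "interior K \<inter> interior K' = {}"
        using interior_subset by blast
    qed auto
    \<comment> \<open>Inside each interval of \<open>C\<close>, the intervals of \<open>D\<close>
      lying in it are completed to a division; the added cells are the gaps.\<close>
    have "\<exists>q. p i \<subseteq> q \<and> q division_of {fst i..snd i}" for i
      using partial_division_extend_interval[OF pdiv[of i], of "fst i" "snd i"]
      unfolding box_real by (fastforce simp: p_def J_def)
    then obtain q where q: "\<And>i. p i \<subseteq> q i" "\<And>i. q i division_of {fst i..snd i}"
      by metis
    have finq: "finite (q i)" for i using q(2) by blast
    define R where "R = Sigma C (\<lambda>i. q i - p i)"
    have finR: "finite R" using fin finq by (auto simp: R_def)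
    have qK: "\<exists>x y. K = {x..y} \<and> x \<le> y \<and> fst i \<le> x \<and> y \<le> snd i" if K: "K \<in> q i" for i K
    proof -
      obtain x y where "K = {x..y}" using division_ofD(4)[OF q(2) K] by (auto simp: box_real)
      then show ?thesis using division_ofD(2,3)[OF q(2) K] by auto
    qed
    \<comment> \<open>Stated for arbitrary \<open>g\<close>: the identity gives the total length of
      the gaps, \<open>f\<close> their total increment.\<close>
    have rest: "(\<Sum>r\<in>R. g (Sup (snd r)) - g (Inf (snd r))) =
        (\<Sum>(u, v)\<in>C. g v - g u) - (\<Sum>(u, v)\<in>D. g v - g u)" for g :: "real \<Rightarrow> real"
    proof -
      have inj: "inj_on (\<lambda>j. {fst j..snd j}) (J i)" for i
      proof (rule inj_onI)
        fix x y assume xy: "x \<in> J i" "y \<in> J i" "{fst x..snd x} = {fst y..snd y}"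
        then show "x = y" using D'[of x] D'[of y] by (auto simp: J_def prod_eq_iff)
      qed
      have "(\<Sum>r\<in>R. g (Sup (snd r)) - g (Inf (snd r))) =
          (\<Sum>i\<in>C. \<Sum>K\<in>q i - p i. g (Sup K) - g (Inf K))"
        unfolding R_def using fin finq by (subst sum.Sigma) (auto simp: case_prod_beta)
      also have "\<dots> = (\<Sum>i\<in>C. (\<Sum>K\<in>q i. g (Sup K) - g (Inf K)) - (\<Sum>K\<in>p i. g (Sup K) - g (Inf K)))"
        using q(1) finq by (intro sum.cong refl sum_diff) auto
      also have "\<dots> = (\<Sum>i\<in>C. (g (snd i) - g (fst i)) - (\<Sum>j\<in>J i. g (snd j) - g (fst j)))"
      proof (intro sum.cong refl arg_cong2[where f = "(-)"])
        fix i assume "i \<in> C"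
        then show "(\<Sum>K\<in>q i. g (Sup K) - g (Inf K)) = g (snd i) - g (fst i)"
          using sum_division_endpoint_diff[OF q(2)] C' by (simp add: less_imp_le)
        show "(\<Sum>K\<in>p i. g (Sup K) - g (Inf K)) = (\<Sum>j\<in>J i. g (snd j) - g (fst j))"
          unfolding p_def using inj D'
          by (subst sum.reindex) (auto intro!: sum.cong simp: J_def less_imp_le)
      qed
      also have "\<dots> = (\<Sum>i\<in>C. g (snd i) - g (fst i)) - (\<Sum>i\<in>C. \<Sum>j\<in>J i. g (snd j) - g (fst j))"
        by (simp add: sum_subtractf)
      also have "(\<Sum>i\<in>C. \<Sum>j\<in>J i. g (snd j) - g (fst j)) = (\<Sum>j\<in>(\<Union>i\<in>C. J i). g (snd j) - g (fst j))"
      proof (rule sum.UNION_disjoint[symmetric])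
        show "\<forall>i\<in>C. \<forall>j\<in>C. i \<noteq> j \<longrightarrow> J i \<inter> J j = {}"
        proof (intro ballI impI equals0I)
          fix i j x assume ij: "i \<in> C" "j \<in> C" "i \<noteq> j" "x \<in> J i \<inter> J j"
          then have "fst x \<in> {fst x..snd x}" "{fst x..snd x} \<subseteq> {fst i..snd i}"
            "{fst x..snd x} \<subseteq> {fst j..snd j}"
            using D'[of x] by (auto simp: J_def)
          moreover have "{fst i..snd i} \<inter> {fst j..snd j} = {}"
            using dC ij unfolding pairwise_def disjnt_def by blast
          ultimately show False by blast
        qed
      qed (use fin finJ in auto)
      also have "(\<Union>i\<in>C. J i) = D" using sub by (auto simp: J_def)
      finally show ?thesis by (simp add: case_prod_beta)
    qed
    have "(\<Sum>r\<in>R. \<bar>f (Sup (snd r)) - f (Inf (snd r))\<bar>) < \<epsilon>"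
    proof (rule \<delta>, intro conjI ballI impI)
      fix r assume "r \<in> R"
      then have r: "fst r \<in> C" "snd r \<in> q (fst r)" by (auto simp: R_def)
      from qK[OF r(2)] C'[OF r(1)]
      show "a \<le> Inf (snd r)" "Inf (snd r) \<le> Sup (snd r)" "Sup (snd r) \<le> b" by auto
      fix s assume "s \<in> R" and "r \<noteq> s"
      then have s: "fst s \<in> C" "snd s \<in> q (fst s)" by (auto simp: R_def)
      obtain x y where xy: "snd r = {x..y}" "x \<le> y" using qK[OF r(2)] by auto
      obtain x' y' where xy': "snd s = {x'..y'}" "x' \<le> y'" using qK[OF s(2)] by auto
      have "interior (snd r) \<inter> interior (snd s) = {}"
      proof (cases "fst r = fst s")
        case True
        then show ?thesis using division_ofD(5)[OF q(2) r(2), of "snd s"] s \<open>r \<noteq> s\<close>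
          by (metis prod_eq_iff)
      next
        case False
        then have "{fst (fst r)..snd (fst r)} \<inter> {fst (fst s)..snd (fst s)} = {}"
          using dC r s unfolding pairwise_def disjnt_def by blast
        moreover have "snd r \<subseteq> {fst (fst r)..snd (fst r)}" "snd s \<subseteq> {fst (fst s)..snd (fst s)}"
          using qK[OF r(2)] qK[OF s(2)] by auto
        ultimately show ?thesis using interior_subset by blast
      qed
      then show "{Inf (snd r)<..<Sup (snd r)} \<inter> {Inf (snd s)<..<Sup (snd s)} = {}"
        using xy xy' by (simp add: interior_atLeastAtMost_real)
    next
      show "(\<Sum>r\<in>R. Sup (snd r) - Inf (snd r)) < \<delta>"
        using small rest[of "\<lambda>x. x"] by simp
    qed (rule finR)
    moreover have "\<bar>\<Sum>r\<in>R. f (Sup (snd r)) - f (Inf (snd r))\<bar> \<le> (\<Sum>r\<in>R. \<bar>f (Sup (snd r)) - f (Inf (snd r))\<bar>)"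
      by (rule sum_abs)
    ultimately show "\<bar>(\<Sum>(u, v)\<in>C. f v - f u) - (\<Sum>(u, v)\<in>D. f v - f u)\<bar> < \<epsilon>"
      unfolding rest by linarith
  qed
qed

text \<open>The set is covered twice by Vitali's theorem: by disjoint intervals with difference quotient
  below \<open>p\<close>, and inside these by disjoint intervals with quotient above \<open>q\<close>. The two unions nearly agree,
  so absolute continuity makes the two total increments nearly equal.\<close>

lemma absolutely_continuous_fun_oscillating_negligible:
  assumes ac: "absolutely_continuous_fun a b f" and "p < q"
    and E: "E \<in> sets lebesgue" "E \<subseteq> {a<..<b}"
    and lo: "\<And>x d. x \<in> E \<Longrightarrow> d > 0 \<Longrightarrow> \<exists>u v. f v - f u < p * (v - u) \<and> u < x \<and> x < v \<and> v - u < d"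
    and hi: "\<And>x d. x \<in> E \<Longrightarrow> d > 0 \<Longrightarrow> \<exists>u v. f v - f u > q * (v - u) \<and> u < x \<and> x < v \<and> v - u < d"
  shows "negligible E"
proof -
  have Em: "E \<in> lmeasurable"
    using E by (intro bounded_set_imp_lmeasurable) (auto intro: bounded_subset[OF bounded_Ioo])
  define e where "e = measure lebesgue E"
  have "\<not> e > 0"
  proof
    assume "e > 0"
    define \<epsilon> where "\<epsilon> = (q - p) * e / 4"
    have "\<epsilon> > 0" using \<open>e > 0\<close> \<open>p < q\<close> by (simp add: \<epsilon>_def)
    obtain \<delta> where "\<delta> > 0" and \<delta>: "\<And>C D. finite C \<and> finite D \<and>
      (\<forall>(u, v)\<in>C. a \<le> u \<and> u < v \<and> v \<le> b) \<and> (\<forall>(u, v)\<in>D. u < v) \<and>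
      pairwise (\<lambda>i j. disjnt {fst i..snd i} {fst j..snd j}) C \<and>
      pairwise (\<lambda>i j. disjnt {fst i..snd i} {fst j..snd j}) D \<and>
      (\<forall>j\<in>D. \<exists>i\<in>C. {fst j..snd j} \<subseteq> {fst i..snd i}) \<and>
      (\<Sum>(u, v)\<in>C. v - u) - (\<Sum>(u, v)\<in>D. v - u) < \<delta> \<Longrightarrow>
      \<bar>(\<Sum>(u, v)\<in>C. f v - f u) - (\<Sum>(u, v)\<in>D. f v - f u)\<bar> < \<epsilon>"
      using absolutely_continuous_fun_subfamily[OF ac \<open>\<epsilon> > 0\<close>] by blast
    \<comment> \<open>Each approximation below loses measure less than \<eta>. The three bounds keep
      the lost length below \<delta>, keep at least three quarters of \<open>e\<close> covered, and
      make the error \<open>\<bar>q\<bar> * (L C - L D)\<close> small whatever the sign of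
      \<open>q\<close>.\<close>
    define \<eta> where "\<eta> = min (\<delta> / 3) (min (e / 4) ((q - p) * e / (12 * (\<bar>q\<bar> + 1))))"
    have "\<eta> > 0" using \<open>\<delta> > 0\<close> \<open>e > 0\<close> \<open>p < q\<close> by (simp add: \<eta>_def add_nonneg_pos)
    have \<eta>: "3 * \<eta> \<le> \<delta>" "\<eta> \<le> e / 4" "3 * \<bar>q\<bar> * \<eta> \<le> (q - p) * e / 4"
    proof -
      have "\<eta> \<le> (q - p) * e / (12 * (\<bar>q\<bar> + 1))" by (simp add: \<eta>_def)
      then have "\<eta> * (12 * (\<bar>q\<bar> + 1)) \<le> (q - p) * e" by (simp add: pos_le_divide_eq)
      moreover have "\<eta> * (12 * (\<bar>q\<bar> + 1)) = 12 * (\<bar>q\<bar> * \<eta>) + 12 * \<eta>" by (simp add: algebra_simps)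
      ultimately show "3 * \<bar>q\<bar> * \<eta> \<le> (q - p) * e / 4" using \<open>\<eta> > 0\<close> by simp
      show "3 * \<eta> \<le> \<delta>" "\<eta> \<le> e / 4" unfolding \<eta>_def by linarith+
    qed
    obtain T where T: "open T" "E \<subseteq> T" "T - E \<in> lmeasurable" "emeasure lebesgue (T - E) < ennreal \<eta>"
      using sets_lebesgue_outer_open[OF E(1) \<open>\<eta> > 0\<close>] by blast
    define U where "U = T \<inter> {a<..<b}"
    have U: "open U" "E \<subseteq> U" "U \<subseteq> {a<..<b}" using T E by (auto simp: U_def)
    have UE: "U - E \<in> lmeasurable"
      using U Em by (intro bounded_set_imp_lmeasurable) (auto intro: bounded_subset[OF bounded_Ioo] fmeasurableD)
    have "measure lebesgue (U - E) \<le> measure lebesgue (T - E)"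
      using T UE by (intro measure_mono_fmeasurable) (auto simp: U_def)
    also have "\<dots> < \<eta>"
      using T(3,4) \<open>\<eta> > 0\<close> by (simp add: emeasure_eq_measure2 ennreal_less_iff)
    finally have mUE: "measure lebesgue (U - E) < \<eta>" .
    obtain C where C: "finite C"
      "\<And>u v. (u, v) \<in> C \<Longrightarrow> f v - f u < p * (v - u) \<and> u < v \<and> {u..v} \<subseteq> U"
      "pairwise (\<lambda>i j. disjnt {fst i..snd i} {fst j..snd j}) C"
      "measure lebesgue (E - (\<Union>(u, v)\<in>C. {u..v})) < \<eta>"
      by (rule Vitali_covering_intervals[OF Em U(1,2) \<open>\<eta> > 0\<close>], rule lo, assumption+, rule that)
    have Cq: "f v - f u < p * (v - u)" "u < v" "{u..v} \<subseteq> U" if "(u, v) \<in> C" for u v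
      using C(2)[OF that] by blast+
    \<comment> \<open>Interiors give every point room on both sides: short enough intervals around
      it stay within a single interval of \<open>C\<close>. Only the finitely many endpoints are
      lost.\<close>
    define U' where "U' = (\<Union>(u, v)\<in>C. {u<..<v})"
    have "open U'" by (auto simp: U'_def)
    have U'm: "U' \<in> sets lebesgue" using \<open>open U'\<close> by simp
    have E'm: "E \<inter> U' \<in> lmeasurable" using Em U'm by (simp add: fmeasurable_Int_fmeasurable)
    obtain D where D: "finite D"
      "\<And>u v. (u, v) \<in> D \<Longrightarrow> (f v - f u > q * (v - u) \<and> (\<exists>i\<in>C. {u..v} \<subseteq> {fst i..snd i})) \<and> u < v \<and> {u..v} \<subseteq> U'"
      "pairwise (\<lambda>i j. disjnt {fst i..snd i} {fst j..snd j}) D"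
      "measure lebesgue (E \<inter> U' - (\<Union>(u, v)\<in>D. {u..v})) < \<eta>"
    proof (rule Vitali_covering_intervals[OF E'm \<open>open U'\<close> Int_lower2 \<open>\<eta> > 0\<close>,
          of "\<lambda>u v. f v - f u > q * (v - u) \<and> (\<exists>i\<in>C. {u..v} \<subseteq> {fst i..snd i})"])
      fix x d :: real assume x: "x \<in> E \<inter> U'" and "d > 0"
      then obtain i where i: "i \<in> C" "fst i < x" "x < snd i" by (auto simp: U'_def)
      obtain u v where uv: "f v - f u > q * (v - u)" "u < x" "x < v" "v - u < min d (min (x - fst i) (snd i - x))"
        using hi[of x "min d (min (x - fst i) (snd i - x))"] x i \<open>d > 0\<close> by auto
      then show "\<exists>u v. (q * (v - u) < f v - f u \<and> (\<exists>i\<in>C. {u..v} \<subseteq> {fst i..snd i})) \<and> u < x \<and> x < v \<and> v - u < d"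
        using i by (intro exI[of _ u] exI[of _ v]) (auto intro!: bexI[of _ i])
    qed (rule that)
    have Dq: "f v - f u > q * (v - u)" "\<exists>i\<in>C. {u..v} \<subseteq> {fst i..snd i}" "u < v" if "(u, v) \<in> D" for u v
      using D(2)[OF that] by blast+
    have E'D: "E \<inter> U' - (\<Union>(u, v)\<in>D. {u..v}) \<in> lmeasurable"
      using E'm D(1) by (intro fmeasurable.Diff) (auto intro!: fmeasurable.finite_UN)
    define L where "L F = (\<Sum>(u, v)\<in>F. v - u)" for F :: "(real \<times> real) set"
    have LC: "measure lebesgue (\<Union>(u, v)\<in>C. {u..v}) = L C"
      unfolding L_def by (rule measure_disjoint_intervals[OF C(1) Cq(2) C(3)])
    have LD: "measure lebesgue (\<Union>(u, v)\<in>D. {u..v}) = L D"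
      unfolding L_def by (rule measure_disjoint_intervals[OF D(1) Dq(3) D(3)])
    have Cm: "(\<Union>(u, v)\<in>C. {u..v}) \<in> lmeasurable" using C(1) by (auto intro!: fmeasurable.finite_UN)
    have Dm: "(\<Union>(u, v)\<in>D. {u..v}) \<in> lmeasurable" using D(1) by (auto intro!: fmeasurable.finite_UN)
    have "e \<le> measure lebesgue ((\<Union>(u, v)\<in>C. {u..v}) \<union> (E - (\<Union>(u, v)\<in>C. {u..v})))"
      unfolding e_def using Em Cm by (intro measure_mono_fmeasurable) auto
    also have "\<dots> \<le> L C + measure lebesgue (E - (\<Union>(u, v)\<in>C. {u..v}))"
      unfolding LC[symmetric] using Em Cm by (intro measure_Un_le) auto
    finally have eC: "e < L C + \<eta>" using C(4) by simp
    define N where "N = fst ` C \<union> snd ` C"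
    have N: "N \<in> lmeasurable" "measure lebesgue N = 0"
      using C(1) negligible_finite[of N] by (auto simp: N_def negligible_iff_measure)
    have "L C \<le> measure lebesgue ((((\<Union>(u, v)\<in>D. {u..v}) \<union> (U - E)) \<union> (E \<inter> U' - (\<Union>(u, v)\<in>D. {u..v}))) \<union> N)"
      unfolding LC[symmetric]
    proof (intro measure_mono_fmeasurable fmeasurable.Un E'D)
      show "(\<Union>(u, v)\<in>C. {u..v}) \<subseteq> (\<Union>(u, v)\<in>D. {u..v}) \<union> (U - E) \<union> (E \<inter> U' - (\<Union>(u, v)\<in>D. {u..v})) \<union> N"
      proof
        fix x assume "x \<in> (\<Union>(u, v)\<in>C. {u..v})"
        then obtain u v where uv: "(u, v) \<in> C" "u \<le> x" "x \<le> v" by auto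
        then have "x \<in> U" using Cq(3)[OF uv(1)] by auto
        moreover have "x \<in> N \<or> x \<in> U'"
          using uv by (cases "x = u \<or> x = v") (force simp: N_def U'_def)+
        ultimately show "x \<in> (\<Union>(u, v)\<in>D. {u..v}) \<union> (U - E) \<union> (E \<inter> U' - (\<Union>(u, v)\<in>D. {u..v})) \<union> N"
          by blast
      qed
    qed (use Cm Dm UE E'm N in auto)
    also have "\<dots> \<le> ((L D + measure lebesgue (U - E)) + measure lebesgue (E \<inter> U' - (\<Union>(u, v)\<in>D. {u..v}))) + measure lebesgue N"
      unfolding LD[symmetric] using Dm UE E'm N
      by (intro order_trans[OF measure_Un_le] add_right_mono) auto
    also have "\<dots> < L D + 2 * \<eta>" using mUE D(4) N by simp
    finally have CD: "L C < L D + 2 * \<eta>" .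
    have "\<bar>(\<Sum>(u, v)\<in>C. f v - f u) - (\<Sum>(u, v)\<in>D. f v - f u)\<bar> < \<epsilon>"
    proof (rule \<delta>, intro conjI)
      show "finite C" "finite D" by fact+
      show "pairwise (\<lambda>i j. disjnt {fst i..snd i} {fst j..snd j}) C"
        "pairwise (\<lambda>i j. disjnt {fst i..snd i} {fst j..snd j}) D" by fact+
      show "\<forall>(u, v)\<in>C. a \<le> u \<and> u < v \<and> v \<le> b"
      proof safe
        fix u v assume "(u, v) \<in> C"
        then have uv: "u < v" "{u..v} \<subseteq> {a<..<b}" using Cq[of u v] U(3) by blast+
        then have "u \<in> {a<..<b}" "v \<in> {a<..<b}" by (meson atLeastAtMost_iff less_imp_le order_refl subsetD)+
        then show "a \<le> u" "u < v" "v \<le> b" using uv by auto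
      qed
      show "\<forall>(u, v)\<in>D. u < v" using Dq(3) by blast
      show "\<forall>j\<in>D. \<exists>i\<in>C. {fst j..snd j} \<subseteq> {fst i..snd i}" 
      proof
        fix j assume "j \<in> D"
        then show "\<exists>i\<in>C. {fst j..snd j} \<subseteq> {fst i..snd i}" using Dq(2)[of "fst j" "snd j"] by simp
      qed
      show "(\<Sum>(u, v)\<in>C. v - u) - (\<Sum>(u, v)\<in>D. v - u) < \<delta>"
        using CD \<eta>(1) \<open>\<eta> > 0\<close> by (simp add: L_def)
    qed
    moreover have "(\<Sum>(u, v)\<in>C. f v - f u) \<le> p * L C"
      unfolding L_def sum_distrib_left using Cq(1) by (intro sum_mono) (auto intro: less_imp_le)
    moreover have "(\<Sum>(u, v)\<in>D. f v - f u) \<ge> q * L D"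
      unfolding L_def sum_distrib_left using Dq(1) by (intro sum_mono) (auto intro: less_imp_le)
    ultimately have less: "q * L D < p * L C + \<epsilon>" by linarith
    have "L D \<le> L C"
      unfolding LC[symmetric] LD[symmetric]
    proof (rule measure_mono_fmeasurable)
      show "(\<Union>(u, v)\<in>D. {u..v}) \<subseteq> (\<Union>(u, v)\<in>C. {u..v})"
      proof safe
        fix x u v assume "(u, v) \<in> D" "x \<in> {u..v}"
        then obtain i where "i \<in> C" "x \<in> {fst i..snd i}" using Dq(2)[of u v] by blast
        then show "x \<in> (\<Union>(u, v)\<in>C. {u..v})" by (intro UN_I[of i]) auto
      qed
    qed (use Dm Cm in auto)
    then have "\<bar>q\<bar> * (L C - L D) \<le> 3 * \<bar>q\<bar> * \<eta>"
      unfolding mult.assoc mult.left_commute[of 3] using CD \<open>\<eta> > 0\<close> by (intro mult_left_mono) auto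
    then have "\<bar>q\<bar> * (L C - L D) \<le> (q - p) * e / 4"
      using \<eta>(3) by linarith
    moreover have "q * (L C - L D) \<le> \<bar>q\<bar> * (L C - L D)"
      using \<open>L D \<le> L C\<close> by (intro mult_right_mono) auto
    ultimately have "q * (L C - L D) \<le> (q - p) * e / 4" by linarith
    then have "q * L C \<le> q * L D + (q - p) * e / 4"
      unfolding right_diff_distrib by linarith
    \<comment> \<open>Two errors of size \<open>(q - p) * e / 4\<close> add up to half of
      \<open>(q - p) * e\<close>, whereas \<open>L C\<close> is at least three quarters of
      \<open>e\<close>.\<close>
    then have "(q - p) * L C < (q - p) * (e / 2)"
      using less unfolding \<epsilon>_def left_diff_distrib[of q p "L C"] by simp
    moreover have "(q - p) * L C \<ge> (q - p) * (3 * e / 4)"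
      using eC \<eta>(2) \<open>p < q\<close> by (intro mult_left_mono) auto
    ultimately show False using \<open>e > 0\<close> \<open>p < q\<close> by (simp add: mult_less_cancel_left)
  qed
  then show ?thesis
    using Em measure_nonneg[of lebesgue E] by (simp add: negligible_iff_measure0 e_def)
qed

text \<open>Negligibility is local, so it suffices to treat a piece \<open>F\<close> inside an
  interval shorter than \<delta>. If \<open>F\<close> had measure \<open>e > 0\<close>, disjoint
  intervals of slope above \<open>2 / e\<close> and total length above \<open>e / 2\<close> would
  have total increment above 1, although their total length is below \<delta>.\<close>

lemma absolutely_continuous_fun_steep_negligible:
  assumes ac: "absolutely_continuous_fun a b f"
    and E: "E \<in> sets lebesgue" "E \<subseteq> {a<..<b}"
    and steep: "\<And>x d c. x \<in> E \<Longrightarrow> d > 0 \<Longrightarrow> \<exists>u v. \<bar>f v - f u\<bar> > c * (v - u) \<and> u < x \<and> x < v \<and> v - u < d"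
  shows "negligible E"
proof -
  obtain \<delta> where "\<delta> > 0" and \<delta>: "\<And>(I :: (real \<times> real) set) u v. finite I \<and> 
      (\<forall>i\<in>I. a \<le> u i \<and> u i \<le> v i \<and> v i \<le> b) \<and>
      (\<forall>i\<in>I. \<forall>j\<in>I. i \<noteq> j \<longrightarrow> {u i<..<v i} \<inter> {u j<..<v j} = {}) \<and>
      (\<Sum>i\<in>I. v i - u i) < \<delta> \<Longrightarrow> (\<Sum>i\<in>I. \<bar>f (v i) - f (u i)\<bar>) < 1"
    using absolutely_continuous_fun_family[OF ac, of 1, where ?'i = "real \<times> real"] by auto
  have "\<exists>F. openin (top_of_set E) F \<and> z \<in> F \<and> negligible F" if "z \<in> E" for z
  proof -
    define V where "V = {z - \<delta> / 3<..<z + \<delta> / 3} \<inter> {a<..<b}"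
    define F where "F = E \<inter> V"
    have V: "open V" by (auto simp: V_def)
    have "bounded F" by (rule bounded_subset[of "{a<..<b}"]) (auto simp: F_def V_def)
    then have Fm: "F \<in> lmeasurable"
      using E V by (intro bounded_set_imp_lmeasurable) (auto simp: F_def)
    define e where "e = measure lebesgue F"
    have "\<not> e > 0"
    proof
      assume "e > 0"
      then have "e / 2 > 0" by simp
      have "F \<subseteq> V" by (simp add: F_def)
      obtain D where D: "finite D"
        "\<And>u v. (u, v) \<in> D \<Longrightarrow> \<bar>f v - f u\<bar> > 2 / e * (v - u) \<and> u < v \<and> {u..v} \<subseteq> V"
        "pairwise (\<lambda>i j. disjnt {fst i..snd i} {fst j..snd j}) D"
        "measure lebesgue (F - (\<Union>(u, v)\<in>D. {u..v})) < e / 2"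
      proof (rule Vitali_covering_intervals[OF Fm V \<open>F \<subseteq> V\<close> \<open>e / 2 > 0\<close>, of "\<lambda>u v. \<bar>f v - f u\<bar> > 2 / e * (v - u)"])
        show "\<exists>u v. \<bar>f v - f u\<bar> > 2 / e * (v - u) \<and> u < x \<and> x < v \<and> v - u < d" if "x \<in> F" "d > 0" for x d
          using steep[of x d "2 / e"] that by (auto simp: F_def)
      qed (rule that)
      define L where "L = (\<Sum>(u, v)\<in>D. v - u)"
      have LD: "measure lebesgue (\<Union>(u, v)\<in>D. {u..v}) = L"
        unfolding L_def using D by (intro measure_disjoint_intervals) auto
      have Dm: "(\<Union>(u, v)\<in>D. {u..v}) \<in> lmeasurable" using D(1) by (auto intro!: fmeasurable.finite_UN)
      have "e \<le> measure lebesgue ((\<Union>(u, v)\<in>D. {u..v}) \<union> (F - (\<Union>(u, v)\<in>D. {u..v})))"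
        unfolding e_def using Fm Dm by (intro measure_mono_fmeasurable) auto
      also have "\<dots> \<le> L + measure lebesgue (F - (\<Union>(u, v)\<in>D. {u..v}))"
        unfolding LD[symmetric] using Fm Dm by (intro measure_Un_le) auto
      finally have eL: "e / 2 < L" using D(4) by simp
      have "L \<le> measure lebesgue {z - \<delta> / 3<..<z + \<delta> / 3}"
        unfolding LD[symmetric]
      proof (rule measure_mono_fmeasurable)
        show "(\<Union>(u, v)\<in>D. {u..v}) \<subseteq> {z - \<delta> / 3<..<z + \<delta> / 3}"
          using D(2) unfolding V_def by blast
      qed (use Dm in auto)
      also have "\<dots> < \<delta>" using \<open>\<delta> > 0\<close> by simp
      finally have "L < \<delta>" .
      have "(\<Sum>i\<in>D. \<bar>f (snd i) - f (fst i)\<bar>) < 1"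
      proof (rule \<delta>, intro conjI ballI impI)
        fix i assume i: "i \<in> D"
        then have "fst i < snd i" "{fst i..snd i} \<subseteq> {a<..<b}"
          using D(2)[of "fst i" "snd i"] by (auto simp: V_def)
        moreover from this have "fst i \<in> {a<..<b}" "snd i \<in> {a<..<b}" by (meson atLeastAtMost_iff less_imp_le order_refl subsetD)+
        ultimately show "a \<le> fst i" "fst i \<le> snd i" "snd i \<le> b" by auto
        fix j assume j: "j \<in> D" "i \<noteq> j"
        have "{fst i..snd i} \<inter> {fst j..snd j} = {}"
          using D(3) i j unfolding pairwise_def disjnt_def by blast
        then show "{fst i<..<snd i} \<inter> {fst j<..<snd j} = {}"
          using greaterThanLessThan_subseteq_atLeastAtMost_iff by blast
      qed (use D(1) \<open>L < \<delta>\<close> in \<open>auto simp: L_def case_prod_beta\<close>)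
      moreover have "2 / e * L \<le> (\<Sum>i\<in>D. \<bar>f (snd i) - f (fst i)\<bar>)"
        unfolding L_def sum_distrib_left using D(2) by (intro sum_mono) (auto intro: less_imp_le)
      moreover have "2 / e * L > 1" using eL \<open>e > 0\<close> by (simp add: field_simps)
      ultimately show False by linarith
    qed
    then have "negligible F"
      using Fm measure_nonneg[of lebesgue F] by (simp add: negligible_iff_measure0 e_def)
    moreover have "z \<in> F" using that E \<open>\<delta> > 0\<close> by (auto simp: F_def V_def)
    moreover have "openin (top_of_set E) F" using V by (auto simp: F_def openin_open)
    ultimately show ?thesis by blast
  qed
  then show ?thesis by (subst locally_negligible_alt) blast
qed

text \<open>Quotients over intervals straddling \<open>x\<close> are what Vitali coverings control.
  They are bounded and cannot oscillate across two rationals, hence converge; continuity at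
  \<open>x\<close> then lets one endpoint tend to \<open>x\<close>, which gives ordinary difference
  quotients. Rational levels keep the later exceptional set a countable union.\<close>

lemma has_real_derivative_straddle:
  fixes f :: "real \<Rightarrow> real"
  assumes cont: "isCont f x"
    and bdd: "\<exists>d>0. \<exists>c. \<forall>u v. u < x \<and> x < v \<and> v - u < d \<longrightarrow> \<bar>f v - f u\<bar> \<le> c * (v - u)"
    and osc: "\<And>p q. p \<in> \<rat> \<Longrightarrow> q \<in> \<rat> \<Longrightarrow> p < q \<Longrightarrow> \<exists>d>0.
        (\<forall>u v. u < x \<and> x < v \<and> v - u < d \<longrightarrow> p * (v - u) \<le> f v - f u) \<or>
        (\<forall>u v. u < x \<and> x < v \<and> v - u < d \<longrightarrow> f v - f u \<le> q * (v - u))"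
  shows "\<exists>l. (f has_real_derivative l) (at x)"
proof -
  obtain d0 c where d0: "d0 > 0"
    and c: "\<And>u v. u < x \<Longrightarrow> x < v \<Longrightarrow> v - u < d0 \<Longrightarrow> \<bar>f v - f u\<bar> \<le> c * (v - u)"
    using bdd by blast
  \<comment> \<open>The eventual lower bounds of the straddling quotients; their supremum is the
    candidate derivative.\<close>
  define P where "P = {p. \<exists>d>0. \<forall>u v. u < x \<and> x < v \<and> v - u < d \<longrightarrow> p * (v - u) \<le> f v - f u}"
  have "- c \<in> P"
  proof -
    have "- c * (v - u) \<le> f v - f u" if "u < x \<and> x < v \<and> v - u < d0" for u v
      using c[of u v] that by (simp add: abs_le_iff)
    then show ?thesis unfolding P_def mem_Collect_eq using d0 by (intro exI[of _ d0]) simp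
  qed
  have le_c: "p \<le> c" if "p \<in> P" for p
  proof -
    obtain d where d: "d > 0" "\<forall>u v. u < x \<and> x < v \<and> v - u < d \<longrightarrow> p * (v - u) \<le> f v - f u"
      using \<open>p \<in> P\<close> unfolding P_def by blast
    define h where "h = min d d0 / 3"
    have h: "h > 0" "2 * h < d" "2 * h < d0" unfolding h_def using d(1) d0 by linarith+
    have "p * (2 * h) \<le> f (x + h) - f (x - h)" using d(2)[rule_format, of "x - h" "x + h"] h by simp
    also have "\<dots> \<le> c * (2 * h)" using c[of "x - h" "x + h"] h by simp
    finally show ?thesis using h by simp
  qed
  define l where "l = Sup P"
  have bddP: "bdd_above P" using le_c by (intro bdd_aboveI)
  have key: "\<exists>d>0. \<forall>u v. u < x \<and> x < v \<and> v - u < d \<longrightarrow> \<bar>f v - f u - l * (v - u)\<bar> \<le> \<epsilon> * (v - u)"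
    if "\<epsilon> > 0" for \<epsilon>
  proof -
    obtain p where p: "p \<in> P" "l - \<epsilon> < p"
      using less_cSup_iff[of P "l - \<epsilon>"] \<open>- c \<in> P\<close> bddP \<open>\<epsilon> > 0\<close> by (auto simp: l_def)
    \<comment> \<open>Two rationals above \<open>l\<close> are needed: \<open>q1\<close> is not an
      eventual lower bound, so the dichotomy for the pair yields the upper bound
      \<open>q2\<close>.\<close>
    obtain q1 where q1: "q1 \<in> \<rat>" "l < q1" "q1 < l + \<epsilon> / 2" using Rats_dense_in_real[of l "l + \<epsilon> / 2"] \<open>\<epsilon> > 0\<close> by auto
    obtain q2 where q2: "q2 \<in> \<rat>" "l + \<epsilon> / 2 < q2" "q2 < l + \<epsilon>"
      using Rats_dense_in_real[of "l + \<epsilon> / 2" "l + \<epsilon>"] \<open>\<epsilon> > 0\<close> by auto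
    have "q1 \<notin> P" using cSup_upper[OF _ bddP, of q1] q1 by (auto simp: l_def)
    then have "\<not> (\<exists>d>0. \<forall>u v. u < x \<and> x < v \<and> v - u < d \<longrightarrow> q1 * (v - u) \<le> f v - f u)"
      by (simp add: P_def)
    moreover have "q1 < q2" using q1 q2 by simp
    ultimately obtain d2 where d2: "d2 > 0" "\<forall>u v. u < x \<and> x < v \<and> v - u < d2 \<longrightarrow> f v - f u \<le> q2 * (v - u)"
      using osc[OF q1(1) q2(1)] by blast
    obtain d1 where d1: "d1 > 0" "\<forall>u v. u < x \<and> x < v \<and> v - u < d1 \<longrightarrow> p * (v - u) \<le> f v - f u"
      using p(1) unfolding P_def by blast
    have "\<bar>f v - f u - l * (v - u)\<bar> \<le> \<epsilon> * (v - u)" if uv: "u < x" "x < v" "v - u < min d1 d2" for u v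
    proof -
      have "(l - \<epsilon>) * (v - u) \<le> p * (v - u)" using p uv by (intro mult_right_mono) auto
      moreover have "q2 * (v - u) \<le> (l + \<epsilon>) * (v - u)" using q2 uv by (intro mult_right_mono) auto
      ultimately show ?thesis using d1(2)[rule_format, of u v] d2(2)[rule_format, of u v] uv
        by (simp add: abs_le_iff algebra_simps)
    qed
    then show ?thesis using d1(1) d2(1) by (intro exI[of _ "min d1 d2"]) auto
  qed
  have "((\<lambda>y. (f y - f x) / (y - x)) \<longlongrightarrow> l) (at x)"
  proof (rule tendstoI)
    fix e :: real assume "e > 0"
    then have "e / 2 > 0" by simp
    from key[OF this] obtain d where "d > 0"
      and d: "\<forall>u v. u < x \<and> x < v \<and> v - u < d \<longrightarrow> \<bar>f v - f u - l * (v - u)\<bar> \<le> e / 2 * (v - u)"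
      by blast
    \<comment> \<open>Letting the left endpoint tend to \<open>x\<close> keeps the estimate.\<close>
    have R: "\<bar>f y - f x - l * (y - x)\<bar> \<le> e / 2 * (y - x)" if y: "x < y" "y < x + d" for y
    proof (rule tendsto_le[OF trivial_limit_at_left_real])
      show "((\<lambda>u. \<bar>f y - f u - l * (y - u)\<bar>) \<longlongrightarrow> \<bar>f y - f x - l * (y - x)\<bar>) (at_left x)"
        using cont unfolding isCont_def by (intro tendsto_intros) (rule tendsto_within_subset, auto)
      show "((\<lambda>u. e / 2 * (y - u)) \<longlongrightarrow> e / 2 * (y - x)) (at_left x)" by (intro tendsto_intros)
      show "\<forall>\<^sub>F u in at_left x. \<bar>f y - f u - l * (y - u)\<bar> \<le> e / 2 * (y - u)"
        using y by (intro eventually_at_leftI[of "y - d"] d[rule_format]) auto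
    qed
    have L: "\<bar>f x - f y - l * (x - y)\<bar> \<le> e / 2 * (x - y)" if y: "y < x" "x - d < y" for y
    proof (rule tendsto_le[OF trivial_limit_at_right_real])
      show "((\<lambda>v. \<bar>f v - f y - l * (v - y)\<bar>) \<longlongrightarrow> \<bar>f x - f y - l * (x - y)\<bar>) (at_right x)"
        using cont unfolding isCont_def by (intro tendsto_intros) (rule tendsto_within_subset, auto)
      show "((\<lambda>v. e / 2 * (v - y)) \<longlongrightarrow> e / 2 * (x - y)) (at_right x)" by (intro tendsto_intros)
      show "\<forall>\<^sub>F v in at_right x. \<bar>f v - f y - l * (v - y)\<bar> \<le> e / 2 * (v - y)"
        using y by (intro eventually_at_rightI[of _ "y + d"] d[rule_format]) auto
    qed
    have "dist ((f y - f x) / (y - x)) l < e" if y: "y \<noteq> x" "dist y x < d" for y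
    proof -
      have "\<bar>f y - f x - l * (y - x)\<bar> \<le> e / 2 * \<bar>y - x\<bar>"
      proof (cases "x < y")
        case True
        then show ?thesis using R[of y] y by (simp add: dist_real_def)
      next
        case False
        moreover have "f y - f x - l * (y - x) = - (f x - f y - l * (x - y))" by (simp add: algebra_simps)
        then have "\<bar>f y - f x - l * (y - x)\<bar> = \<bar>f x - f y - l * (x - y)\<bar>" by (simp only: abs_minus_cancel)
        ultimately show ?thesis using L[of y] y by (simp add: dist_real_def)
      qed
      moreover have "dist ((f y - f x) / (y - x)) l = \<bar>f y - f x - l * (y - x)\<bar> / \<bar>y - x\<bar>"
        using y by (simp add: dist_real_def field_simps flip: abs_divide)
      ultimately have "dist ((f y - f x) / (y - x)) l \<le> e / 2" using y by (simp add: divide_le_eq)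
      then show ?thesis using \<open>e > 0\<close> by simp
    qed
    then show "\<forall>\<^sub>F y in at x. dist ((f y - f x) / (y - x)) l < e"
      unfolding eventually_at using \<open>d > 0\<close> by blast
  qed
  then show ?thesis unfolding has_field_derivative_iff by blast
qed

text \<open>Both kinds of bad points, those with arbitrarily steep quotients and those oscillating
  across two rationals, are points covered by suitable intervals at every scale. Such sets are
  countable intersections of open sets, which settles measurability.\<close>

theorem absolutely_continuous_fun_differentiable_ae:
  assumes ac: "absolutely_continuous_fun a b f"
  shows "\<exists>N. negligible N \<and> (\<forall>x\<in>{a<..<b} - N. (f has_real_derivative deriv f x) (at x))"
proof -
  define G where "G P n = \<Union>{{u<..<v} | u v. a \<le> u \<and> u < v \<and> v \<le> b \<and> v - u < 1 / real (Suc n) \<and> P u v}"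
    for P :: "real \<Rightarrow> real \<Rightarrow> bool" and n :: nat
  have Gopen: "open (G P n)" for P n by (auto simp: G_def)
  have Gsub: "G P n \<subseteq> {a<..<b}" for P n by (auto simp: G_def)
  have Gm: "(\<Inter>n. G P n) \<in> sets lebesgue" for P using Gopen by (intro sets.countable_INT'') auto
  have GD: "\<exists>u v. P u v \<and> u < x \<and> x < v \<and> v - u < d" if x: "x \<in> (\<Inter>n. G P n)" and "d > 0" for P x d
  proof -
    obtain n where n: "1 / real (Suc n) < d" using \<open>d > 0\<close> by (rule nat_approx_posE)
    have "x \<in> G P n" using x by auto
    then obtain u v where "v - u < 1 / real (Suc n)" "P u v" "u < x" "x < v"
      unfolding G_def by auto
    then show ?thesis using n by (intro exI[of _ u] exI[of _ v]) linarith
  qed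
  have GI: "\<exists>d>0. \<forall>u v. u < x \<and> x < v \<and> v - u < d \<longrightarrow> \<not> P u v" if x: "x \<in> {a<..<b}" "x \<notin> G P n" for P x n
  proof (intro exI[of _ "min (1 / real (Suc n)) (min (x - a) (b - x))"] conjI allI impI notI)
    fix u v assume "u < x \<and> x < v \<and> v - u < min (1 / real (Suc n)) (min (x - a) (b - x))" "P u v"
    then have "x \<in> G P n" unfolding G_def using x
      by (intro UnionI[of "{u<..<v}"] CollectI exI[of _ u] exI[of _ v]) auto
    then show False using x by simp
  qed (use x in auto)
  define B where "B p q = (\<Inter>n. G (\<lambda>u v. f v - f u < p * (v - u)) n) \<inter> (\<Inter>n. G (\<lambda>u v. f v - f u > q * (v - u)) n)" for p q
  define B' where "B' = (\<Inter>c::nat. \<Inter>n. G (\<lambda>u v. \<bar>f v - f u\<bar> > real c * (v - u)) n)"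
  have "negligible (B p q)" if "p < q" for p q
  proof (rule absolutely_continuous_fun_oscillating_negligible[OF ac that])
    show "B p q \<in> sets lebesgue" unfolding B_def using Gm by (intro sets.Int) auto
    show "B p q \<subseteq> {a<..<b}" unfolding B_def using Gsub by blast
  qed (use GD in \<open>auto simp: B_def\<close>)
  then have nB: "negligible (\<Union>(p, q)\<in>{(p, q). p \<in> \<rat> \<and> q \<in> \<rat> \<and> p < q}. B p q)"
    using countable_subset[of "{(p, q). p \<in> \<rat> \<and> q \<in> \<rat> \<and> p < q}" "\<rat> \<times> (\<rat> :: real set)"]
    by (intro negligible_countable_Union countable_image) (auto simp: countable_rat)
  have nB': "negligible B'"
  proof (rule absolutely_continuous_fun_steep_negligible[OF ac])
    show "B' \<in> sets lebesgue" unfolding B'_def by (rule sets.countable_INT''[OF _ _ Gm]) auto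
    show "B' \<subseteq> {a<..<b}" unfolding B'_def using Gsub by blast
    fix x d c :: real assume x: "x \<in> B'" "d > 0"
    obtain m :: nat where m: "c \<le> real m" using real_arch_simple by blast
    obtain u v where "\<bar>f v - f u\<bar> > real m * (v - u)" "u < x" "x < v" "v - u < d"
      using GD[of x "\<lambda>u v. \<bar>f v - f u\<bar> > real m * (v - u)" d] x by (auto simp: B'_def)
    moreover from this have "c * (v - u) \<le> real m * (v - u)" using m by (intro mult_right_mono) auto
    ultimately show "\<exists>u v. \<bar>f v - f u\<bar> > c * (v - u) \<and> u < x \<and> x < v \<and> v - u < d"
      by (intro exI[of _ u] exI[of _ v]) linarith
  qed
  define N where "N = B' \<union> (\<Union>(p, q)\<in>{(p, q). p \<in> \<rat> \<and> q \<in> \<rat> \<and> p < q}. B p q)"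
  have "(f has_real_derivative deriv f x) (at x)" if x: "x \<in> {a<..<b} - N" for x
  proof -
    have "\<exists>l. (f has_real_derivative l) (at x)"
    proof (rule has_real_derivative_straddle)
      show "isCont f x"
        using continuous_on_interior[OF absolutely_continuous_fun_continuous_on[OF ac], of x] x
        by (simp add: interior_atLeastAtMost_real)
      obtain c n where "x \<notin> G (\<lambda>u v. \<bar>f v - f u\<bar> > real c * (v - u)) n"
        using x by (auto simp: N_def B'_def)
      from GI[OF _ this] x show "\<exists>d>0. \<exists>c. \<forall>u v. u < x \<and> x < v \<and> v - u < d \<longrightarrow> \<bar>f v - f u\<bar> \<le> c * (v - u)"
        by (force simp: not_less)
      fix p q :: real assume "p \<in> \<rat>" "q \<in> \<rat>" "p < q"
      then have "x \<notin> B p q" using x by (auto simp: N_def)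
      then obtain n where "x \<notin> G (\<lambda>u v. f v - f u < p * (v - u)) n \<or> x \<notin> G (\<lambda>u v. f v - f u > q * (v - u)) n"
        by (auto simp: B_def)
      then consider "\<exists>d>0. \<forall>u v. u < x \<and> x < v \<and> v - u < d \<longrightarrow> \<not> f v - f u < p * (v - u)"
        | "\<exists>d>0. \<forall>u v. u < x \<and> x < v \<and> v - u < d \<longrightarrow> \<not> f v - f u > q * (v - u)"
        using GI[of x] x by fast
      then show "\<exists>d>0. (\<forall>u v. u < x \<and> x < v \<and> v - u < d \<longrightarrow> p * (v - u) \<le> f v - f u) \<or>
        (\<forall>u v. u < x \<and> x < v \<and> v - u < d \<longrightarrow> f v - f u \<le> q * (v - u))"
        unfolding not_less by cases blast+
    qed
    then show ?thesis by (auto dest: DERIV_imp_deriv)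
  qed
  moreover have "negligible N" unfolding N_def using nB nB' by (rule negligible_Un[rotated])
  ultimately show ?thesis by blast
qed

text \<open>The gauge integral delivers integrability of \<open>g\<close> together with its value.
  Tags outside the exceptional set are handled by the derivative at the tag, tags inside it by
  absolute continuity, since their cells have small total length.\<close>

theorem absolutely_continuous_fun_has_integral:
  fixes f :: "real \<Rightarrow> real"
  assumes ac: "absolutely_continuous_fun a b f" and "a \<le> b" and N: "negligible N"
    and der: "\<And>x. x \<in> {a<..<b} - N \<Longrightarrow> (f has_real_derivative g x) (at x)"
  shows "(g has_integral f b - f a) {a..b}"
proof (rule has_integral_spike)
  define Z where "Z = N \<union> {a, b}"
  \<comment> \<open>With value 0 on \<open>Z\<close>, a cell tagged in \<open>Z\<close> contributes
    nothing but the increment of \<open>f\<close>.\<close>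
  define h where "h x = (if x \<in> Z then 0 else g x)" for x
  show nZ: "negligible Z" unfolding Z_def using N by (intro negligible_Un) auto
  show "g x = h x" if "x \<in> {a..b} - Z" for x using that by (simp add: h_def)
  show "(h has_integral f b - f a) {a..b}"
    unfolding has_integral_real
  proof (intro allI impI)
    fix e :: real assume "e > 0"
    then have "e / 2 > 0" by simp
    obtain \<delta> where "\<delta> > 0" and \<delta>: "\<And>(I :: (real \<times> real set) set) u v. finite I \<and> 
        (\<forall>i\<in>I. a \<le> u i \<and> u i \<le> v i \<and> v i \<le> b) \<and>
        (\<forall>i\<in>I. \<forall>j\<in>I. i \<noteq> j \<longrightarrow> {u i<..<v i} \<inter> {u j<..<v j} = {}) \<and>
        (\<Sum>i\<in>I. v i - u i) < \<delta> \<Longrightarrow> (\<Sum>i\<in>I. \<bar>f (v i) - f (u i)\<bar>) < e / 2"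
      using absolutely_continuous_fun_family[OF ac \<open>e / 2 > 0\<close>, where ?'i = "real \<times> real set"] by auto
    obtain U where U: "open U" "Z \<subseteq> U" "U - Z \<in> lmeasurable" "emeasure lebesgue (U - Z) < ennreal \<delta>"
      using sets_lebesgue_outer_open[OF negligible_imp_sets[OF nZ] \<open>\<delta> > 0\<close>] by blast
    have Zm: "Z \<in> lmeasurable" "measure lebesgue Z = 0" using nZ by (simp_all add: negligible_iff_measure)
    have UZ: "U = (U - Z) \<union> Z" using U by auto
    then have Um: "U \<in> lmeasurable" using U Zm by (metis fmeasurable.Un)
    have "measure lebesgue U \<le> measure lebesgue (U - Z) + measure lebesgue Z"
      using U Zm by (subst UZ) (intro measure_Un_le, auto)
    also have "\<dots> < \<delta>"
      using U(3,4) Zm \<open>\<delta> > 0\<close> by (simp add: emeasure_eq_measure2 ennreal_less_iff)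
    finally have mU: "measure lebesgue U < \<delta>" .
    define \<eta> where "\<eta> = e / (2 * (b - a + 1))"
    have "\<eta> > 0" using \<open>e > 0\<close> \<open>a \<le> b\<close> by (simp add: \<eta>_def)
    \<comment> \<open>Around points of \<open>Z\<close> the gauge keeps cells inside an open set of
      measure below \<delta>; elsewhere it enforces the linear approximation.\<close>
    have "\<exists>r>0. (x \<in> Z \<longrightarrow> ball x r \<subseteq> U) \<and>
        (x \<in> {a..b} - Z \<longrightarrow> (\<forall>y. \<bar>y - x\<bar> < r \<longrightarrow> \<bar>f y - f x - h x * (y - x)\<bar> \<le> \<eta> * \<bar>y - x\<bar>))" for x
    proof -
      consider "x \<in> Z" | "x \<in> {a..b} - Z" | "x \<notin> Z" "x \<notin> {a..b}" by blast
      then show ?thesis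
      proof cases
        case 1
        then obtain r where "r > 0" "ball x r \<subseteq> U" using U open_contains_ball by blast
        then show ?thesis using 1 by auto
      next
        case 2
        then have "(f has_real_derivative h x) (at x)"
          using der[of x] by (auto simp: Z_def h_def)
        then have "(f has_derivative (\<lambda>y. h x * y)) (at x)"
          by (simp add: has_field_derivative_def)
        then obtain r where "r > 0" "\<forall>y. norm (y - x) < r \<longrightarrow> norm (f y - f x - h x * (y - x)) \<le> \<eta> * norm (y - x)"
          using \<open>\<eta> > 0\<close> unfolding has_derivative_at_alt by blast
        then show ?thesis using 2 by auto
      qed (auto intro: exI[of _ 1])
    qed
    then obtain r where r: "\<And>x. r x > 0" "\<And>x. x \<in> Z \<Longrightarrow> ball x (r x) \<subseteq> U"
      "\<And>x y. x \<in> {a..b} - Z \<Longrightarrow> \<bar>y - x\<bar> < r x \<Longrightarrow> \<bar>f y - f x - h x * (y - x)\<bar> \<le> \<eta> * \<bar>y - x\<bar>"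
      by metis
    show "\<exists>\<gamma>. gauge \<gamma> \<and> (\<forall>\<D>. \<D> tagged_division_of {a..b} \<and> \<gamma> fine \<D> \<longrightarrow>
        norm ((\<Sum>(x, k)\<in>\<D>. measure lborel k *\<^sub>R h x) - (f b - f a)) < e)"
    proof (intro exI[of _ "\<lambda>x. ball x (r x)"] conjI allI impI)
      show "gauge (\<lambda>x. ball x (r x))" using r(1) by (rule gauge_ball_dependent[rule_format])
      fix p assume "p tagged_division_of {a..b} \<and> (\<lambda>x. ball x (r x)) fine p"
      then have p: "p tagged_division_of {a..b}" and fine: "\<And>x K. (x, K) \<in> p \<Longrightarrow> K \<subseteq> ball x (r x)"
        by (auto simp: fine_def)
      have finp: "finite p" using p by blast
      have K: "\<exists>u v. K = {u..v} \<and> u \<le> x \<and> x \<le> v \<and> a \<le> u \<and> v \<le> b" if "(x, K) \<in> p" for x K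
      proof -
        from tagged_division_ofD(4)[OF p that] obtain u v where uv: "K = {u..v}" by auto
        with tagged_division_ofD(2,3)[OF p that] show ?thesis by auto
      qed
      define T where "T = {i \<in> p. fst i \<in> Z}"
      define d where "d i = measure lborel (snd i) * h (fst i) - (f (Sup (snd i)) - f (Inf (snd i)))" for i
      have "(\<Sum>(x, k)\<in>p. measure lborel k *\<^sub>R h x) - (f b - f a) = (\<Sum>i\<in>p. d i)"
        using additive_tagged_division_1[OF \<open>a \<le> b\<close> p, of f]
        by (simp add: d_def sum_subtractf case_prod_beta)
      also have "\<dots> = (\<Sum>i\<in>p - T. d i) + (\<Sum>i\<in>T. d i)"
        using finp by (intro sum.subset_diff) (auto simp: T_def)
      finally have eq: "(\<Sum>(x, k)\<in>p. measure lborel k *\<^sub>R h x) - (f b - f a) = (\<Sum>i\<in>p - T. d i) + (\<Sum>i\<in>T. d i)" .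
      have "norm ((\<Sum>(x, k)\<in>p. measure lborel k *\<^sub>R h x) - (f b - f a)) \<le> (\<Sum>i\<in>p - T. \<bar>d i\<bar>) + (\<Sum>i\<in>T. \<bar>d i\<bar>)"
        unfolding eq real_norm_def using sum_abs[of d "p - T"] sum_abs[of d T] by linarith
      moreover have "(\<Sum>i\<in>p - T. \<bar>d i\<bar>) \<le> \<eta> * (b - a)"
      proof -
        have "(\<Sum>i\<in>p - T. \<bar>d i\<bar>) \<le> (\<Sum>i\<in>p - T. \<eta> * measure lborel (snd i))"
        proof (rule sum_mono)
          fix i assume i: "i \<in> p - T"
          obtain x k where xk: "i = (x, k)" by (cases i)
          with i obtain u v where uv: "k = {u..v}" "u \<le> x" "x \<le> v" "a \<le> u" "v \<le> b" using K by blast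
          have x: "x \<in> {a..b} - Z" using i xk uv by (auto simp: T_def)
          have "k \<subseteq> ball x (r x)" using fine[of x k] i xk by simp
          moreover have "u \<in> k" "v \<in> k" using uv by auto
          ultimately have "u \<in> ball x (r x)" "v \<in> ball x (r x)" by blast+
          then have "\<bar>f u - f x - h x * (u - x)\<bar> \<le> \<eta> * \<bar>u - x\<bar>" "\<bar>f v - f x - h x * (v - x)\<bar> \<le> \<eta> * \<bar>v - x\<bar>"
            using r(3)[OF x] by (auto simp: dist_real_def abs_minus_commute)
          \<comment> \<open>The cell is split at its tag, because the derivative estimate holds only
            with \<open>x\<close> as one endpoint.\<close>
          moreover have "d i = (f u - f x - h x * (u - x)) - (f v - f x - h x * (v - x))"
            using uv xk by (simp add: d_def algebra_simps)
          moreover have "\<eta> * \<bar>u - x\<bar> + \<eta> * \<bar>v - x\<bar> = \<eta> * measure lborel (snd i)"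
            using uv xk by (simp add: algebra_simps)
          ultimately show "\<bar>d i\<bar> \<le> \<eta> * measure lborel (snd i)" by linarith
        qed
        also have "\<dots> \<le> (\<Sum>i\<in>p. \<eta> * measure lborel (snd i))"
          using finp \<open>\<eta> > 0\<close> by (intro sum_mono2) auto
        also have "\<dots> = \<eta> * (b - a)"
          using additive_content_tagged_division[of p a b] p \<open>a \<le> b\<close>
          by (simp add: case_prod_beta sum_distrib_left[symmetric])
        finally show ?thesis .
      qed
      moreover have "(\<Sum>i\<in>T. \<bar>d i\<bar>) < e / 2"
      proof -
        have inter: "{Inf (snd i)<..<Sup (snd i)} = interior (snd i)" if "i \<in> p" for i
        proof -
          obtain u v where "snd i = {u..v}" "u \<le> v" using K[of "fst i" "snd i"] \<open>i \<in> p\<close> by auto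
          then show ?thesis by (simp add: interior_atLeastAtMost_real)
        qed
        have disj: "interior (snd i) \<inter> interior (snd j) = {}" if "i \<in> T" "j \<in> T" "i \<noteq> j" for i j
          using tagged_division_ofD(5)[OF p, of "fst i" "snd i" "fst j" "snd j"] that by (auto simp: T_def prod_eq_iff)
        have len: "Inf (snd i) \<le> Sup (snd i) \<and> a \<le> Inf (snd i) \<and> Sup (snd i) \<le> b \<and>
            measure lebesgue (interior (snd i)) = Sup (snd i) - Inf (snd i)" if "i \<in> T" for i
        proof -
          obtain u v where "snd i = {u..v}" "u \<le> v" "a \<le> u" "v \<le> b" using K[of "fst i" "snd i"] \<open>i \<in> T\<close> by (auto simp: T_def)
          then show ?thesis by (simp add: interior_atLeastAtMost_real)
        qed
        have finT: "finite T" using finp by (simp add: T_def)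
        have "(\<Sum>i\<in>T. Sup (snd i) - Inf (snd i)) = (\<Sum>i\<in>T. measure lebesgue (interior (snd i)))"
          using len by (intro sum.cong) auto
        also have "\<dots> = measure lebesgue (\<Union>i\<in>T. interior (snd i))"
        proof (rule measure_finite_Union[symmetric])
          show "disjoint_family_on (\<lambda>i. interior (snd i)) T" using disj by (auto simp: disjoint_family_on_def)
          show "emeasure lebesgue (interior (snd i)) \<noteq> \<infinity>" if "i \<in> T" for i
          proof -
            have "snd i \<subseteq> U" using fine[of "fst i" "snd i"] r(2)[of "fst i"] that by (auto simp: T_def)
            then have "interior (snd i) \<in> lmeasurable"
              using interior_subset Um by (metis fmeasurableI2 open_interior borel_open sets_completionI_sets sets_lborel subset_trans)
            then show ?thesis by (simp add: fmeasurable_def less_top[symmetric])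
          qed
        qed (use finT in auto)
        also have "\<dots> \<le> measure lebesgue U"
        proof (rule measure_mono_fmeasurable[OF _ _ Um])
          show "(\<Union>i\<in>T. interior (snd i)) \<subseteq> U"
          proof (rule UN_least)
            fix i assume "i \<in> T"
            then have "snd i \<subseteq> U" using fine[of "fst i" "snd i"] r(2)[of "fst i"] by (auto simp: T_def)
            then show "interior (snd i) \<subseteq> U" using interior_subset by blast
          qed
        qed (use finT in auto)
        finally have "(\<Sum>i\<in>T. Sup (snd i) - Inf (snd i)) < \<delta>" using mU by simp
        then have "(\<Sum>i\<in>T. \<bar>f (Sup (snd i)) - f (Inf (snd i))\<bar>) < e / 2"
          using finT len disj inter by (intro \<delta>) (auto simp: T_def)
        moreover have "(\<Sum>i\<in>T. \<bar>d i\<bar>) = (\<Sum>i\<in>T. \<bar>f (Sup (snd i)) - f (Inf (snd i))\<bar>)"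
          by (intro sum.cong) (auto simp: d_def T_def h_def)
        ultimately show ?thesis by simp
      qed
      moreover have "\<eta> * (b - a) \<le> e / 2"
        using \<open>a \<le> b\<close> \<open>e > 0\<close> by (simp add: \<eta>_def field_simps)
      ultimately show "norm ((\<Sum>(x, k)\<in>p. measure lborel k *\<^sub>R h x) - (f b - f a)) < e" by linarith
    qed
  qed
qed

section \<open>The rate function\<close>

text \<open>Half the integral of the squared derivative is the supremum, over families of disjoint intervals,
  of half the sums of \<open>(\<Delta>f)\<^sup>2 / \<Delta>t\<close>.\<close>

definition energy_le :: "(real \<Rightarrow> real) \<Rightarrow> real \<Rightarrow> bool" where
  "energy_le f \<alpha> \<longleftrightarrow>
     (\<forall>(m::nat) u v. (\<forall>i<m. 0 \<le> u i \<and> u i \<le> v i \<and> v i \<le> 1) \<and>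
        (\<forall>i<m. \<forall>j<m. i \<noteq> j \<longrightarrow> {u i<..<v i} \<inter> {u j<..<v j} = {}) \<longrightarrow>
        (\<Sum>i<m. (f (v i) - f (u i))\<^sup>2 / (v i - u i)) \<le> 2 * \<alpha>)"

lemma energy_leD:
  fixes m :: nat
  assumes "energy_le f \<alpha>" "\<And>i. i < m \<Longrightarrow> 0 \<le> u i \<and> u i \<le> v i \<and> v i \<le> 1"
    "\<And>i j. i < m \<Longrightarrow> j < m \<Longrightarrow> i \<noteq> j \<Longrightarrow> {u i<..<v i} \<inter> {u j<..<v j} = {}"
  shows "(\<Sum>i<m. (f (v i) - f (u i))\<^sup>2 / (v i - u i)) \<le> 2 * \<alpha>"
proof -
  have "(\<forall>i<m. 0 \<le> u i \<and> u i \<le> v i \<and> v i \<le> 1) \<and>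
      (\<forall>i<m. \<forall>j<m. i \<noteq> j \<longrightarrow> {u i<..<v i} \<inter> {u j<..<v j} = {})"
    by (intro conjI allI impI assms(2,3)) (simp_all add: assms(2))
  then show ?thesis using assms(1) unfolding energy_le_def by blast
qed

lemma energy_le_nonneg: "energy_le f \<alpha> \<Longrightarrow> 0 \<le> \<alpha>"
  unfolding energy_le_def by (drule spec[of _ 0]) simp

text \<open>Hoelder continuity of exponent one half, from a family with a single interval; the
  source of all moduli below.\<close>

lemma energy_le_increment:
  assumes "energy_le f \<alpha>" "0 \<le> u" "u \<le> v" "v \<le> 1"
  shows "(f v - f u)\<^sup>2 \<le> 2 * \<alpha> * (v - u)"
proof (cases "u = v")
  case False
  have "(f v - f u)\<^sup>2 / (v - u) \<le> 2 * \<alpha>"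
    using assms(1)[unfolded energy_le_def, rule_format, of "Suc 0" "\<lambda>_. u" "\<lambda>_. v"] assms by simp
  then show ?thesis using False assms by (simp add: divide_le_eq)
qed simp

lemma uniform_grid_disjoint:
  fixes i j :: nat
  assumes "i \<noteq> j"
  shows "{real i / real m<..<(real i + 1) / real m} \<inter> {real j / real m<..<(real j + 1) / real m} = {}"
proof (cases "m = 0")
  case False
  have "real i + 1 \<le> real j \<or> real j + 1 \<le> real i" using assms by linarith
  then have "(real i + 1) / real m \<le> real j / real m \<or> (real j + 1) / real m \<le> real i / real m"
    by (auto intro: divide_right_mono)
  then show ?thesis by auto
qed simp

lemma energy_le_grid:
  assumes "energy_le f \<alpha>" "m > 0"
  shows "(\<Sum>i<m. real m * (f ((real i + 1) / real m) - f (real i / real m))\<^sup>2) \<le> 2 * \<alpha>"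
proof -
  have "(\<Sum>i<m. (f ((real i + 1) / real m) - f (real i / real m))\<^sup>2 / ((real i + 1) / real m - real i / real m)) \<le> 2 * \<alpha>"
    using assms by (intro energy_leD uniform_grid_disjoint) (auto simp: field_simps)
  also have "(\<lambda>i. (real i + 1) / real m - real i / real m) = (\<lambda>i. 1 / real m)"
    by (simp add: add_divide_distrib)
  finally show ?thesis by (simp add: mult.commute)
qed

text \<open>Weighted arithmetic-geometric mean: \<open>\<bar>\<Delta>f\<bar> \<le> c / 2 *
  ((\<Delta>f)\<^sup>2 / \<Delta>t) + \<Delta>t / (2 * c)\<close>. The choice of \<open>c\<close>
  keeps the energy part below \<open>\<epsilon> / 2\<close>, and total length below
  \<open>c * \<epsilon>\<close> does the same for the second part.\<close>

lemma energy_le_imp_absolutely_continuous: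
  assumes "energy_le f \<alpha>"
  shows "absolutely_continuous_fun 0 1 f"
  unfolding absolutely_continuous_fun_def
proof (intro allI impI)
  fix \<epsilon> :: real assume "\<epsilon> > 0"
  have "\<alpha> \<ge> 0" using assms by (rule energy_le_nonneg)
  define c where "c = \<epsilon> / 2 / (\<alpha> + 1)"
  have "c > 0" using \<open>\<epsilon> > 0\<close> \<open>\<alpha> \<ge> 0\<close> by (simp add: c_def)
  show "\<exists>\<delta>>0. \<forall>(m::nat) u v. (\<forall>i<m. 0 \<le> u i \<and> u i \<le> v i \<and> v i \<le> 1) \<and>
        (\<forall>i<m. \<forall>j<m. i \<noteq> j \<longrightarrow> {u i<..<v i} \<inter> {u j<..<v j} = {}) \<and>
        (\<Sum>i<m. v i - u i) < \<delta> \<longrightarrow> (\<Sum>i<m. \<bar>f (v i) - f (u i)\<bar>) < \<epsilon>"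
  proof (intro exI[of _ "c * \<epsilon>"] conjI allI impI)
    fix m :: nat and u v
    assume uv: "(\<forall>i<m. 0 \<le> u i \<and> u i \<le> v i \<and> v i \<le> 1) \<and>
        (\<forall>i<m. \<forall>j<m. i \<noteq> j \<longrightarrow> {u i<..<v i} \<inter> {u j<..<v j} = {}) \<and> (\<Sum>i<m. v i - u i) < c * \<epsilon>"
    have 1: "\<bar>f (v i) - f (u i)\<bar> \<le> c / 2 * ((f (v i) - f (u i))\<^sup>2 / (v i - u i)) + (v i - u i) / (2 * c)"
      if "i < m" for i
    proof (cases "u i = v i")
      case False
      define x where "x = \<bar>f (v i) - f (u i)\<bar>"
      define t where "t = v i - u i"
      have "t > 0" using False uv \<open>i < m\<close> by (force simp: t_def)
      have "0 \<le> (c * x - t)\<^sup>2" by simp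
      then have "2 * c * t * x \<le> c\<^sup>2 * x\<^sup>2 + t\<^sup>2" by (simp add: power2_eq_square algebra_simps)
      then have "x \<le> c / 2 * (x\<^sup>2 / t) + t / (2 * c)"
        using \<open>c > 0\<close> \<open>t > 0\<close> by (simp add: field_simps power2_eq_square)
      then show ?thesis by (simp add: x_def t_def)
    qed simp
    have "(\<Sum>i<m. \<bar>f (v i) - f (u i)\<bar>) \<le>
        (\<Sum>i<m. c / 2 * ((f (v i) - f (u i))\<^sup>2 / (v i - u i)) + (v i - u i) / (2 * c))"
      using 1 by (intro sum_mono) auto
    also have "\<dots> = c / 2 * (\<Sum>i<m. (f (v i) - f (u i))\<^sup>2 / (v i - u i)) + (\<Sum>i<m. v i - u i) / (2 * c)"
      by (simp add: sum.distrib sum_distrib_left sum_divide_distrib)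
    also have "\<dots> < c / 2 * (2 * \<alpha>) + c * \<epsilon> / (2 * c)"
      using uv \<open>c > 0\<close> by (intro add_le_less_mono mult_left_mono divide_strict_right_mono energy_leD[OF assms]) auto
    also have "c / 2 * (2 * \<alpha>) + c * \<epsilon> / (2 * c) \<le> \<epsilon>"
    proof -
      have "c * (\<alpha> + 1) = \<epsilon> / 2"
        unfolding c_def using \<open>\<alpha> \<ge> 0\<close> by (intro nonzero_eq_divide_eq[THEN iffD1, OF _ refl]) simp
      then show ?thesis using \<open>c > 0\<close> by (simp add: algebra_simps)
    qed
    finally show "(\<Sum>i<m. \<bar>f (v i) - f (u i)\<bar>) < \<epsilon>" .
  qed (use \<open>c > 0\<close> \<open>\<epsilon> > 0\<close> in auto)
qed

text \<open>Lower semicontinuity of the energy: each finite sum depends continuously on finitely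
  many values, so pointwise convergence suffices.\<close>

lemma energy_le_tendsto:
  assumes lim: "\<And>t. t \<in> {0..1} \<Longrightarrow> (\<lambda>n. F n t) \<longlonglongrightarrow> f t" and "\<And>n. energy_le (F n) \<alpha>"
  shows "energy_le f \<alpha>"
  unfolding energy_le_def
proof (intro allI impI)
  fix m :: nat and u v :: "nat \<Rightarrow> real"
  assume uv: "(\<forall>i<m. 0 \<le> u i \<and> u i \<le> v i \<and> v i \<le> 1) \<and>
        (\<forall>i<m. \<forall>j<m. i \<noteq> j \<longrightarrow> {u i<..<v i} \<inter> {u j<..<v j} = {})"
  have "(\<lambda>n. F n (v i)) \<longlonglongrightarrow> f (v i)" "(\<lambda>n. F n (u i)) \<longlonglongrightarrow> f (u i)" if "i < m" for i
  proof -
    have "v i \<in> {0..1}" "u i \<in> {0..1}" using uv that by force+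
    then show "(\<lambda>n. F n (v i)) \<longlonglongrightarrow> f (v i)" "(\<lambda>n. F n (u i)) \<longlonglongrightarrow> f (u i)" using lim by auto
  qed
  then have "(\<lambda>n. \<Sum>i<m. (F n (v i) - F n (u i))\<^sup>2 / (v i - u i)) \<longlonglongrightarrow> (\<Sum>i<m. (f (v i) - f (u i))\<^sup>2 / (v i - u i))"
    unfolding divide_inverse by (intro tendsto_intros) auto
  moreover have "\<forall>n\<ge>0. (\<Sum>i<m. (F n (v i) - F n (u i))\<^sup>2 / (v i - u i)) \<le> 2 * \<alpha>"
    using uv by (intro allI impI energy_leD assms) auto
  ultimately show "(\<Sum>i<m. (f (v i) - f (u i))\<^sup>2 / (v i - u i)) \<le> 2 * \<alpha>"
    by (rule LIMSEQ_le_const2[OF _ exI])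
qed

text \<open>Fatou's lemma along uniform grids: the squared slopes of the grid interpolations have
  integrals bounded by the grid energy, and they converge almost everywhere to the squared
  derivative.\<close>

lemma nn_integral_deriv_square_le:
  assumes "energy_le f \<alpha>"
  shows "(\<integral>\<^sup>+u\<in>{0..1}. ennreal ((deriv f u)\<^sup>2) \<partial>lebesgue) \<le> ennreal (2 * \<alpha>)"
proof -
  obtain N where N: "negligible N" and der: "\<And>x. x \<in> {0<..<1} - N \<Longrightarrow> (f has_real_derivative deriv f x) (at x)"
    using absolutely_continuous_fun_differentiable_ae[OF energy_le_imp_absolutely_continuous[OF assms]] by blast
  define c where "c m i = real m * (f ((real i + 1) / real m) - f (real i / real m))" for m i :: nat
  define q where "q m x = (\<Sum>i<m. (c m i)\<^sup>2 * indicator {real i / real m<..<(real i + 1) / real m} x)" for m and x :: real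
  have qm: "q m \<in> borel_measurable lebesgue" for m
    unfolding q_def by (intro borel_measurable_sum borel_measurable_times borel_measurable_const borel_measurable_indicator) auto
  have int_q: "(\<integral>\<^sup>+x. ennreal (q m x) \<partial>lebesgue) \<le> ennreal (2 * \<alpha>)" for m
  proof (cases "m = 0")
    case False
    have "(\<integral>\<^sup>+x. ennreal (q m x) \<partial>lebesgue) =
        (\<integral>\<^sup>+x. (\<Sum>i<m. ennreal ((c m i)\<^sup>2) * indicator {real i / real m<..<(real i + 1) / real m} x) \<partial>lebesgue)"
    proof (rule nn_integral_cong)
      fix x
      have "ennreal (q m x) = (\<Sum>i<m. ennreal ((c m i)\<^sup>2 * indicator {real i / real m<..<(real i + 1) / real m} x))"
        unfolding q_def by (rule sum_ennreal[symmetric]) auto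
      then show "ennreal (q m x) = (\<Sum>i<m. ennreal ((c m i)\<^sup>2) * indicator {real i / real m<..<(real i + 1) / real m} x)"
        by (simp add: ennreal_mult' ennreal_indicator)
    qed
    also have "\<dots> = (\<Sum>i<m. \<integral>\<^sup>+x. ennreal ((c m i)\<^sup>2) * indicator {real i / real m<..<(real i + 1) / real m} x \<partial>lebesgue)"
      by (intro nn_integral_sum borel_measurable_times_ennreal borel_measurable_const borel_measurable_indicator) auto
    also have "\<dots> = (\<Sum>i<m. ennreal ((c m i)\<^sup>2) * emeasure lebesgue {real i / real m<..<(real i + 1) / real m})"
      by (intro sum.cong refl nn_integral_cmult_indicator) simp
    also have "\<dots> = (\<Sum>i<m. ennreal (real m * (f ((real i + 1) / real m) - f (real i / real m))\<^sup>2))"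
    proof (rule sum.cong)
      fix i
      have le: "real i / real m \<le> (real i + 1) / real m" by (rule divide_right_mono) auto
      have "emeasure lebesgue {real i / real m<..<(real i + 1) / real m} = emeasure lborel {real i / real m<..<(real i + 1) / real m}"
        by simp
      also have "\<dots> = ennreal ((real i + 1) / real m - real i / real m)"
        by (rule emeasure_lborel_Ioo[OF le])
      also have "(real i + 1) / real m - real i / real m = 1 / real m" by (simp add: add_divide_distrib)
      finally have em: "emeasure lebesgue {real i / real m<..<(real i + 1) / real m} = ennreal (1 / real m)" .
      have eq: "(c m i)\<^sup>2 * (1 / real m) = real m * (f ((real i + 1) / real m) - f (real i / real m))\<^sup>2"
        using False by (simp add: c_def power2_eq_square)
      show "ennreal ((c m i)\<^sup>2) * emeasure lebesgue {real i / real m<..<(real i + 1) / real m} =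
          ennreal (real m * (f ((real i + 1) / real m) - f (real i / real m))\<^sup>2)"
        unfolding em ennreal_mult'[OF zero_le_power2, symmetric] eq ..
    qed simp
    also have "\<dots> = ennreal (\<Sum>i<m. real m * (f ((real i + 1) / real m) - f (real i / real m))\<^sup>2)"
      by (intro sum_ennreal) auto
    also have "\<dots> \<le> ennreal (2 * \<alpha>)"
      using energy_le_grid[OF assms] False by (intro ennreal_leI) auto
    finally show ?thesis .
  qed (simp add: q_def)
  \<comment> \<open>An irrational point is never a grid point, so exactly one open cell contains it.
    The ends of that cell straddle \<open>x\<close>, and the quotients converge to the
    derivative.\<close>
  have lim: "(\<lambda>n. q n x) \<longlonglongrightarrow> (deriv f x)\<^sup>2" if x: "x \<in> {0<..<1} - N" "x \<notin> \<rat>" for x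
  proof -
    define i where "i m = nat \<lfloor>real m * x\<rfloor>" for m
    have i: "real (i m) < real m * x" "real m * x < real (i m) + 1" "i m < m" if "m > 0" for m :: nat
    proof -
      have pos: "real m * x > 0" using x that by simp
      then have fl: "real (i m) = of_int \<lfloor>real m * x\<rfloor>" by (simp add: i_def)
      have "real (i m) \<noteq> real m * x"
      proof
        assume "real (i m) = real m * x"
        then have "x = real (i m) / real m" using that by (simp add: field_simps)
        then show False using x(2) by simp
      qed
      then show "real (i m) < real m * x" unfolding fl using of_int_floor_le[of "real m * x"] by linarith
      show "real m * x < real (i m) + 1" unfolding fl by linarith
      have "real m * x < real m * 1" using x that by (intro mult_strict_left_mono) auto
      then show "i m < m" using \<open>real (i m) < real m * x\<close> by linarith
    qed
    have qi: "q m x = (c m (i m))\<^sup>2" if "m > 0" for m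
    proof -
      have "q m x = (\<Sum>j\<in>{i m}. (c m j)\<^sup>2 * indicator {real j / real m<..<(real j + 1) / real m} x)"
        unfolding q_def
      proof (intro sum.mono_neutral_right ballI)
        fix j assume j: "j \<in> {..<m} - {i m}"
        have "x \<in> {real (i m) / real m<..<(real (i m) + 1) / real m}"
          using i[OF that] that by (simp add: field_simps)
        then have "x \<notin> {real j / real m<..<(real j + 1) / real m}"
          using uniform_grid_disjoint[of j "i m" m] j by blast
        then show "(c m j)\<^sup>2 * indicator {real j / real m<..<(real j + 1) / real m} x = 0" by simp
      qed (use i[OF that] in auto)
      also have "\<dots> = (c m (i m))\<^sup>2"
        using i[OF that] that by (simp add: field_simps)
      finally show ?thesis .
    qed
    have "(\<lambda>n. c n (i n)) \<longlonglongrightarrow> deriv f x"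
    proof (rule LIMSEQ_I)
      fix e :: real assume "e > 0"
      then have "e / 2 > 0" by simp
      have "(f has_derivative (\<lambda>y. deriv f x * y)) (at x)"
        using der[OF x(1)] by (simp add: has_field_derivative_def)
      then obtain r where "r > 0" and r: "\<forall>y. norm (y - x) < r \<longrightarrow> norm (f y - f x - deriv f x * (y - x)) \<le> e / 2 * norm (y - x)"
        using \<open>e / 2 > 0\<close> unfolding has_derivative_at_alt by blast
      obtain M where M: "1 / real (Suc M) < r" using \<open>r > 0\<close> by (rule nat_approx_posE)
      have "norm (c n (i n) - deriv f x) < e" if "n \<ge> Suc M" for n
      proof -
        have "n > 0" using that by simp
        define u where "u = real (i n) / real n"
        define v where "v = (real (i n) + 1) / real n"
        have uv: "u < x" "x < v" using i[OF \<open>n > 0\<close>] \<open>n > 0\<close> by (auto simp: u_def v_def field_simps)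
        have len: "v - u = 1 / real n" by (simp add: u_def v_def add_divide_distrib)
        have "1 / real n \<le> 1 / real (Suc M)" using that by (intro divide_left_mono) auto
        then have "v - u < r" using len M by simp
        then have "\<bar>f v - f x - deriv f x * (v - x)\<bar> \<le> e / 2 * (v - x)"
            "\<bar>f u - f x - deriv f x * (u - x)\<bar> \<le> e / 2 * (x - u)"
          using r[rule_format, of v] r[rule_format, of u] uv by (auto simp: abs_if)
        moreover have "f v - f u - deriv f x * (v - u) = (f v - f x - deriv f x * (v - x)) - (f u - f x - deriv f x * (u - x))"
          by (simp add: algebra_simps)
        moreover have "e / 2 * (v - u) = e / 2 * (v - x) + e / 2 * (x - u)" by (simp flip: distrib_left)
        ultimately have "\<bar>f v - f u - deriv f x * (v - u)\<bar> \<le> e / 2 * (1 / real n)"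
          unfolding len[symmetric] by linarith
        then have "real n * \<bar>f v - f u - deriv f x * (v - u)\<bar> \<le> real n * (e / 2 * (1 / real n))"
          by (rule mult_left_mono) simp
        then have "real n * \<bar>f v - f u - deriv f x * (v - u)\<bar> \<le> e / 2"
          using \<open>n > 0\<close> by simp
        moreover have "c n (i n) - deriv f x = real n * (f v - f u - deriv f x * (v - u))"
          unfolding len using \<open>n > 0\<close> by (simp add: c_def u_def v_def right_diff_distrib)
        ultimately have "norm (c n (i n) - deriv f x) \<le> e / 2" by (simp add: abs_mult)
        then show ?thesis using \<open>e > 0\<close> by simp
      qed
      then show "\<exists>no. \<forall>n\<ge>no. norm (c n (i n) - deriv f x) < e" by blast
    qed
    then have "(\<lambda>n. (c n (i n))\<^sup>2) \<longlonglongrightarrow> (deriv f x)\<^sup>2" by (intro tendsto_intros)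
    then show ?thesis
    proof (rule Lim_transform_eventually)
      show "\<forall>\<^sub>F n in sequentially. (c n (i n))\<^sup>2 = q n x"
        using eventually_gt_at_top[of 0] by eventually_elim (simp add: qi)
    qed
  qed
  have "(\<integral>\<^sup>+u\<in>{0..1}. ennreal ((deriv f u)\<^sup>2) \<partial>lebesgue) \<le> (\<integral>\<^sup>+x. liminf (\<lambda>n. ennreal (q n x)) \<partial>lebesgue)"
  proof (rule nn_integral_mono_AE)
    have "negligible (N \<union> \<rat> \<union> {0, 1})"
      using N null_sets_completionI[OF countable_imp_null_set_lborel[OF countable_rat]]
      by (intro negligible_Un) (auto simp: negligible_iff_null_sets)
    then have "AE x in lebesgue. x \<notin> N \<union> \<rat> \<union> {0, 1}"
      unfolding negligible_iff_null_sets by (rule AE_not_in)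
    then show "AE x in lebesgue. ennreal ((deriv f x)\<^sup>2) * indicator {0..1} x \<le> liminf (\<lambda>n. ennreal (q n x))"
    proof eventually_elim
      case (elim x)
      show ?case
      proof (cases "x \<in> {0..1}")
        case True
        then have "x \<in> {0<..<1} - N" "x \<notin> \<rat>" using elim by auto
        from lim[OF this] have "(\<lambda>n. ennreal (q n x)) \<longlonglongrightarrow> ennreal ((deriv f x)\<^sup>2)"
          by (rule tendsto_ennrealI)
        then have "liminf (\<lambda>n. ennreal (q n x)) = ennreal ((deriv f x)\<^sup>2)"
          by (rule lim_imp_Liminf[rotated]) simp
        then show ?thesis using True by simp
      qed simp
    qed
  qed
  also have "\<dots> \<le> liminf (\<lambda>n. \<integral>\<^sup>+x. ennreal (q n x) \<partial>lebesgue)"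
    using qm by (intro nn_integral_liminf) simp
  also have "\<dots> \<le> liminf (\<lambda>n. ennreal (2 * \<alpha>))"
    by (intro Liminf_mono always_eventually allI int_q)
  also have "\<dots> = ennreal (2 * \<alpha>)" by (simp add: Liminf_const)
  finally show ?thesis .
qed

text \<open>On one interval this is Cauchy-Schwarz, obtained by integrating
  \<open>0 \<le> (deriv f x - c)\<^sup>2\<close> with the mean slope \<open>c\<close>; disjointness
  then adds up the intervals. The integral of the derivative itself comes from the fundamental
  theorem.\<close>

lemma energy_leI_nn_integral:
  assumes ac: "absolutely_continuous_fun 0 1 f" and "\<alpha> \<ge> 0"
    and int: "(\<integral>\<^sup>+u\<in>{0..1}. ennreal ((deriv f u)\<^sup>2) \<partial>lebesgue) \<le> ennreal (2 * \<alpha>)"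
  shows "energy_le f \<alpha>"
proof -
  obtain N where N: "negligible N" and der: "\<And>x. x \<in> {0<..<1} - N \<Longrightarrow> (f has_real_derivative deriv f x) (at x)"
    using absolutely_continuous_fun_differentiable_ae[OF ac] by blast
  have ac_sub: "absolutely_continuous_fun u v f" if "0 \<le> u" "v \<le> 1" for u v
    unfolding absolutely_continuous_fun_def
  proof (intro allI impI)
    fix \<epsilon> :: real assume "\<epsilon> > 0"
    then obtain \<delta> where "\<delta> > 0" and \<delta>: "\<And>(m::nat) x y.
        (\<forall>i<m. 0 \<le> x i \<and> x i \<le> y i \<and> y i \<le> 1) \<and>
        (\<forall>i<m. \<forall>j<m. i \<noteq> j \<longrightarrow> {x i<..<y i} \<inter> {x j<..<y j} = {}) \<and>
        (\<Sum>i<m. y i - x i) < \<delta> \<Longrightarrow> (\<Sum>i<m. \<bar>f (y i) - f (x i)\<bar>) < \<epsilon>"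
      using ac unfolding absolutely_continuous_fun_def by blast
    show "\<exists>\<delta>>0. \<forall>(m::nat) x y. (\<forall>i<m. u \<le> x i \<and> x i \<le> y i \<and> y i \<le> v) \<and>
        (\<forall>i<m. \<forall>j<m. i \<noteq> j \<longrightarrow> {x i<..<y i} \<inter> {x j<..<y j} = {}) \<and>
        (\<Sum>i<m. y i - x i) < \<delta> \<longrightarrow> (\<Sum>i<m. \<bar>f (y i) - f (x i)\<bar>) < \<epsilon>"
    proof (intro exI[of _ \<delta>] conjI allI impI \<open>\<delta> > 0\<close>)
      fix m :: nat and x y :: "nat \<Rightarrow> real"
      assume A: "(\<forall>i<m. u \<le> x i \<and> x i \<le> y i \<and> y i \<le> v) \<and>
        (\<forall>i<m. \<forall>j<m. i \<noteq> j \<longrightarrow> {x i<..<y i} \<inter> {x j<..<y j} = {}) \<and> (\<Sum>i<m. y i - x i) < \<delta>"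
      then have "\<forall>i<m. 0 \<le> x i \<and> x i \<le> y i \<and> y i \<le> 1" using that by force
      then show "(\<Sum>i<m. \<bar>f (y i) - f (x i)\<bar>) < \<epsilon>" using A by (intro \<delta>) blast
    qed
  qed
  have hi: "(deriv f has_integral f v - f u) {u..v}" if "0 \<le> u" "u \<le> v" "v \<le> 1" for u v
  proof (rule absolutely_continuous_fun_has_integral[OF ac_sub \<open>u \<le> v\<close> N])
    show "(f has_real_derivative deriv f x) (at x)" if "x \<in> {u<..<v} - N" for x
      using der[of x] that \<open>0 \<le> u\<close> \<open>v \<le> 1\<close> by auto
  qed fact+
  have meas: "(\<lambda>x. deriv f x * indicator {0..1} x) \<in> borel_measurable lebesgue"
    using hi[of 0 1] by (intro has_integral_implies_lebesgue_measurable_real) auto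
  define g where "g x = (deriv f x)\<^sup>2 * indicator {0..1} x" for x
  have g_eq: "g = (\<lambda>x. (deriv f x * indicator {0..1} x)\<^sup>2)"
    by (auto simp: g_def fun_eq_iff indicator_def)
  have gm[measurable]: "g \<in> borel_measurable lebesgue" unfolding g_eq using meas by measurable
  have g0: "g x \<ge> 0" for x by (simp add: g_def)
  have int': "(\<integral>\<^sup>+x. ennreal (g x) \<partial>lebesgue) \<le> ennreal (2 * \<alpha>)"
    using int by (simp add: g_def ennreal_mult' ennreal_indicator)
  have gi: "integrable lebesgue g"
    using int' g0 by (intro integrableI_nonneg) (auto intro: le_less_trans)
  have one: "ennreal ((f v - f u)\<^sup>2 / (v - u)) \<le> (\<integral>\<^sup>+x. ennreal (g x) * indicator {u<..<v} x \<partial>lebesgue)"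
    if uv: "0 \<le> u" "u \<le> v" "v \<le> 1" for u v
  proof (cases "u = v")
    case False
    then have "u < v" using uv by simp
    define gg where "gg x = g x * indicator {u<..<v} x" for x
    have ggi: "integrable lebesgue gg"
      unfolding gg_def using gi by (intro integrable_real_mult_indicator) auto
    have "set_integrable lebesgue {u..v} gg"
      unfolding set_integrable_def using ggi by (intro integrable_mult_indicator) auto
    from has_integral_set_lebesgue[OF this] have I: "(gg has_integral (LINT x:{u..v}|lebesgue. gg x)) {u..v}" .
    have LL: "(LINT x:{u..v}|lebesgue. gg x) = integral\<^sup>L lebesgue gg"
      unfolding set_lebesgue_integral_def by (intro Bochner_Integration.integral_cong) (auto simp: gg_def indicator_def)
    define c where "c = (f v - f u) / (v - u)"
    \<comment> \<open>The left side is twice, and the last term once,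
      \<open>(f v - f u)\<^sup>2 / (v - u)\<close>; one copy remains below the integral of
      \<open>gg\<close>.\<close>
    have "2 * c * (f v - f u) \<le> integral\<^sup>L lebesgue gg + c\<^sup>2 * (v - u)"
    proof (rule has_integral_le)
      show "((\<lambda>x. if x \<in> {u, v} then 0 else 2 * c * deriv f x) has_integral 2 * c * (f v - f u)) {u..v}"
        by (rule has_integral_spike_finite[of "{u, v}", OF _ _ has_integral_mult_right[OF hi[OF uv], of "2 * c"]]) auto
      show "((\<lambda>x. gg x + c\<^sup>2) has_integral (integral\<^sup>L lebesgue gg + c\<^sup>2 * (v - u))) {u..v}"
        using has_integral_add[OF I[unfolded LL] has_integral_const_real[of "c\<^sup>2" u v]] uv by (simp add: mult.commute)
      fix x assume "x \<in> {u..v}"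
      show "(if x \<in> {u, v} then 0 else 2 * c * deriv f x) \<le> gg x + c\<^sup>2"
      proof (cases "x \<in> {u, v}")
        case True
        then show ?thesis by (auto simp: gg_def)
      next
        case False
        then have "gg x = (deriv f x)\<^sup>2" using \<open>x \<in> {u..v}\<close> uv by (auto simp: gg_def g_def)
        moreover have "0 \<le> (deriv f x - c)\<^sup>2" by simp
        ultimately show ?thesis using False by (simp add: power2_eq_square algebra_simps)
      qed
    qed
    moreover have "2 * c * (f v - f u) = 2 * ((f v - f u)\<^sup>2 / (v - u))" "c\<^sup>2 * (v - u) = (f v - f u)\<^sup>2 / (v - u)"
      using \<open>u < v\<close> by (simp_all add: c_def power2_eq_square)
    ultimately have "(f v - f u)\<^sup>2 / (v - u) \<le> integral\<^sup>L lebesgue gg" by linarith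
    then have "ennreal ((f v - f u)\<^sup>2 / (v - u)) \<le> ennreal (integral\<^sup>L lebesgue gg)" by (rule ennreal_leI)
    also have "\<dots> = (\<integral>\<^sup>+x. ennreal (gg x) \<partial>lebesgue)"
      using ggi g0 by (intro nn_integral_eq_integral[symmetric]) (auto simp: gg_def)
    also have "\<dots> = (\<integral>\<^sup>+x. ennreal (g x) * indicator {u<..<v} x \<partial>lebesgue)"
      using g0 by (intro nn_integral_cong) (simp add: gg_def ennreal_mult' ennreal_indicator)
    finally show ?thesis .
  qed simp
  show ?thesis
    unfolding energy_le_def
  proof (intro allI impI)
    fix m :: nat and u v :: "nat \<Rightarrow> real"
    assume uv: "(\<forall>i<m. 0 \<le> u i \<and> u i \<le> v i \<and> v i \<le> 1) \<and>
        (\<forall>i<m. \<forall>j<m. i \<noteq> j \<longrightarrow> {u i<..<v i} \<inter> {u j<..<v j} = {})"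
    have "ennreal (\<Sum>i<m. (f (v i) - f (u i))\<^sup>2 / (v i - u i)) = (\<Sum>i<m. ennreal ((f (v i) - f (u i))\<^sup>2 / (v i - u i)))"
      using uv by (intro sum_ennreal[symmetric]) auto
    also have "\<dots> \<le> (\<Sum>i<m. \<integral>\<^sup>+x. ennreal (g x) * indicator {u i<..<v i} x \<partial>lebesgue)"
      using uv by (intro sum_mono one) auto
    also have "\<dots> = (\<integral>\<^sup>+x. (\<Sum>i<m. ennreal (g x) * indicator {u i<..<v i} x) \<partial>lebesgue)"
      by (intro nn_integral_sum[symmetric] borel_measurable_times_ennreal measurable_compose[OF gm measurable_ennreal]
          borel_measurable_indicator) auto
    also have "\<dots> \<le> (\<integral>\<^sup>+x. ennreal (g x) \<partial>lebesgue)"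
    proof (rule nn_integral_mono)
      fix x
      have "(\<Sum>i<m. indicator {u i<..<v i} x :: ennreal) = indicator (\<Union>i\<in>{..<m}. {u i<..<v i}) x"
        using uv by (intro indicator_UN_disjoint[symmetric]) (auto simp: disjoint_family_on_def)
      also have "\<dots> \<le> 1" by (simp add: indicator_def)
      finally have "ennreal (g x) * (\<Sum>i<m. indicator {u i<..<v i} x) \<le> ennreal (g x) * 1"
        by (rule mult_left_mono) simp
      then show "(\<Sum>i<m. ennreal (g x) * indicator {u i<..<v i} x) \<le> ennreal (g x)"
        by (simp add: sum_distrib_left)
    qed
    also have "\<dots> \<le> ennreal (2 * \<alpha>)" by (rule int')
    finally show "(\<Sum>i<m. (f (v i) - f (u i))\<^sup>2 / (v i - u i)) \<le> 2 * \<alpha>"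
      using \<open>\<alpha> \<ge> 0\<close> by (subst (asm) ennreal_le_iff) auto
  qed
qed

text \<open>From here on the rate enters through its level sets in this form and through
  nonnegativity; derivatives and integrals of paths do not return.\<close>

lemma mdp_rate_le_iff:
  "mdp_rate z \<le> ereal \<alpha> \<longleftrightarrow> apply_cadlag z 0 = 0 \<and> energy_le (apply_cadlag z) \<alpha>"
proof -
  have half: "1 / 2 * enn2ereal J \<le> ereal \<alpha> \<longleftrightarrow> \<alpha> \<ge> 0 \<and> J \<le> ennreal (2 * \<alpha>)" for J
  proof (cases J)
    case (real r)
    then have "1 / 2 * enn2ereal J = ereal (r / 2)" by (simp add: enn2ereal_ennreal)
    then show ?thesis using real by (auto simp: ennreal_le_iff2)
  next
    case top
    have "(1 / 2 :: ereal) = ereal (1 / 2)" by (simp add: one_ereal_def)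
    then have "1 / 2 * enn2ereal top = \<infinity>" by (simp add: enn2ereal_top)
    then show ?thesis using top by (simp add: top_unique)
  qed
  show ?thesis
    unfolding mdp_rate_def
    using energy_le_imp_absolutely_continuous energy_le_nonneg nn_integral_deriv_square_le
      energy_leI_nn_integral[of "apply_cadlag z" \<alpha>] half
    by (auto simp del: enn2ereal_nonneg)
qed

lemma mdp_rate_nonneg: "0 \<le> mdp_rate z"
  by (auto simp: mdp_rate_def)

section \<open>Compactness of the level sets\<close>

lemma is_cadlag_continuous_on:
  assumes "continuous_on {0..1} f"
  shows "is_cadlag f"
  unfolding is_cadlag_def
proof (intro conjI ballI)
  have tl: "(f \<longlongrightarrow> f t) (at t within {0..1})" if "t \<in> {0..1}" for t
    using assms that by (simp add: continuous_on_def)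
  show "(f \<longlongrightarrow> f t) (at_right t)" if "t \<in> {0..<1}" for t
  proof -
    have "(f \<longlongrightarrow> f t) (at t within {t..1})"
      using that by (intro tendsto_within_subset[OF tl]) auto
    then show ?thesis using at_within_Icc_at_right[of t 1] that by simp
  qed
  show "\<exists>l. (f \<longlongrightarrow> l) (at_left t)" if "t \<in> {0<..1}" for t
  proof -
    have "(f \<longlongrightarrow> f t) (at t within {0..t})"
      using that by (intro tendsto_within_subset[OF tl]) auto
    then have "(f \<longlongrightarrow> f t) (at_left t)" using at_within_Icc_at_left[of 0 t] that by simp
    then show ?thesis ..
  qed
qed

definition cadlag_of :: "(real \<Rightarrow> real) \<Rightarrow> cadlag" where
  "cadlag_of f = Cadlag (\<lambda>t. if t \<in> {0..1} then f t else 0)"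

lemma apply_cadlag_of:
  assumes "continuous_on {0..1} f"
  shows "apply_cadlag (cadlag_of f) t = (if t \<in> {0..1} then f t else 0)"
proof -
  have "continuous_on {0..1} (\<lambda>t. if t \<in> {0..1} then f t else 0)"
    using assms by (rule continuous_on_eq) simp
  then show ?thesis
    unfolding cadlag_of_def by (subst Cadlag_inverse) (auto intro: is_cadlag_continuous_on)
qed

lemma dist_cadlag_le: "(\<And>t. t \<in> {0..1} \<Longrightarrow> \<bar>apply_cadlag f t - apply_cadlag g t\<bar> \<le> b) \<Longrightarrow> dist f g \<le> b"
  unfolding dist_cadlag_def by (intro cadlag_norm_leI) (simp add: minus_cadlag.rep_eq)

lemma dist_cadlag_ge: "t \<in> {0..1} \<Longrightarrow> \<bar>apply_cadlag f t - apply_cadlag g t\<bar> \<le> dist f g"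
  unfolding dist_cadlag_def using cadlag_abs_le_norm[of t "f - g"] by (simp add: minus_cadlag.rep_eq)

lemma energy_le_modulus:
  assumes "energy_le f \<alpha>" "u \<in> {0..1}" "v \<in> {0..1}"
  shows "\<bar>f v - f u\<bar> \<le> sqrt (2 * \<alpha> * \<bar>v - u\<bar>)"
proof -
  have "(f v - f u)\<^sup>2 \<le> 2 * \<alpha> * \<bar>v - u\<bar>"
    using energy_le_increment[OF assms(1), of u v] energy_le_increment[OF assms(1), of v u] assms(2,3)
    by (cases "u \<le> v") (auto simp: power2_commute)
  then show ?thesis by (rule real_le_rsqrt[of "\<bar>f v - f u\<bar>", simplified])
qed

text \<open>Bounded energy gives the common modulus
  \<open>sqrt (2 * \<alpha> * \<bar>v - u\<bar>)\<close>, and the value 0 at time 0 turns it into a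
  common bound, so Arzela-Ascoli applies; semicontinuity keeps the limit in the level set.\<close>

lemma good_mdp_rate: "good_rate_function mdp_rate"
  unfolding good_rate_function_def compact_eq_seq_compact_metric seq_compact_def
proof (intro allI impI)
  fix \<alpha> :: real and z :: "nat \<Rightarrow> cadlag"
  assume "\<forall>n. z n \<in> {x. mdp_rate x \<le> ereal \<alpha>}"
  then have z0: "apply_cadlag (z n) 0 = 0" and ze: "energy_le (apply_cadlag (z n)) \<alpha>" for n
    by (auto simp: mdp_rate_le_iff)
  have "\<alpha> \<ge> 0" using ze[of 0] by (rule energy_le_nonneg)
  have mod: "\<bar>apply_cadlag (z n) v - apply_cadlag (z n) u\<bar> \<le> sqrt (2 * \<alpha> * \<bar>v - u\<bar>)"
    if "u \<in> {0..1}" "v \<in> {0..1}" for n u v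
    using energy_le_modulus[OF ze] that by blast
  obtain g r where g: "continuous_on {0..1} g" and r: "strict_mono (r :: nat \<Rightarrow> nat)"
    and conv: "\<And>e. 0 < e \<Longrightarrow> \<exists>N. \<forall>n x. n \<ge> N \<and> x \<in> {0..1} \<longrightarrow> norm (apply_cadlag (z (r n)) x - g x) < e"
  proof (rule Arzela_Ascoli[of "{0..1::real}" "\<lambda>n. apply_cadlag (z n)" "sqrt (2 * \<alpha>)"])
    show "norm (apply_cadlag (z n) x) \<le> sqrt (2 * \<alpha>)" if "x \<in> {0..1}" for n x
    proof -
      have "\<bar>apply_cadlag (z n) x\<bar> \<le> sqrt (2 * \<alpha> * \<bar>x\<bar>)" using mod[of 0 x n] that z0 by simp
      also have "\<dots> \<le> sqrt (2 * \<alpha> * 1)"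
        using that \<open>\<alpha> \<ge> 0\<close> by (intro real_sqrt_le_mono mult_left_mono) auto
      finally show ?thesis by simp
    qed
    show "\<exists>d>0. \<forall>n y. y \<in> {0..1} \<and> norm (x - y) < d \<longrightarrow> norm (apply_cadlag (z n) x - apply_cadlag (z n) y) < e"
      if "x \<in> {0..1}" "0 < e" for x e
    proof (intro exI[of _ "e\<^sup>2 / (2 * \<alpha> + 1)"] conjI allI impI)
      show "0 < e\<^sup>2 / (2 * \<alpha> + 1)" using that \<open>\<alpha> \<ge> 0\<close> by simp
      fix n y assume y: "y \<in> {0..1} \<and> norm (x - y) < e\<^sup>2 / (2 * \<alpha> + 1)"
      then have "(2 * \<alpha> + 1) * \<bar>x - y\<bar> < e\<^sup>2" using \<open>\<alpha> \<ge> 0\<close> by (simp add: field_simps)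
      moreover have "2 * \<alpha> * \<bar>x - y\<bar> \<le> (2 * \<alpha> + 1) * \<bar>x - y\<bar>" by (intro mult_right_mono) auto
      ultimately have "sqrt (2 * \<alpha> * \<bar>x - y\<bar>) < e"
        using that by (intro real_less_lsqrt) auto
      then show "norm (apply_cadlag (z n) x - apply_cadlag (z n) y) < e"
        using mod[of y x n] y that by simp
    qed
  qed auto
  define l where "l = cadlag_of g"
  have al: "apply_cadlag l t = g t" if "t \<in> {0..1}" for t
    using apply_cadlag_of[OF g, of t] that by (simp add: l_def)
  have lim: "(z \<circ> r) \<longlonglongrightarrow> l"
  proof (rule metric_LIMSEQ_I)
    fix e :: real assume "0 < e"
    then have "e / 2 > 0" by simp
    from conv[OF this] obtain N where N: "\<forall>n x. n \<ge> N \<and> x \<in> {0..1} \<longrightarrow> norm (apply_cadlag (z (r n)) x - g x) < e / 2" by blast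
    have "dist ((z \<circ> r) n) l < e" if "n \<ge> N" for n
    proof -
      have "dist ((z \<circ> r) n) l \<le> e / 2"
        using N that by (intro dist_cadlag_le) (auto simp: al less_imp_le)
      then show ?thesis using \<open>0 < e\<close> by simp
    qed
    then show "\<exists>N. \<forall>n\<ge>N. dist ((z \<circ> r) n) l < e" by blast
  qed
  have pt: "(\<lambda>n. apply_cadlag (z (r n)) t) \<longlonglongrightarrow> apply_cadlag l t" if "t \<in> {0..1}" for t
  proof (rule metric_tendsto_imp_tendsto[OF lim])
    show "\<forall>\<^sub>F n in sequentially. dist (apply_cadlag (z (r n)) t) (apply_cadlag l t) \<le> dist ((z \<circ> r) n) l"
      using dist_cadlag_ge[OF that] by (auto simp: dist_real_def)
  qed
  have "apply_cadlag l 0 = 0"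
    using pt[of 0] z0 by (simp add: LIMSEQ_const_iff)
  moreover have "energy_le (apply_cadlag l) \<alpha>"
    using pt ze by (rule energy_le_tendsto)
  ultimately show "\<exists>l\<in>{x. mdp_rate x \<le> ereal \<alpha>}. \<exists>r. strict_mono r \<and> (z \<circ> r) \<longlonglongrightarrow> l"
    using lim r by (auto simp: mdp_rate_le_iff)
qed

text \<open>A sum of clamped ramps that interpolates \<open>c i - c 0\<close> at
  \<open>i / m\<close>. Each ramp is monotone with values in \<open>{0..1}\<close> and moves on one
  cell only, which is what the energy estimate exploits.\<close>

definition polygon :: "nat \<Rightarrow> (nat \<Rightarrow> real) \<Rightarrow> real \<Rightarrow> real" where
  "polygon m c t = (\<Sum>i<m. (c (Suc i) - c i) * max 0 (min 1 (real m * t - real i)))"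

lemma continuous_on_polygon: "continuous_on A (polygon m c)"
  unfolding polygon_def by (intro continuous_intros)

lemma polygon_cell:
  assumes "i < m" "real i / real m \<le> t" "t \<le> (real i + 1) / real m"
  shows "polygon m c t = c i - c 0 + (real m * t - real i) * (c (Suc i) - c i)"
proof -
  have "m > 0" using assms(1) by simp
  have b: "real i \<le> real m * t" "real m * t \<le> real i + 1"
    using assms(2,3) \<open>m > 0\<close> by (simp_all add: field_simps)
  have "polygon m c t = (\<Sum>j<Suc i. (c (Suc j) - c j) * max 0 (min 1 (real m * t - real j)))"
    unfolding polygon_def
  proof (rule sum.mono_neutral_right)
    show "\<forall>j\<in>{..<m} - {..<Suc i}. (c (Suc j) - c j) * max 0 (min 1 (real m * t - real j)) = 0"
    proof
      fix j assume "j \<in> {..<m} - {..<Suc i}"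
      then have "real i + 1 \<le> real j" by auto
      then have "max 0 (min 1 (real m * t - real j)) = 0" using b by simp
      then show "(c (Suc j) - c j) * max 0 (min 1 (real m * t - real j)) = 0" by simp
    qed
  qed (use assms in auto)
  also have "\<dots> = (\<Sum>j<i. (c (Suc j) - c j) * max 0 (min 1 (real m * t - real j))) + (c (Suc i) - c i) * (real m * t - real i)"
    using b by simp
  also have "(\<Sum>j<i. (c (Suc j) - c j) * max 0 (min 1 (real m * t - real j))) = (\<Sum>j<i. c (Suc j) - c j)"
  proof (rule sum.cong)
    fix j assume "j \<in> {..<i}"
    then have "real j + 1 \<le> real i" by auto
    then have "max 0 (min 1 (real m * t - real j)) = 1" using b by simp
    then show "(c (Suc j) - c j) * max 0 (min 1 (real m * t - real j)) = c (Suc j) - c j" by simp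
  qed simp
  also have "(\<Sum>j<i. c (Suc j) - c j) = c i - c 0" by (rule sum_lessThan_telescope)
  finally show ?thesis by (simp add: mult.commute)
qed

lemma grid_cellE:
  assumes "m > 0" "t \<in> {0..1::real}"
  obtains i where "i < m" "real i / real m \<le> t" "t \<le> (real i + 1) / real m"
proof (cases "t = 1")
  case True
  then show ?thesis using assms(1) that[of "m - 1"] by (simp add: field_simps of_nat_diff)
next
  case False
  define i where "i = nat \<lfloor>real m * t\<rfloor>"
  have fl: "real i = of_int \<lfloor>real m * t\<rfloor>" using assms by (simp add: i_def)
  have "real m * t < real m * 1" using assms False by (intro mult_strict_left_mono) auto
  then have "i < m" using fl of_int_floor_le[of "real m * t"] by linarith
  moreover have "real i \<le> real m * t" "real m * t \<le> real i + 1" unfolding fl by linarith+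
  ultimately show ?thesis using assms(1) that[of i] by (simp add: field_simps)
qed

text \<open>A monotone function carries intervals with disjoint interiors to such intervals inside
  \<open>{l..r}\<close>, so this is a comparison of Lebesgue measures.\<close>

lemma sum_increments_mono_le:
  fixes h :: "real \<Rightarrow> real"
  assumes "mono h" and range: "\<And>x. h x \<in> {l..r}" and uv: "\<And>i. i < m \<Longrightarrow> u i \<le> v i"
    and disj: "\<And>i j. i < m \<Longrightarrow> j < m \<Longrightarrow> i \<noteq> j \<Longrightarrow> {u i<..<v i} \<inter> {u j<..<v j} = {}"
  shows "(\<Sum>i<(m::nat). h (v i) - h (u i)) \<le> r - l"
proof -
  have mono: "h x \<le> h y" if "x \<le> y" for x y using \<open>mono h\<close> that by (rule monoD)
  have "(\<Sum>i<m. h (v i) - h (u i)) = (\<Sum>i<m. measure lborel {h (u i)<..<h (v i)})"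
    using uv by (intro sum.cong) (auto simp: mono)
  also have "\<dots> = measure lborel (\<Union>i<m. {h (u i)<..<h (v i)})"
  proof (rule measure_finite_Union[symmetric])
    show "disjoint_family_on (\<lambda>i. {h (u i)<..<h (v i)}) {..<m}"
      unfolding disjoint_family_on_def
    proof (intro ballI impI)
      fix i j assume ij: "i \<in> {..<m}" "j \<in> {..<m}" "i \<noteq> j"
      consider "u i = v i" | "u j = v j" | "u i < v i" "u j < v j" using uv[of i] uv[of j] ij by fastforce
      then show "{h (u i)<..<h (v i)} \<inter> {h (u j)<..<h (v j)} = {}"
      proof cases
        case 3
        have "v i \<le> u j \<or> v j \<le> u i"
        proof (rule ccontr)
          assume "\<not> ?thesis"
          then have "max (u i) (u j) < min (v i) (v j)" using 3 by auto
          then obtain x where "max (u i) (u j) < x" "x < min (v i) (v j)" using dense by blast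
          then have "x \<in> {u i<..<v i} \<inter> {u j<..<v j}" by auto
          then show False using disj[of i j] ij by auto
        qed
        then have "h (v i) \<le> h (u j) \<or> h (v j) \<le> h (u i)" using mono by blast
        then show ?thesis by auto
      qed auto
    qed
    show "emeasure lborel {h (u i)<..<h (v i)} \<noteq> \<infinity>" for i
      by (cases "h (u i) \<le> h (v i)") auto
  qed auto
  also have "\<dots> \<le> measure lborel {l..r}"
  proof (rule measure_mono_fmeasurable)
    show "(\<Union>i<m. {h (u i)<..<h (v i)}) \<subseteq> {l..r}"
    proof
      fix x assume "x \<in> (\<Union>i<m. {h (u i)<..<h (v i)})"
      then obtain i where "h (u i) < x" "x < h (v i)" by auto
      then show "x \<in> {l..r}" using range[of "u i"] range[of "v i"] by simp
    qed
    show "{l..r} \<in> fmeasurable lborel" by (intro fmeasurableI) (auto simp: emeasure_lborel_Icc_eq)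
  qed auto
  also have "\<dots> = r - l" using range[of 0] by auto
  finally show ?thesis .
qed

text \<open>Cauchy-Schwarz with the weights \<open>w j i\<close>, the share of cell \<open>i\<close>
  covered by the \<open>j\<close>-th interval: over \<open>i\<close> they sum to \<open>m\<close>
  times the length of that interval, over \<open>j\<close> to at most 1.\<close>

lemma energy_le_polygon:
  assumes "m > 0"
  shows "energy_le (polygon m c) (real m / 2 * (\<Sum>i<m. (c (Suc i) - c i)\<^sup>2))"
  unfolding energy_le_def
proof (intro allI impI)
  fix n :: nat and u v :: "nat \<Rightarrow> real"
  assume uv: "(\<forall>i<n. 0 \<le> u i \<and> u i \<le> v i \<and> v i \<le> 1) \<and>
        (\<forall>i<n. \<forall>j<n. i \<noteq> j \<longrightarrow> {u i<..<v i} \<inter> {u j<..<v j} = {})"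
  define h where "h i t = max 0 (min 1 (real m * t - real i))" for i :: nat and t :: real
  have h_mono: "mono (h i)" for i
  proof (rule monoI)
    fix x y :: real assume "x \<le> y"
    then have "real m * x \<le> real m * y" by (intro mult_left_mono) auto
    then show "h i x \<le> h i y" unfolding h_def by linarith
  qed
  define w where "w j i = h i (v j) - h i (u j)" for i j
  have w0: "w j i \<ge> 0" if "j < n" for j i using uv that monoD[OF h_mono] by (simp add: w_def)
  \<comment> \<open>With \<open>real\<close> as vertex sequence the polygon is
    \<open>real m * t\<close>, which is the sum of the ramps.\<close>
  have sum_h: "(\<Sum>i<m. h i t) = real m * t" if t: "t \<in> {0..1}" for t
  proof -
    obtain i where i: "i < m" "real i / real m \<le> t" "t \<le> (real i + 1) / real m"
      using assms t by (rule grid_cellE)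
    show ?thesis using polygon_cell[OF i, of real] by (simp add: polygon_def h_def)
  qed
  have one: "(polygon m c (v j) - polygon m c (u j))\<^sup>2 / (v j - u j) \<le> real m * (\<Sum>i<m. (c (Suc i) - c i)\<^sup>2 * w j i)"
    if j: "j < n" for j
  proof (cases "u j = v j")
    case False
    then have "u j < v j" "u j \<in> {0..1}" "v j \<in> {0..1}" using uv j by force+
    have "polygon m c (v j) - polygon m c (u j) = (\<Sum>i<m. sqrt (w j i) * ((c (Suc i) - c i) * sqrt (w j i)))"
      unfolding polygon_def sum_subtractf[symmetric]
    proof (rule sum.cong)
      fix i
      have "sqrt (w j i) * ((c (Suc i) - c i) * sqrt (w j i)) = (c (Suc i) - c i) * (sqrt (w j i))\<^sup>2"
        by (simp add: power2_eq_square)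
      also have "\<dots> = (c (Suc i) - c i) * w j i" using w0[OF j] by simp
      finally show "(c (Suc i) - c i) * max 0 (min 1 (real m * v j - real i)) - (c (Suc i) - c i) * max 0 (min 1 (real m * u j - real i)) =
          sqrt (w j i) * ((c (Suc i) - c i) * sqrt (w j i))"
        by (simp add: w_def h_def right_diff_distrib)
    qed simp
    then have "(polygon m c (v j) - polygon m c (u j))\<^sup>2 \<le>
        (\<Sum>i<m. (sqrt (w j i))\<^sup>2) * (\<Sum>i<m. ((c (Suc i) - c i) * sqrt (w j i))\<^sup>2)"
      by (simp only: Cauchy_Schwarz_ineq_sum)
    also have "\<dots> = (\<Sum>i<m. w j i) * (\<Sum>i<m. (c (Suc i) - c i)\<^sup>2 * w j i)"
      using w0[OF j] by (simp add: power_mult_distrib)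
    also have "(\<Sum>i<m. w j i) = real m * (v j - u j)"
      unfolding w_def sum_subtractf
      using sum_h[OF \<open>u j \<in> {0..1}\<close>] sum_h[OF \<open>v j \<in> {0..1}\<close>] by (simp add: right_diff_distrib)
    finally show ?thesis using \<open>u j < v j\<close> by (simp add: divide_le_eq mult.assoc mult.left_commute mult.commute)
  qed (use w0[OF j] in \<open>auto intro!: mult_nonneg_nonneg sum_nonneg\<close>)
  have "(\<Sum>j<n. (polygon m c (v j) - polygon m c (u j))\<^sup>2 / (v j - u j)) \<le>
      (\<Sum>j<n. real m * (\<Sum>i<m. (c (Suc i) - c i)\<^sup>2 * w j i))"
    using one by (intro sum_mono) auto
  also have "\<dots> = real m * (\<Sum>i<m. (c (Suc i) - c i)\<^sup>2 * (\<Sum>j<n. w j i))"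
    unfolding sum_distrib_left by (rule sum.swap)
  also have "\<dots> \<le> real m * (\<Sum>i<m. (c (Suc i) - c i)\<^sup>2 * 1)"
  proof (intro mult_left_mono sum_mono)
    fix i
    have "(\<Sum>j<n. h i (v j) - h i (u j)) \<le> 1 - 0"
      using uv by (intro sum_increments_mono_le h_mono) (auto simp: h_def)
    then show "(\<Sum>j<n. w j i) \<le> 1" by (simp add: w_def)
  qed auto
  finally show "(\<Sum>j<n. (polygon m c (v j) - polygon m c (u j))\<^sup>2 / (v j - u j)) \<le>
      2 * (real m / 2 * (\<Sum>i<m. (c (Suc i) - c i)\<^sup>2))" by simp
qed

lemma mdp_rate_polygon_le:
  assumes "m > 0" "c 0 = 0"
  shows "mdp_rate (cadlag_of (polygon m c)) \<le> ereal (real m / 2 * (\<Sum>i<m. (c (Suc i) - c i)\<^sup>2))"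
proof -
  have ap: "apply_cadlag (cadlag_of (polygon m c)) t = polygon m c t" if "t \<in> {0..1}" for t
    using apply_cadlag_of[OF continuous_on_polygon, of m c t] that by simp
  have "polygon m c 0 = 0" using polygon_cell[of 0 m 0 c] assms by simp
  \<comment> \<open>A constant sequence in the semicontinuity lemma replaces a function by one that
    agrees with it on \<open>{0..1}\<close>.\<close>
  moreover have "energy_le (apply_cadlag (cadlag_of (polygon m c))) (real m / 2 * (\<Sum>i<m. (c (Suc i) - c i)\<^sup>2))"
    by (rule energy_le_tendsto[of "\<lambda>_. polygon m c"]) (simp add: ap, rule energy_le_polygon[OF assms(1)])
  ultimately show ?thesis by (simp add: mdp_rate_le_iff ap)
qed

text \<open>On cell \<open>i\<close> the polygon stays within
  \<open>\<bar>c (Suc i) - c i\<bar>\<close> of \<open>c i\<close>.\<close>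

lemma dist_polygon_le:
  assumes "m > 0" "c 0 = 0"
    and near: "\<And>i t. i < m \<Longrightarrow> t \<in> {0..1} \<Longrightarrow> real i / real m \<le> t \<Longrightarrow> t \<le> (real i + 1) / real m \<Longrightarrow>
        \<bar>apply_cadlag z t - c i\<bar> + \<bar>c (Suc i) - c i\<bar> \<le> b"
  shows "dist z (cadlag_of (polygon m c)) \<le> b"
proof (rule dist_cadlag_le)
  fix t :: real assume t: "t \<in> {0..1}"
  obtain i where i: "i < m" "real i / real m \<le> t" "t \<le> (real i + 1) / real m"
    using assms(1) t by (rule grid_cellE)
  define p where "p = (real m * t - real i) * (c (Suc i) - c i)"
  have "\<bar>real m * t - real i\<bar> \<le> 1" using i assms(1) by (simp add: field_simps abs_le_iff)
  then have "\<bar>p\<bar> \<le> 1 * \<bar>c (Suc i) - c i\<bar>"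
    unfolding p_def abs_mult by (intro mult_right_mono) auto
  moreover have "apply_cadlag (cadlag_of (polygon m c)) t = c i + p"
    unfolding p_def using apply_cadlag_of[OF continuous_on_polygon, of m c t] t polygon_cell[OF i, of c] assms(2) by simp
  ultimately show "\<bar>apply_cadlag z t - apply_cadlag (cadlag_of (polygon m c)) t\<bar> \<le> b"
    using near[OF i(1) t i(2,3)] abs_triangle_ineq4[of "apply_cadlag z t - c i" p] by simp
qed

text \<open>The uniform topology is not locally compact, so a positive distance between a level set and a disjoint
  closed set comes from minimising the distance to the closed set over the compact level set.\<close>

lemma compact_closed_separated:
  fixes K F :: "'a :: metric_space set"
  assumes "compact K" "closed F" "K \<inter> F = {}"
  obtains d where "d > 0" "\<And>x y. x \<in> K \<Longrightarrow> y \<in> F \<Longrightarrow> d \<le> dist x y"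
proof (cases "K = {} \<or> F = {}")
  case True
  then show ?thesis using that[of 1] by auto
next
  case False
  then obtain x where x: "x \<in> K" "\<And>y. y \<in> K \<Longrightarrow> infdist x F \<le> infdist y F"
    using continuous_attains_inf[OF assms(1) _ continuous_on_infdist[OF continuous_on_id], of F] by blast
  have "infdist x F \<noteq> 0"
    using in_closed_iff_infdist_zero[OF assms(2), of x] False x assms(3) by blast
  then have "infdist x F > 0" using infdist_nonneg[of x F] by simp
  moreover have "infdist x F \<le> dist y w" if "y \<in> K" "w \<in> F" for y w
    using x(2)[OF that(1)] infdist_le[OF that(2), of y] by simp
  ultimately show ?thesis by (rule that)
qed

section \<open>Exponentially small sequences\<close>

locale speed =
  fixes a :: "nat \<Rightarrow> real"
  assumes a_pos: "\<And>n. n \<ge> 1 \<Longrightarrow> a n > 0" and a_lim: "a \<longlonglongrightarrow> 0"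
begin

text \<open>For nonnegative \<open>p\<close> this says that the limsup of
  \<open>a n * ln (p n)\<close> is at most \<open>- \<alpha>\<close>. Without the logarithm,
  vanishing probabilities need no special case and sums and products are estimated directly.\<close>

definition exp_bound :: "(nat \<Rightarrow> real) \<Rightarrow> real \<Rightarrow> bool" where
  "exp_bound p \<alpha> \<longleftrightarrow> (\<forall>\<delta>>0. \<forall>\<^sub>F n in sequentially. p n \<le> exp ((\<delta> - \<alpha>) / a n))"

lemma eventually_a_pos: "\<forall>\<^sub>F n in sequentially. n \<ge> 1 \<and> a n > 0"
  using eventually_ge_at_top[of 1] by eventually_elim (simp add: a_pos)

text \<open>\<open>\<delta> / a n\<close> tends to infinity, so constant factors cost nothing at
  this scale.\<close>

lemma eventually_le_exp:
  assumes "\<delta> > 0"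
  shows "\<forall>\<^sub>F n in sequentially. c \<le> exp (\<delta> / a n)"
proof -
  define C where "C = max c 2"
  have "ln C > 0" by (simp add: C_def)
  then have "\<forall>\<^sub>F n in sequentially. a n < \<delta> / ln C"
    using assms by (intro order_tendstoD[OF a_lim]) simp
  then show ?thesis using eventually_a_pos
  proof eventually_elim
    case (elim n)
    then have "ln C < \<delta> / a n" using \<open>ln C > 0\<close> by (simp add: field_simps)
    then have "exp (ln C) \<le> exp (\<delta> / a n)" by simp
    then show ?case by (simp add: C_def)
  qed
qed

lemma exp_boundD: "exp_bound p \<alpha> \<Longrightarrow> \<delta> > 0 \<Longrightarrow> \<forall>\<^sub>F n in sequentially. p n \<le> exp ((\<delta> - \<alpha>) / a n)"
  by (simp add: exp_bound_def)

lemma exp_bound_mono: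
  assumes "exp_bound q \<alpha>" "\<forall>\<^sub>F n in sequentially. p n \<le> q n"
  shows "exp_bound p \<alpha>"
  unfolding exp_bound_def
proof (intro allI impI)
  fix \<delta> :: real assume "\<delta> > 0"
  from exp_boundD[OF assms(1) this] assms(2) show "\<forall>\<^sub>F n in sequentially. p n \<le> exp ((\<delta> - \<alpha>) / a n)"
    by eventually_elim simp
qed

lemma exp_bound_cmult:
  assumes "exp_bound p \<alpha>" "c \<ge> 0"
  shows "exp_bound (\<lambda>n. c * p n) \<alpha>"
  unfolding exp_bound_def
proof (intro allI impI)
  fix \<delta> :: real assume "\<delta> > 0"
  then have "\<delta> / 2 > 0" by simp
  from exp_boundD[OF assms(1) this] eventually_le_exp[OF this, of c]
  show "\<forall>\<^sub>F n in sequentially. c * p n \<le> exp ((\<delta> - \<alpha>) / a n)"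
  proof eventually_elim
    case (elim n)
    then have "c * p n \<le> exp (\<delta> / 2 / a n) * exp ((\<delta> / 2 - \<alpha>) / a n)"
      using assms(2) by (meson mult_left_mono mult_right_mono order_trans exp_ge_zero)
    also have "\<dots> = exp ((\<delta> - \<alpha>) / a n)"
      unfolding exp_add[symmetric] add_divide_distrib[symmetric] by simp
    finally show ?case .
  qed
qed

text \<open>The sum is at most twice the maximum, and the factor 2 is absorbed.\<close>

lemma exp_bound_add:
  assumes "exp_bound p \<alpha>" "exp_bound q \<alpha>"
  shows "exp_bound (\<lambda>n. p n + q n) \<alpha>"
proof -
  have "exp_bound (\<lambda>n. max (p n) (q n)) \<alpha>"
    unfolding exp_bound_def
  proof (intro allI impI)
    fix \<delta> :: real assume "\<delta> > 0"
    from exp_boundD[OF assms(1) this] exp_boundD[OF assms(2) this]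
    show "\<forall>\<^sub>F n in sequentially. max (p n) (q n) \<le> exp ((\<delta> - \<alpha>) / a n)"
      by eventually_elim simp
  qed
  from exp_bound_cmult[OF this, of 2] show ?thesis
    by (rule exp_bound_mono) (auto intro!: always_eventually)
qed

lemma exp_bound_zero: "exp_bound (\<lambda>n. 0) \<alpha>"
  by (simp add: exp_bound_def)

lemma exp_bound_sum:
  assumes "finite I" "\<And>i. i \<in> I \<Longrightarrow> exp_bound (p i) \<alpha>"
  shows "exp_bound (\<lambda>n. \<Sum>i\<in>I. p i n) \<alpha>"
  using assms by (induction I rule: finite_induct) (auto intro: exp_bound_add exp_bound_zero)

lemma exp_bound_mult:
  assumes "exp_bound p \<alpha>" "exp_bound q \<beta>" "\<And>n. p n \<ge> 0" "\<And>n. q n \<ge> 0"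
  shows "exp_bound (\<lambda>n. p n * q n) (\<alpha> + \<beta>)"
  unfolding exp_bound_def
proof (intro allI impI)
  fix \<delta> :: real assume "\<delta> > 0"
  then have "\<delta> / 2 > 0" by simp
  from exp_boundD[OF assms(1) this] exp_boundD[OF assms(2) this]
  show "\<forall>\<^sub>F n in sequentially. p n * q n \<le> exp ((\<delta> - (\<alpha> + \<beta>)) / a n)"
  proof eventually_elim
    case (elim n)
    then have "p n * q n \<le> exp ((\<delta> / 2 - \<alpha>) / a n) * exp ((\<delta> / 2 - \<beta>) / a n)"
      using assms(3,4) by (intro mult_mono) auto
    also have "\<dots> = exp ((\<delta> - (\<alpha> + \<beta>)) / a n)"
      unfolding exp_add[symmetric] add_divide_distrib[symmetric] by (simp add: algebra_simps)
    finally show ?case .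
  qed
qed

text \<open>Estimates may thus lose any positive amount of the rate.\<close>

lemma exp_bound_lift:
  assumes "\<And>\<beta>. \<beta> < \<alpha> \<Longrightarrow> exp_bound p \<beta>"
  shows "exp_bound p \<alpha>"
  unfolding exp_bound_def
proof (intro allI impI)
  fix \<delta> :: real assume "\<delta> > 0"
  then have "exp_bound p (\<alpha> - \<delta> / 2)" "\<delta> / 2 > 0" using assms by auto
  from exp_boundD[OF this] show "\<forall>\<^sub>F n in sequentially. p n \<le> exp ((\<delta> - \<alpha>) / a n)"
    by (simp add: algebra_simps)
qed

lemma exp_bound_antimono:
  assumes "exp_bound p \<alpha>" "\<beta> \<le> \<alpha>"
  shows "exp_bound p \<beta>"
  unfolding exp_bound_def
proof (intro allI impI)
  fix \<delta> :: real assume "\<delta> > 0"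
  from exp_boundD[OF assms(1) this] eventually_a_pos
  show "\<forall>\<^sub>F n in sequentially. p n \<le> exp ((\<delta> - \<beta>) / a n)"
  proof eventually_elim
    case (elim n)
    have "(\<delta> - \<alpha>) / a n \<le> (\<delta> - \<beta>) / a n" using elim assms(2) by (intro divide_right_mono) auto
    with elim show ?case by (meson exp_le_cancel_iff order_trans)
  qed
qed

lemma exp_bound_le_1:
  assumes "\<forall>\<^sub>F n in sequentially. p n \<le> 1" "\<alpha> \<le> 0"
  shows "exp_bound p \<alpha>"
proof (rule exp_bound_antimono[OF _ assms(2)])
  show "exp_bound p 0"
    unfolding exp_bound_def
  proof (intro allI impI)
    fix \<delta> :: real assume "\<delta> > 0"
    from eventually_le_exp[OF this, of 1] assms(1)
    show "\<forall>\<^sub>F n in sequentially. p n \<le> exp ((\<delta> - 0) / a n)"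
      unfolding diff_0_right by eventually_elim linarith
  qed
qed

end

section \<open>Sums of independent random variables\<close>

context prob_space
begin

section \<open>Exponential moments, maximal inequality and tails of independent sums\<close>

lemma bounded_random_variable_integrable:
  fixes Y :: "'a \<Rightarrow> real"
  assumes [measurable]: "Y \<in> borel_measurable M" and "\<And>\<omega>. \<bar>Y \<omega>\<bar> \<le> C"
  shows "integrable M Y"
  using assms(2) by (intro integrable_const_bound[of _ C]) auto

lemma exp_bounded_integrable:
  fixes Y :: "'a \<Rightarrow> real"
  assumes [measurable]: "Y \<in> borel_measurable M" and "\<And>\<omega>. \<bar>Y \<omega>\<bar> \<le> C"
  shows "integrable M (\<lambda>\<omega>. exp (\<theta> * Y \<omega>))"
proof (rule bounded_random_variable_integrable)
  show "\<bar>exp (\<theta> * Y \<omega>)\<bar> \<le> exp (\<bar>\<theta>\<bar> * C)" for \<omega>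
  proof -
    have "\<theta> * Y \<omega> \<le> \<bar>\<theta>\<bar> * \<bar>Y \<omega>\<bar>" by (simp flip: abs_mult)
    also have "\<dots> \<le> \<bar>\<theta>\<bar> * C" using assms(2) by (intro mult_left_mono) auto
    finally show ?thesis by simp
  qed
qed auto

lemma indep_sum_exp_expectation:
  fixes Y :: "'i \<Rightarrow> 'a \<Rightarrow> real"
  assumes I: "finite I" "indep_vars (\<lambda>_. borel) Y I" and bdd: "\<And>i \<omega>. i \<in> I \<Longrightarrow> \<bar>Y i \<omega>\<bar> \<le> C"
  shows "expectation (\<lambda>\<omega>. exp (\<theta> * (\<Sum>i\<in>I. Y i \<omega>))) = exp (\<Sum>i\<in>I. ln (expectation (\<lambda>\<omega>. exp (\<theta> * Y i \<omega>))))"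
proof -
  have rv: "Y i \<in> borel_measurable M" if "i \<in> I" for i using I(2) that by (auto simp: indep_vars_def)
  have int: "integrable M (\<lambda>\<omega>. exp (\<theta> * Y i \<omega>))" if "i \<in> I" for i
    using rv bdd that by (intro exp_bounded_integrable) auto
  have pos: "expectation (\<lambda>\<omega>. exp (\<theta> * Y i \<omega>)) > 0" if "i \<in> I" for i
    using integral_less_AE_space[of "\<lambda>_. 0" "\<lambda>\<omega>. exp (\<theta> * Y i \<omega>)"] int[OF that] emeasure_space_1 by simp
  have "expectation (\<lambda>\<omega>. exp (\<theta> * (\<Sum>i\<in>I. Y i \<omega>))) = expectation (\<lambda>\<omega>. \<Prod>i\<in>I. exp (\<theta> * Y i \<omega>))"
    using I(1) by (simp add: sum_distrib_left exp_sum)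
  also have "\<dots> = (\<Prod>i\<in>I. expectation (\<lambda>\<omega>. exp (\<theta> * Y i \<omega>)))"
    using int by (intro indep_vars_lebesgue_integral I indep_vars_compose2[OF I(2)]) auto
  also have "\<dots> = (\<Prod>i\<in>I. exp (ln (expectation (\<lambda>\<omega>. exp (\<theta> * Y i \<omega>)))))"
    using pos by (intro prod.cong) auto
  also have "\<dots> = exp (\<Sum>i\<in>I. ln (expectation (\<lambda>\<omega>. exp (\<theta> * Y i \<omega>))))"
    using I(1) by (simp add: exp_sum)
  finally show ?thesis .
qed

text \<open>Chernoff's bound for the unnormalised density \<open>exp (\<kappa> * S)\<close>, so that
  no tilted measure has to be built; \<kappa> = 0 is the usual bound.\<close>

lemma exp_tilted_Markov:
  fixes S :: "'a \<Rightarrow> real"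
  assumes [measurable]: "S \<in> borel_measurable M" and bdd: "\<And>\<omega>. \<bar>S \<omega>\<bar> \<le> C" and "\<theta> \<ge> 0"
  shows "expectation (\<lambda>\<omega>. exp (\<kappa> * S \<omega>) * indicator {\<omega>. x \<le> S \<omega>} \<omega>) \<le> exp (- \<theta> * x) * expectation (\<lambda>\<omega>. exp ((\<kappa> + \<theta>) * S \<omega>))"
proof -
  have [simp]: "integrable M (\<lambda>\<omega>. exp (t * S \<omega>))" for t
    using bdd by (intro exp_bounded_integrable) auto
  have "expectation (\<lambda>\<omega>. exp (\<kappa> * S \<omega>) * indicator {\<omega>. x \<le> S \<omega>} \<omega>) \<le> expectation (\<lambda>\<omega>. exp (- \<theta> * x) * exp ((\<kappa> + \<theta>) * S \<omega>))"
  proof (rule integral_mono)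
    show "integrable M (\<lambda>\<omega>. exp (\<kappa> * S \<omega>) * indicator {\<omega>. x \<le> S \<omega>} \<omega>)"
      by (rule Bochner_Integration.integrable_bound[of M "\<lambda>\<omega>. exp (\<kappa> * S \<omega>)"]) (auto simp: indicator_def)
    fix \<omega>
    show "exp (\<kappa> * S \<omega>) * indicator {\<omega>. x \<le> S \<omega>} \<omega> \<le> exp (- \<theta> * x) * exp ((\<kappa> + \<theta>) * S \<omega>)"
    proof (cases "x \<le> S \<omega>")
      case True
      then have "\<theta> * x \<le> \<theta> * S \<omega>" using \<open>\<theta> \<ge> 0\<close> by (rule mult_left_mono)
      then show ?thesis using True unfolding exp_add[symmetric] by (simp add: algebra_simps)
    qed simp
  qed simp
  then show ?thesis by simp
qed

lemma exp_Markov: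
  fixes S :: "'a \<Rightarrow> real"
  assumes [measurable]: "S \<in> borel_measurable M" and bdd: "\<And>\<omega>. \<bar>S \<omega>\<bar> \<le> C" and "\<theta> \<ge> 0"
  shows "prob {\<omega> \<in> space M. x \<le> S \<omega>} \<le> exp (- \<theta> * x) * expectation (\<lambda>\<omega>. exp (\<theta> * S \<omega>))"
proof -
  have "prob {\<omega> \<in> space M. x \<le> S \<omega>} = expectation (indicator {\<omega> \<in> space M. x \<le> S \<omega>})" by simp
  also have "\<dots> = expectation (\<lambda>\<omega>. exp (0 * S \<omega>) * indicator {\<omega>. x \<le> S \<omega>} \<omega>)"
    by (intro Bochner_Integration.integral_cong) (auto simp: indicator_def)
  also have "\<dots> \<le> exp (- \<theta> * x) * expectation (\<lambda>\<omega>. exp ((0 + \<theta>) * S \<omega>))"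
    by (rule exp_tilted_Markov[OF assms])
  finally show ?thesis by simp
qed

text \<open>Etemadi's argument: split according to the first index at which the partial sum exceeds \<open>3 * x\<close>; either
  the total sum exceeds \<open>x\<close> or the independent remainder exceeds \<open>2 * x\<close>.\<close>

lemma Etemadi_inequality:
  fixes Y :: "nat \<Rightarrow> 'a \<Rightarrow> real"
  assumes ind: "indep_vars (\<lambda>_. borel) Y {p<..q}" and "p \<le> q" and "x > 0"
    and c: "\<And>l. l \<in> {p..q} \<Longrightarrow> prob {\<omega> \<in> space M. x \<le> \<bar>\<Sum>j\<in>{l<..q}. Y j \<omega>\<bar>} \<le> c"
  shows "prob {\<omega> \<in> space M. \<exists>l\<in>{p..q}. 3 * x \<le> \<bar>\<Sum>j\<in>{p<..l}. Y j \<omega>\<bar>} \<le> 2 * c"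
proof -
  have rv: "Y j \<in> borel_measurable M" if "j \<in> {p<..q}" for j using ind that by (auto simp: indep_vars_def)
  define S where "S l \<omega> = (\<Sum>j\<in>{p<..l}. Y j \<omega>)" for l \<omega>
  define R where "R l \<omega> = (\<Sum>j\<in>{l<..q}. Y j \<omega>)" for l \<omega>
  have Sm[measurable]: "S l \<in> borel_measurable M" if "l \<le> q" for l
    unfolding S_def using rv that by (intro borel_measurable_sum) auto
  have Rm: "R l \<in> borel_measurable M" if "p \<le> l" for l
    unfolding R_def using rv that by (intro borel_measurable_sum) auto
  have SR: "S q \<omega> = S l \<omega> + R l \<omega>" if "l \<in> {p..q}" for l \<omega>
    unfolding S_def R_def using that by (subst sum.union_disjoint[symmetric]) (auto intro!: sum.cong)
  \<comment> \<open>The level \<open>3 * x\<close> is reached for the first time at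
    \<open>l\<close>, an event that depends on the summands up to \<open>l\<close> only.\<close>
  define A where "A l = {\<omega> \<in> space M. 3 * x \<le> \<bar>S l \<omega>\<bar> \<and> (\<forall>i\<in>{p..<l}. \<bar>S i \<omega>\<bar> < 3 * x)}" for l
  have Am: "A l \<in> events" if "l \<le> q" for l
  proof -
    have "A l = {\<omega> \<in> space M. 3 * x \<le> \<bar>S l \<omega>\<bar>} \<inter> {\<omega> \<in> space M. \<forall>i\<in>{p..<l}. \<bar>S i \<omega>\<bar> < 3 * x}"
      by (auto simp: A_def)
    moreover have "{\<omega> \<in> space M. 3 * x \<le> \<bar>S l \<omega>\<bar>} \<in> events" using Sm[OF that] by measurable
    moreover have "{\<omega> \<in> space M. \<forall>i\<in>{p..<l}. \<bar>S i \<omega>\<bar> < 3 * x} \<in> events"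
    proof (rule sets.sets_Collect_finite_All)
      fix i assume "i \<in> {p..<l}"
      then have "S i \<in> borel_measurable M" using that by (intro Sm) auto
      then show "{\<omega> \<in> space M. \<bar>S i \<omega>\<bar> < 3 * x} \<in> events" by measurable
    qed simp
    ultimately show ?thesis by (simp add: sets.Int)
  qed
  have disj: "disjoint_family_on A {p..q}"
    unfolding disjoint_family_on_def
  proof (intro ballI impI equals0I)
    fix i j \<omega> assume ij: "i \<in> {p..q}" "j \<in> {p..q}" "i \<noteq> j" "\<omega> \<in> A i \<inter> A j"
    then consider "i < j" | "j < i" by linarith
    then show False
    proof cases
      case 1
      then have "\<bar>S i \<omega>\<bar> < 3 * x" using ij by (auto simp: A_def)
      then show False using ij by (auto simp: A_def)
    next
      case 2
      then have "\<bar>S j \<omega>\<bar> < 3 * x" using ij by (auto simp: A_def)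
      then show False using ij by (auto simp: A_def)
    qed
  qed
  have "c \<ge> 0" using c[of p] \<open>p \<le> q\<close> by (auto intro: order_trans[OF measure_nonneg])
  have indAR: "prob (A l \<inter> {\<omega> \<in> space M. x \<le> \<bar>R l \<omega>\<bar>}) = prob (A l) * prob {\<omega> \<in> space M. x \<le> \<bar>R l \<omega>\<bar>}"
    if l: "l \<in> {p..q}" for l
  proof -
    have "indep_var (PiM {p<..l} (\<lambda>_. borel)) (\<lambda>\<omega>. restrict (\<lambda>i. Y i \<omega>) {p<..l})
        (PiM {l<..q} (\<lambda>_. borel)) (\<lambda>\<omega>. restrict (\<lambda>i. Y i \<omega>) {l<..q})"
      using l by (intro indep_var_restrict[OF ind]) auto
    note * = indep_varD[OF this]
    define XA where "XA = {f \<in> space (PiM {p<..l} (\<lambda>_. borel :: real measure)). 3 * x \<le> \<bar>\<Sum>j\<in>{p<..l}. f j\<bar> \<and> (\<forall>i\<in>{p..<l}. \<bar>\<Sum>j\<in>{p<..i}. f j\<bar> < 3 * x)}"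
    define XB where "XB = {f \<in> space (PiM {l<..q} (\<lambda>_. borel :: real measure)). x \<le> \<bar>\<Sum>j\<in>{l<..q}. f j\<bar>}"
    have mS: "(\<lambda>f. \<Sum>j\<in>{p<..i}. f j) \<in> borel_measurable (PiM {p<..l} (\<lambda>_. borel :: real measure))" if "i \<le> l" for i
      using that by (intro borel_measurable_sum measurable_component_singleton) auto
    have "XA = {f \<in> space (PiM {p<..l} (\<lambda>_. borel)). 3 * x \<le> \<bar>\<Sum>j\<in>{p<..l}. f j\<bar>} \<inter>
        {f \<in> space (PiM {p<..l} (\<lambda>_. borel)). \<forall>i\<in>{p..<l}. \<bar>\<Sum>j\<in>{p<..i}. f j\<bar> < 3 * x}"
      by (auto simp: XA_def)
    also have "\<dots> \<in> sets (PiM {p<..l} (\<lambda>_. borel))"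
    proof (rule sets.Int)
      show "{f \<in> space (PiM {p<..l} (\<lambda>_. borel)). 3 * x \<le> \<bar>\<Sum>j\<in>{p<..l}. f j\<bar>} \<in> sets (PiM {p<..l} (\<lambda>_. borel))"
        using mS[OF order_refl] by measurable
      show "{f \<in> space (PiM {p<..l} (\<lambda>_. borel)). \<forall>i\<in>{p..<l}. \<bar>\<Sum>j\<in>{p<..i}. f j\<bar> < 3 * x} \<in> sets (PiM {p<..l} (\<lambda>_. borel))"
      proof (rule sets.sets_Collect_finite_All)
        fix i assume "i \<in> {p..<l}"
        then have "(\<lambda>f. \<Sum>j\<in>{p<..i}. f j) \<in> borel_measurable (PiM {p<..l} (\<lambda>_. borel :: real measure))"
          by (intro mS) simp
        then show "{f \<in> space (PiM {p<..l} (\<lambda>_. borel)). \<bar>\<Sum>j\<in>{p<..i}. f j\<bar> < 3 * x} \<in> sets (PiM {p<..l} (\<lambda>_. borel))"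
          by measurable
      qed simp
    qed
    finally have XA: "XA \<in> sets (PiM {p<..l} (\<lambda>_. borel))" .
    have "(\<lambda>f. \<Sum>j\<in>{l<..q}. f j) \<in> borel_measurable (PiM {l<..q} (\<lambda>_. borel :: real measure))"
      by (intro borel_measurable_sum measurable_component_singleton)
    then have XB: "XB \<in> sets (PiM {l<..q} (\<lambda>_. borel))" unfolding XB_def by measurable
    have eA: "(\<lambda>\<omega>. restrict (\<lambda>i. Y i \<omega>) {p<..l}) -` XA \<inter> space M = A l"
    proof -
      have "(\<Sum>j\<in>{p<..i}. restrict (\<lambda>i. Y i \<omega>) {p<..l} j) = S i \<omega>" if "i \<le> l" for i \<omega>
        unfolding S_def using that by (intro sum.cong) auto
      then show ?thesis by (auto simp: XA_def A_def space_PiM)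
    qed
    have eB: "(\<lambda>\<omega>. restrict (\<lambda>i. Y i \<omega>) {l<..q}) -` XB \<inter> space M = {\<omega> \<in> space M. x \<le> \<bar>R l \<omega>\<bar>}"
      by (auto simp: XB_def R_def space_PiM)
    have "(\<lambda>w. (restrict (\<lambda>i. Y i w) {p<..l}, restrict (\<lambda>i. Y i w) {l<..q})) -` (XA \<times> XB) \<inter> space M =
        ((\<lambda>\<omega>. restrict (\<lambda>i. Y i \<omega>) {p<..l}) -` XA \<inter> space M) \<inter> ((\<lambda>\<omega>. restrict (\<lambda>i. Y i \<omega>) {l<..q}) -` XB \<inter> space M)"
      by auto
    then show ?thesis using *[OF XA XB] by (simp only: eA eB)
  qed
  have "{\<omega> \<in> space M. \<exists>l\<in>{p..q}. 3 * x \<le> \<bar>S l \<omega>\<bar>} \<subseteq>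
      {\<omega> \<in> space M. x \<le> \<bar>R p \<omega>\<bar>} \<union> (\<Union>l\<in>{p..q}. A l \<inter> {\<omega> \<in> space M. x \<le> \<bar>R l \<omega>\<bar>})"
  proof
    fix \<omega> assume "\<omega> \<in> {\<omega> \<in> space M. \<exists>l\<in>{p..q}. 3 * x \<le> \<bar>S l \<omega>\<bar>}"
    then have \<omega>: "\<omega> \<in> space M" and ex: "\<exists>l. l \<in> {p..q} \<and> 3 * x \<le> \<bar>S l \<omega>\<bar>" by auto
    define l where "l = (LEAST l. l \<in> {p..q} \<and> 3 * x \<le> \<bar>S l \<omega>\<bar>)"
    have l: "l \<in> {p..q}" "3 * x \<le> \<bar>S l \<omega>\<bar>" using LeastI_ex[OF ex] by (auto simp: l_def)
    have "\<bar>S i \<omega>\<bar> < 3 * x" if "i \<in> {p..<l}" for i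
    proof -
      have "i < l" "i \<in> {p..q}" using that l(1) by auto
      then have "\<not> 3 * x \<le> \<bar>S i \<omega>\<bar>"
        using not_less_Least[of i "\<lambda>l. l \<in> {p..q} \<and> 3 * x \<le> \<bar>S l \<omega>\<bar>"] unfolding l_def by blast
      then show ?thesis by simp
    qed
    then have "\<omega> \<in> A l" using l \<omega> by (auto simp: A_def)
    \<comment> \<open>\<open>R p\<close> is the total sum. If both it and the remainder after
      \<open>l\<close> were below \<open>x\<close> in absolute value, then
      \<open>\<bar>S l \<omega>\<bar>\<close> would be below \<open>2 * x\<close>.\<close>
    moreover have "x \<le> \<bar>R p \<omega>\<bar> \<or> x \<le> \<bar>R l \<omega>\<bar>"
      using SR[of l \<omega>] SR[of p \<omega>] l \<open>p \<le> q\<close> \<open>x > 0\<close> by (auto simp: S_def)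
    ultimately show "\<omega> \<in> {\<omega> \<in> space M. x \<le> \<bar>R p \<omega>\<bar>} \<union> (\<Union>l\<in>{p..q}. A l \<inter> {\<omega> \<in> space M. x \<le> \<bar>R l \<omega>\<bar>})"
      using \<omega> l by blast
  qed
  moreover have Rset: "{\<omega> \<in> space M. x \<le> \<bar>R l \<omega>\<bar>} \<in> events" if "p \<le> l" for l
    using Rm[OF that] by measurable
  ultimately have "prob {\<omega> \<in> space M. \<exists>l\<in>{p..q}. 3 * x \<le> \<bar>S l \<omega>\<bar>} \<le>
      prob ({\<omega> \<in> space M. x \<le> \<bar>R p \<omega>\<bar>} \<union> (\<Union>l\<in>{p..q}. A l \<inter> {\<omega> \<in> space M. x \<le> \<bar>R l \<omega>\<bar>}))"
    using Am by (intro finite_measure_mono) auto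
  also have "\<dots> \<le> prob {\<omega> \<in> space M. x \<le> \<bar>R p \<omega>\<bar>} + prob (\<Union>l\<in>{p..q}. A l \<inter> {\<omega> \<in> space M. x \<le> \<bar>R l \<omega>\<bar>})"
    using Am Rset by (intro measure_Un_le) auto
  also have "\<dots> \<le> c + (\<Sum>l\<in>{p..q}. prob (A l \<inter> {\<omega> \<in> space M. x \<le> \<bar>R l \<omega>\<bar>}))"
    using Am Rset c[of p] \<open>p \<le> q\<close> by (intro add_mono measure_UNION_le) (auto simp: R_def)
  also have "\<dots> \<le> c + (\<Sum>l\<in>{p..q}. prob (A l) * c)"
  proof (intro add_left_mono sum_mono)
    fix l assume l: "l \<in> {p..q}"
    show "prob (A l \<inter> {\<omega> \<in> space M. x \<le> \<bar>R l \<omega>\<bar>}) \<le> prob (A l) * c"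
      unfolding indAR[OF l] using c[OF l] by (intro mult_left_mono) (auto simp: R_def)
  qed
  \<comment> \<open>The first-passage events are disjoint, so their probabilities sum to at most 1,
    whatever the number of indices.\<close>
  also have "\<dots> = c + prob (\<Union>l\<in>{p..q}. A l) * c"
    using Am disj by (subst finite_measure_finite_Union) (auto simp: sum_distrib_right)
  also have "\<dots> \<le> c + 1 * c"
    using \<open>c \<ge> 0\<close> by (intro add_left_mono mult_right_mono) auto
  finally show ?thesis by (simp add: S_def)
qed

text \<open>Rounding \<open>U\<close> down to a multiple \<open>i * h\<close> leaves at least
  \<open>(K - 1 - i) * h\<close> for \<open>W\<close>; one step \<open>h\<close> is lost to the
  rounding. The last term covers the case that \<open>U\<close> alone reaches the level.\<close>

lemma indep_sum_tail_le:
  fixes U W :: "'a \<Rightarrow> real"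
  assumes ind: "indep_var borel U borel W" and "\<And>\<omega>. U \<omega> \<ge> 0" and "h > 0"
  shows "prob {\<omega> \<in> space M. real K * h \<le> U \<omega> + W \<omega>} \<le>
      (\<Sum>i<K. prob {\<omega> \<in> space M. real i * h \<le> U \<omega>} * prob {\<omega> \<in> space M. real (K - 1 - i) * h \<le> W \<omega>}) +
      prob {\<omega> \<in> space M. real K * h \<le> U \<omega>}"
proof -
  have [measurable]: "U \<in> borel_measurable M" "W \<in> borel_measurable M"
    using indep_var_rv1[OF ind] indep_var_rv2[OF ind] by auto
  let ?B = "\<lambda>i. {\<omega> \<in> space M. real i * h \<le> U \<omega>} \<inter> {\<omega> \<in> space M. real (K - 1 - i) * h \<le> W \<omega>}"
  have "{\<omega> \<in> space M. real K * h \<le> U \<omega> + W \<omega>} \<subseteq> (\<Union>i<K. ?B i) \<union> {\<omega> \<in> space M. real K * h \<le> U \<omega>}"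
  proof
    fix \<omega> assume "\<omega> \<in> {\<omega> \<in> space M. real K * h \<le> U \<omega> + W \<omega>}"
    then have \<omega>: "\<omega> \<in> space M" "real K * h \<le> U \<omega> + W \<omega>" by auto
    show "\<omega> \<in> (\<Union>i<K. ?B i) \<union> {\<omega> \<in> space M. real K * h \<le> U \<omega>}"
    proof (cases "real K * h \<le> U \<omega>")
      case False
      define i where "i = nat \<lfloor>U \<omega> / h\<rfloor>"
      have fl: "real i = of_int \<lfloor>U \<omega> / h\<rfloor>" using assms by (simp add: i_def)
      have "real i \<le> U \<omega> / h" "U \<omega> / h < real i + 1" unfolding fl by linarith+
      then have i: "real i * h \<le> U \<omega>" "U \<omega> < (real i + 1) * h" using \<open>h > 0\<close> by (simp_all add: field_simps)
      then have "real i * h < real K * h" using False by linarith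
      then have "i < K" using \<open>h > 0\<close> by simp
      then have "real (K - 1 - i) * h = real K * h - (real i + 1) * h" by (simp add: of_nat_diff algebra_simps)
      then have "real (K - 1 - i) * h \<le> W \<omega>" using i \<omega> by linarith
      then show ?thesis using i \<omega> \<open>i < K\<close> by auto
    qed (use \<omega> in auto)
  qed
  then have "prob {\<omega> \<in> space M. real K * h \<le> U \<omega> + W \<omega>} \<le> prob ((\<Union>i<K. ?B i) \<union> {\<omega> \<in> space M. real K * h \<le> U \<omega>})"
    by (intro finite_measure_mono) auto
  also have "\<dots> \<le> prob (\<Union>i<K. ?B i) + prob {\<omega> \<in> space M. real K * h \<le> U \<omega>}"
    by (intro measure_Un_le) auto
  also have "\<dots> \<le> (\<Sum>i<K. prob (?B i)) + prob {\<omega> \<in> space M. real K * h \<le> U \<omega>}"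
    by (intro add_right_mono measure_UNION_le) auto
  also have "(\<Sum>i<K. prob (?B i)) =
      (\<Sum>i<K. prob {\<omega> \<in> space M. real i * h \<le> U \<omega>} * prob {\<omega> \<in> space M. real (K - 1 - i) * h \<le> W \<omega>})"
  proof (rule sum.cong)
    fix i
    have "?B i = (\<lambda>x. (U x, W x)) -` ({real i * h..} \<times> {real (K - 1 - i) * h..}) \<inter> space M" by auto
    moreover have "{\<omega> \<in> space M. y \<le> V \<omega>} = V -` {y..} \<inter> space M" for y :: real and V by auto
    ultimately show "prob (?B i) = prob {\<omega> \<in> space M. real i * h \<le> U \<omega>} * prob {\<omega> \<in> space M. real (K - 1 - i) * h \<le> W \<omega>}"
      using indep_varD[OF ind, of "{real i * h..}" "{real (K - 1 - i) * h..}"] by simp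
  qed simp
  finally show ?thesis .
qed

end

section \<open>Moderate deviations of block sums\<close>

text \<open>\<open>mgf\<close> says that sums over any set of indices in a row look Gaussian with
  variance given by the weights, uniformly over these sets. \<open>C n\<close> may grow with
  \<open>n\<close>: it secures integrability, not rates.\<close>

locale exp_array = speed a for a :: "nat \<Rightarrow> real" +
  fixes M :: "nat \<Rightarrow> 'a measure" and Y :: "nat \<Rightarrow> nat \<Rightarrow> 'a \<Rightarrow> real" and k :: "nat \<Rightarrow> nat"
    and w :: "nat \<Rightarrow> nat \<Rightarrow> real" and C :: "nat \<Rightarrow> real"
  assumes prob: "\<And>n. n \<ge> 1 \<Longrightarrow> prob_space (M n)"
    and indep: "\<And>n. n \<ge> 1 \<Longrightarrow> prob_space.indep_vars (M n) (\<lambda>_. borel) (Y n) {1..k n}"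
    and bdd: "\<And>n j \<omega>. n \<ge> 1 \<Longrightarrow> j \<in> {1..k n} \<Longrightarrow> \<bar>Y n j \<omega>\<bar> \<le> C n"
    and w_nonneg: "\<And>n j. w n j \<ge> 0"
    and mgf: "\<And>\<theta> \<delta>. \<delta> > 0 \<Longrightarrow> \<forall>\<^sub>F n in sequentially. \<forall>B\<subseteq>{1..k n}.
      \<bar>a n * (\<Sum>j\<in>B. ln (prob_space.expectation (M n) (\<lambda>\<omega>. exp (\<theta> * Y n j \<omega>)))) - \<theta>\<^sup>2 / 2 * (\<Sum>j\<in>B. w n j)\<bar> \<le> \<delta>"
begin

definition S :: "nat \<Rightarrow> nat set \<Rightarrow> 'a \<Rightarrow> real" where
  "S n B \<omega> = (\<Sum>j\<in>B. Y n j \<omega>)"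

lemma Y_measurable:
  assumes "n \<ge> 1" "j \<in> {1..k n}"
  shows "Y n j \<in> borel_measurable (M n)"
proof -
  interpret prob_space "M n" using assms(1) by (rule prob)
  show ?thesis using indep[OF assms(1)] assms(2) by (simp add: indep_vars_def)
qed

lemma S_measurable: "n \<ge> 1 \<Longrightarrow> B \<subseteq> {1..k n} \<Longrightarrow> S n B \<in> borel_measurable (M n)"
  unfolding S_def using Y_measurable by (intro borel_measurable_sum) auto

lemma S_bounded: "n \<ge> 1 \<Longrightarrow> B \<subseteq> {1..k n} \<Longrightarrow> \<bar>S n B \<omega>\<bar> \<le> (\<Sum>j\<in>B. C n)"
  unfolding S_def using bdd by (intro order_trans[OF sum_abs sum_mono]) auto

lemma S_mgf:
  assumes "n \<ge> 1" "B \<subseteq> {1..k n}"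
  shows "prob_space.expectation (M n) (\<lambda>\<omega>. exp (\<theta> * S n B \<omega>)) =
    exp (\<Sum>j\<in>B. ln (prob_space.expectation (M n) (\<lambda>\<omega>. exp (\<theta> * Y n j \<omega>))))"
proof -
  interpret prob_space "M n" using assms(1) by (rule prob)
  show ?thesis
    unfolding S_def
    using indep[OF assms(1)] assms bdd finite_subset[OF assms(2)]
    by (intro indep_sum_exp_expectation[where C = "C n"] indep_vars_subset[of _ _ "{1..k n}" B]) auto
qed

lemma S_mgf_bounds:
  assumes "\<delta> > 0"
  shows "\<forall>\<^sub>F n in sequentially. n \<ge> 1 \<and> a n > 0 \<and> (\<forall>B\<subseteq>{1..k n}.
    prob_space.expectation (M n) (\<lambda>\<omega>. exp (\<theta> * S n B \<omega>)) \<le> exp ((\<theta>\<^sup>2 / 2 * (\<Sum>j\<in>B. w n j) + \<delta>) / a n) \<and>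
    exp ((\<theta>\<^sup>2 / 2 * (\<Sum>j\<in>B. w n j) - \<delta>) / a n) \<le> prob_space.expectation (M n) (\<lambda>\<omega>. exp (\<theta> * S n B \<omega>)))"
  using mgf[OF assms, of \<theta>] eventually_a_pos
proof eventually_elim
  case (elim n)
  then have "n \<ge> 1" "a n > 0" by auto
  show ?case
  proof (intro conjI allI impI)
    fix B assume B: "B \<subseteq> {1..k n}"
    define L where "L = (\<Sum>j\<in>B. ln (prob_space.expectation (M n) (\<lambda>\<omega>. exp (\<theta> * Y n j \<omega>))))"
    have "\<bar>a n * L - \<theta>\<^sup>2 / 2 * (\<Sum>j\<in>B. w n j)\<bar> \<le> \<delta>" using elim(1) B by (simp add: L_def)
    then have "L \<le> (\<theta>\<^sup>2 / 2 * (\<Sum>j\<in>B. w n j) + \<delta>) / a n" "(\<theta>\<^sup>2 / 2 * (\<Sum>j\<in>B. w n j) - \<delta>) / a n \<le> L"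
      using \<open>a n > 0\<close> by (simp_all add: pos_le_divide_eq pos_divide_le_eq abs_le_iff mult.commute[of L])
    then show "prob_space.expectation (M n) (\<lambda>\<omega>. exp (\<theta> * S n B \<omega>)) \<le> exp ((\<theta>\<^sup>2 / 2 * (\<Sum>j\<in>B. w n j) + \<delta>) / a n)"
      "exp ((\<theta>\<^sup>2 / 2 * (\<Sum>j\<in>B. w n j) - \<delta>) / a n) \<le> prob_space.expectation (M n) (\<lambda>\<omega>. exp (\<theta> * S n B \<omega>))"
      using S_mgf[OF \<open>n \<ge> 1\<close> B, of \<theta>] by (simp_all add: L_def[symmetric])
  qed fact+
qed

text \<open>Chernoff's bound for both signs. \<theta> stays free because two different choices are
  made later: the optimal one for block energies, and one that is large compared with the desired
  rate for oscillations.\<close>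

lemma tail_bound:
  assumes "\<theta> \<ge> 0" "\<delta> > 0"
  shows "\<forall>\<^sub>F n in sequentially. \<forall>B\<subseteq>{1..k n}. (\<Sum>j\<in>B. w n j) \<le> v \<longrightarrow>
    measure (M n) {\<omega> \<in> space (M n). x \<le> \<bar>a n * S n B \<omega>\<bar>} \<le> 2 * exp ((\<delta> - (\<theta> * x - \<theta>\<^sup>2 * v / 2)) / a n)"
  using S_mgf_bounds[OF assms(2), of \<theta>] S_mgf_bounds[OF assms(2), of "- \<theta>"]
proof eventually_elim
  case (elim n)
  then have "n \<ge> 1" "a n > 0" by auto
  interpret prob_space "M n" using \<open>n \<ge> 1\<close> by (rule prob)
  show ?case
  proof (intro allI impI)
    fix B assume B: "B \<subseteq> {1..k n}" and v: "(\<Sum>j\<in>B. w n j) \<le> v"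
    have [measurable]: "S n B \<in> borel_measurable (M n)" using \<open>n \<ge> 1\<close> B by (rule S_measurable)
    have "(\<theta>\<^sup>2 / 2 * (\<Sum>j\<in>B. w n j) + \<delta>) / a n \<le> (\<theta>\<^sup>2 / 2 * v + \<delta>) / a n"
      using v \<open>a n > 0\<close> by (intro divide_right_mono add_right_mono mult_left_mono) auto
    then have E: "expectation (\<lambda>\<omega>. exp (\<theta> * S n B \<omega>)) \<le> exp ((\<theta>\<^sup>2 / 2 * v + \<delta>) / a n)"
      "expectation (\<lambda>\<omega>. exp (- \<theta> * S n B \<omega>)) \<le> exp ((\<theta>\<^sup>2 / 2 * v + \<delta>) / a n)"
      using elim B by (auto intro: order_trans)
    have comb: "exp (- \<theta> * (x / a n)) * exp ((\<theta>\<^sup>2 / 2 * v + \<delta>) / a n) = exp ((\<delta> - (\<theta> * x - \<theta>\<^sup>2 * v / 2)) / a n)"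
      unfolding exp_add[symmetric] using \<open>a n > 0\<close> by (simp add: field_simps)
    have "prob {\<omega> \<in> space (M n). x / a n \<le> S n B \<omega>} \<le> exp (- \<theta> * (x / a n)) * expectation (\<lambda>\<omega>. exp (\<theta> * S n B \<omega>))"
      using S_bounded[OF \<open>n \<ge> 1\<close> B] assms(1) by (intro exp_Markov) auto
    also have "\<dots> \<le> exp (- \<theta> * (x / a n)) * exp ((\<theta>\<^sup>2 / 2 * v + \<delta>) / a n)"
      using E by (intro mult_left_mono) auto
    finally have 1: "prob {\<omega> \<in> space (M n). x / a n \<le> S n B \<omega>} \<le> exp ((\<delta> - (\<theta> * x - \<theta>\<^sup>2 * v / 2)) / a n)"
      by (simp only: comb)
    have "prob {\<omega> \<in> space (M n). x / a n \<le> - S n B \<omega>} \<le> exp (- \<theta> * (x / a n)) * expectation (\<lambda>\<omega>. exp (\<theta> * (- S n B \<omega>)))"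
      using S_bounded[OF \<open>n \<ge> 1\<close> B] assms(1) by (intro exp_Markov) auto
    also have "\<dots> \<le> exp (- \<theta> * (x / a n)) * exp ((\<theta>\<^sup>2 / 2 * v + \<delta>) / a n)"
      using E by (intro mult_left_mono) auto
    finally have 2: "prob {\<omega> \<in> space (M n). x / a n \<le> - S n B \<omega>} \<le> exp ((\<delta> - (\<theta> * x - \<theta>\<^sup>2 * v / 2)) / a n)"
      by (simp only: comb)
    have "{\<omega> \<in> space (M n). x \<le> \<bar>a n * S n B \<omega>\<bar>} \<subseteq>
        {\<omega> \<in> space (M n). x / a n \<le> S n B \<omega>} \<union> {\<omega> \<in> space (M n). x / a n \<le> - S n B \<omega>}"
      using \<open>a n > 0\<close> by (auto simp: pos_divide_le_eq abs_if mult.commute[of _ "a n"] split: if_splits)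
    then have "prob {\<omega> \<in> space (M n). x \<le> \<bar>a n * S n B \<omega>\<bar>} \<le>
        prob ({\<omega> \<in> space (M n). x / a n \<le> S n B \<omega>} \<union> {\<omega> \<in> space (M n). x / a n \<le> - S n B \<omega>})"
      by (intro finite_measure_mono) auto
    also have "\<dots> \<le> prob {\<omega> \<in> space (M n). x / a n \<le> S n B \<omega>} + prob {\<omega> \<in> space (M n). x / a n \<le> - S n B \<omega>}"
      by (intro measure_Un_le) auto
    finally show "prob {\<omega> \<in> space (M n). x \<le> \<bar>a n * S n B \<omega>\<bar>} \<le> 2 * exp ((\<delta> - (\<theta> * x - \<theta>\<^sup>2 * v / 2)) / a n)"
      using 1 2 by linarith
  qed
qed

text \<open>Under the weight \<open>exp (\<theta> * S)\<close> with \<open>\<theta> = r / v\<close> the block sum concentrates at \<open>r\<close>: the two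
  complementary tails are negligible by Chernoff bounds with \<open>\<theta> \<plusminus> \<eta> / v\<close> in place of \<open>\<theta>\<close>.\<close>

lemma concentration_lower_bound:
  assumes B: "\<forall>\<^sub>F n in sequentially. B n \<subseteq> {1..k n}" and v: "(\<lambda>n. \<Sum>j\<in>B n. w n j) \<longlonglongrightarrow> v" "v > 0"
    and "\<eta> > 0" "\<delta> > 0"
  shows "\<forall>\<^sub>F n in sequentially. exp (- (r\<^sup>2 / (2 * v) + \<delta>) / a n) \<le>
    measure (M n) {\<omega> \<in> space (M n). \<bar>a n * S n (B n) \<omega> - r\<bar> < \<eta>}"
proof -
  define \<theta> where "\<theta> = r / v"
  \<comment> \<open>The window is shrunk so that on it the weight exceeds
    \<open>exp (\<theta> * r / a n)\<close> by a factor of at most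
    \<open>exp (\<delta> / 4 / a n)\<close>.\<close>
  define h where "h = min \<eta> (\<delta> / (4 * (\<bar>\<theta>\<bar> + 1)))"
  have "h > 0" "h \<le> \<eta>" using \<open>\<eta> > 0\<close> \<open>\<delta> > 0\<close> by (auto simp: h_def)
  have h\<theta>: "\<bar>\<theta>\<bar> * h \<le> \<delta> / 4"
  proof -
    have "h * (\<bar>\<theta>\<bar> + 1) \<le> \<delta> / (4 * (\<bar>\<theta>\<bar> + 1)) * (\<bar>\<theta>\<bar> + 1)"
      unfolding h_def by (intro mult_right_mono) auto
    also have "\<dots> = \<delta> / 4" by (simp add: field_simps)
    finally have "h * \<bar>\<theta>\<bar> + h \<le> \<delta> / 4" by (simp add: distrib_left)
    then show ?thesis using \<open>h > 0\<close> by (simp add: mult.commute)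
  qed
  \<comment> \<open>\<open>t = h / v\<close> maximises \<open>t * h - t\<^sup>2 * v / 2\<close>, and
    \<open>g\<close> is the maximum: the gain that makes both tails negligible.\<close>
  define t where "t = h / v"
  have "t > 0" using \<open>h > 0\<close> v by (simp add: t_def)
  define g where "g = h\<^sup>2 / (2 * v)"
  have "g > 0" using \<open>h > 0\<close> v by (simp add: g_def)
  define \<epsilon> where "\<epsilon> = min (g / 8) (\<delta> / 8)"
  have "\<epsilon> > 0" using \<open>g > 0\<close> \<open>\<delta> > 0\<close> by (simp add: \<epsilon>_def)
  have vb: "\<forall>\<^sub>F n in sequentially. \<bar>c * (\<Sum>j\<in>B n. w n j) - c * v\<bar> < \<epsilon>" for c
    using tendstoD[OF tendsto_mult_left[OF v(1), of c] \<open>\<epsilon> > 0\<close>] by (simp add: dist_real_def)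
  have "\<delta> / 4 > 0" "g / 4 > 0" using \<open>\<delta> > 0\<close> \<open>g > 0\<close> by auto
  show ?thesis
    using B S_mgf_bounds[OF \<open>\<epsilon> > 0\<close>, of \<theta>] S_mgf_bounds[OF \<open>\<epsilon> > 0\<close>, of "\<theta> + t"] S_mgf_bounds[OF \<open>\<epsilon> > 0\<close>, of "\<theta> - t"]
      vb[of "\<theta>\<^sup>2 / 2"] vb[of "(\<theta> + t)\<^sup>2 / 2"] vb[of "(\<theta> - t)\<^sup>2 / 2"]
      eventually_le_exp[OF \<open>\<delta> / 4 > 0\<close>, of 2] eventually_le_exp[OF \<open>g / 4 > 0\<close>, of 4]
  proof eventually_elim
    case (elim n)
    then have "n \<ge> 1" "a n > 0" by auto
    interpret prob_space "M n" using \<open>n \<ge> 1\<close> by (rule prob)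
    define X where "X = S n (B n)"
    have [measurable]: "X \<in> borel_measurable (M n)" unfolding X_def using \<open>n \<ge> 1\<close> elim(1) by (rule S_measurable)
    have Xb: "\<bar>X \<omega>\<bar> \<le> (\<Sum>j\<in>B n. C n)" for \<omega> unfolding X_def using \<open>n \<ge> 1\<close> elim(1) by (rule S_bounded)
    have int: "integrable (M n) (\<lambda>\<omega>. exp (u * X \<omega>))" for u
      using Xb by (intro exp_bounded_integrable) auto
    have up: "expectation (\<lambda>\<omega>. exp (u * X \<omega>)) \<le> exp ((u\<^sup>2 / 2 * v + 2 * \<epsilon>) / a n)"
      if "u = \<theta> + t \<or> u = \<theta> - t" for u
    proof -
      have "expectation (\<lambda>\<omega>. exp (u * X \<omega>)) \<le> exp ((u\<^sup>2 / 2 * (\<Sum>j\<in>B n. w n j) + \<epsilon>) / a n)"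
        using elim that unfolding X_def by blast
      moreover have "u\<^sup>2 / 2 * (\<Sum>j\<in>B n. w n j) \<le> u\<^sup>2 / 2 * v + \<epsilon>"
        using elim(6,7) that by (elim disjE) (simp_all only: abs_less_iff, linarith+)
      then have "(u\<^sup>2 / 2 * (\<Sum>j\<in>B n. w n j) + \<epsilon>) / a n \<le> (u\<^sup>2 / 2 * v + 2 * \<epsilon>) / a n"
        using \<open>a n > 0\<close> by (intro divide_right_mono) auto
      ultimately show ?thesis by (meson exp_le_cancel_iff order_trans)
    qed
    define E where "E = expectation (\<lambda>\<omega>. exp (\<theta> * X \<omega>))"
    have lo: "exp ((\<theta>\<^sup>2 / 2 * v - 2 * \<epsilon>) / a n) \<le> E"
    proof -
      have "exp ((\<theta>\<^sup>2 / 2 * (\<Sum>j\<in>B n. w n j) - \<epsilon>) / a n) \<le> E"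
        using elim unfolding X_def E_def by blast
      moreover have "(\<theta>\<^sup>2 / 2 * v - 2 * \<epsilon>) / a n \<le> (\<theta>\<^sup>2 / 2 * (\<Sum>j\<in>B n. w n j) - \<epsilon>) / a n"
        using \<open>a n > 0\<close> elim(5) unfolding abs_less_iff by (intro divide_right_mono) auto
      ultimately show ?thesis by (meson exp_le_cancel_iff order_trans)
    qed
    have tail: "x \<le> E / 4" if x: "x \<le> exp ((\<theta>\<^sup>2 / 2 * v + 2 * \<epsilon> - g) / a n)" for x
    proof -
      have "\<theta>\<^sup>2 / 2 * v + 2 * \<epsilon> - g \<le> - (g / 4) + (\<theta>\<^sup>2 / 2 * v - 2 * \<epsilon>)"
        using \<open>g > 0\<close> unfolding \<epsilon>_def by linarith
      then have "(\<theta>\<^sup>2 / 2 * v + 2 * \<epsilon> - g) / a n \<le> - (g / 4 / a n) + (\<theta>\<^sup>2 / 2 * v - 2 * \<epsilon>) / a n"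
        using \<open>a n > 0\<close> by (simp add: field_simps)
      then have "x \<le> exp (- (g / 4 / a n)) * exp ((\<theta>\<^sup>2 / 2 * v - 2 * \<epsilon>) / a n)"
        using x unfolding exp_add[symmetric] by (meson exp_le_cancel_iff order_trans)
      also have "\<dots> \<le> (1 / 4) * E"
        using elim(9) lo by (intro mult_mono) (auto simp: exp_minus field_simps)
      finally show ?thesis by simp
    qed
    \<comment> \<open>Completing the square, with \<open>\<theta> * v = r\<close>.\<close>
    have u_eq: "- t * ((r + h) / a n) + ((\<theta> + t)\<^sup>2 / 2 * v + 2 * \<epsilon>) / a n = (\<theta>\<^sup>2 / 2 * v + 2 * \<epsilon> - g) / a n"
      "- t * ((- r + h) / a n) + ((\<theta> - t)\<^sup>2 / 2 * v + 2 * \<epsilon>) / a n = (\<theta>\<^sup>2 / 2 * v + 2 * \<epsilon> - g) / a n"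
      using \<open>a n > 0\<close> v(2) by (simp_all add: \<theta>_def t_def g_def field_simps power2_eq_square)
    define J1 where "J1 \<omega> = exp (\<theta> * X \<omega>) * indicator {\<omega>. (r + h) / a n \<le> X \<omega>} \<omega>" for \<omega>
    \<comment> \<open>The left tail is the right tail of \<open>- X\<close> under the tilt
      \<open>- \<theta>\<close>.\<close>
    define J2 where "J2 \<omega> = exp (- \<theta> * (- X \<omega>)) * indicator {\<omega>. (- r + h) / a n \<le> - X \<omega>} \<omega>" for \<omega>
    define I1 where "I1 = expectation J1"
    define I2 where "I2 = expectation J2"
    have "I1 \<le> E / 4"
    proof (rule tail)
      have "I1 \<le> exp (- t * ((r + h) / a n)) * expectation (\<lambda>\<omega>. exp ((\<theta> + t) * X \<omega>))"
        unfolding I1_def J1_def using Xb \<open>t > 0\<close> by (intro exp_tilted_Markov) auto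
      also have "\<dots> \<le> exp (- t * ((r + h) / a n)) * exp (((\<theta> + t)\<^sup>2 / 2 * v + 2 * \<epsilon>) / a n)"
        using up by (intro mult_left_mono) auto
      finally show "I1 \<le> exp ((\<theta>\<^sup>2 / 2 * v + 2 * \<epsilon> - g) / a n)"
        by (simp only: exp_add[symmetric] u_eq)
    qed
    have "I2 \<le> E / 4"
    proof (rule tail)
      have "I2 \<le> exp (- t * ((- r + h) / a n)) * expectation (\<lambda>\<omega>. exp ((- \<theta> + t) * (- X \<omega>)))"
        unfolding I2_def J2_def using Xb \<open>t > 0\<close> by (intro exp_tilted_Markov) auto
      also have "(\<lambda>\<omega>. exp ((- \<theta> + t) * (- X \<omega>))) = (\<lambda>\<omega>. exp ((\<theta> - t) * X \<omega>))"
        by (simp add: algebra_simps)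
      also have "exp (- t * ((- r + h) / a n)) * expectation (\<lambda>\<omega>. exp ((\<theta> - t) * X \<omega>)) \<le>
          exp (- t * ((- r + h) / a n)) * exp (((\<theta> - t)\<^sup>2 / 2 * v + 2 * \<epsilon>) / a n)"
        using up by (intro mult_left_mono) auto
      finally show "I2 \<le> exp ((\<theta>\<^sup>2 / 2 * v + 2 * \<epsilon> - g) / a n)"
        by (simp only: exp_add[symmetric] u_eq)
    qed
    define c where "c = exp ((\<theta> * r + \<bar>\<theta>\<bar> * h) / a n)"
    define G where "G = {\<omega> \<in> space (M n). \<bar>a n * X \<omega> - r\<bar> < h}"
    have [measurable]: "G \<in> sets (M n)" unfolding G_def by measurable
    have intI: "integrable (M n) J1"
      "integrable (M n) J2"
      unfolding J1_def J2_def by (rule Bochner_Integration.integrable_bound[OF int[of \<theta>]], auto simp: indicator_def)+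
    have intG: "integrable (M n) (\<lambda>\<omega>. c * indicator G \<omega>)"
      by (rule bounded_random_variable_integrable[of _ "\<bar>c\<bar>"]) (auto simp: indicator_def)
    have "E \<le> expectation (\<lambda>\<omega>. c * indicator G \<omega> + J1 \<omega> +
        J2 \<omega>)"
      unfolding E_def
    proof (rule integral_mono)
      fix \<omega> assume \<omega>: "\<omega> \<in> space (M n)"
      consider "\<omega> \<in> G" | "(r + h) / a n \<le> X \<omega>" | "(- r + h) / a n \<le> - X \<omega>"
        using \<omega> \<open>a n > 0\<close> by (force simp: G_def field_simps abs_if split: if_splits)
      then show "exp (\<theta> * X \<omega>) \<le> c * indicator G \<omega> + J1 \<omega> +
          J2 \<omega>"
      proof cases
        case 1
        have "\<theta> * (a n * X \<omega> - r) \<le> \<bar>\<theta>\<bar> * \<bar>a n * X \<omega> - r\<bar>" by (simp flip: abs_mult)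
        also have "\<dots> \<le> \<bar>\<theta>\<bar> * h" using 1 by (intro mult_left_mono) (auto simp: G_def)
        finally have "\<theta> * X \<omega> \<le> (\<theta> * r + \<bar>\<theta>\<bar> * h) / a n"
          using \<open>a n > 0\<close> by (simp add: field_simps)
        then have "exp (\<theta> * X \<omega>) \<le> c" by (simp add: c_def)
        then show ?thesis using 1 by (simp add: add_increasing2 J1_def J2_def)
      qed (simp_all add: c_def add_increasing J1_def J2_def)
    qed (use int intI intG in \<open>auto intro!: Bochner_Integration.integrable_add\<close>)
    also have "\<dots> = c * prob G + I1 + I2"
      unfolding I1_def I2_def
      by (simp add: Bochner_Integration.integral_add[OF Bochner_Integration.integrable_add[OF intG intI(1)] intI(2)]
          Bochner_Integration.integral_add[OF intG intI(1)])
    finally have "E / 2 \<le> c * prob G" using \<open>I1 \<le> E / 4\<close> \<open>I2 \<le> E / 4\<close> by linarith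
    have "exp (- (r\<^sup>2 / (2 * v) + \<delta>) / a n) \<le> exp (- (\<delta> / 4 / a n)) * exp ((\<theta>\<^sup>2 / 2 * v - 2 * \<epsilon>) / a n) * exp (- ((\<theta> * r + \<bar>\<theta>\<bar> * h) / a n))"
    proof -
      \<comment> \<open>Minus the Legendre transform of the Gaussian at \<open>r\<close>; all
        remaining terms fit into \<delta>.\<close>
      have "\<theta>\<^sup>2 / 2 * v - \<theta> * r = - (r\<^sup>2 / (2 * v))"
        using v(2) by (simp add: \<theta>_def field_simps power2_eq_square)
      then have "- (r\<^sup>2 / (2 * v) + \<delta>) \<le> - (\<delta> / 4) + (\<theta>\<^sup>2 / 2 * v - 2 * \<epsilon>) - (\<theta> * r + \<bar>\<theta>\<bar> * h)"
        using h\<theta> \<open>\<delta> > 0\<close> unfolding \<epsilon>_def by linarith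
      then have "- (r\<^sup>2 / (2 * v) + \<delta>) / a n \<le> (- (\<delta> / 4) + (\<theta>\<^sup>2 / 2 * v - 2 * \<epsilon>) - (\<theta> * r + \<bar>\<theta>\<bar> * h)) / a n"
        using \<open>a n > 0\<close> by (intro divide_right_mono) auto
      also have "\<dots> = - (\<delta> / 4 / a n) + (\<theta>\<^sup>2 / 2 * v - 2 * \<epsilon>) / a n + - ((\<theta> * r + \<bar>\<theta>\<bar> * h) / a n)"
        by (simp add: diff_divide_distrib add_divide_distrib)
      finally show ?thesis unfolding exp_add[symmetric] by simp
    qed
    also have "\<dots> \<le> (1 / 2) * E * exp (- ((\<theta> * r + \<bar>\<theta>\<bar> * h) / a n))"
      using elim(8) lo by (intro mult_right_mono mult_mono) (auto simp: exp_minus field_simps)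
    also have "\<dots> \<le> prob G"
      using \<open>E / 2 \<le> c * prob G\<close> by (simp add: c_def exp_minus field_simps)
    also have "\<dots> \<le> prob {\<omega> \<in> space (M n). \<bar>a n * S n (B n) \<omega> - r\<bar> < \<eta>}"
    proof (rule finite_measure_mono)
      show "G \<subseteq> {\<omega> \<in> space (M n). \<bar>a n * S n (B n) \<omega> - r\<bar> < \<eta>}"
        using \<open>h \<le> \<eta>\<close> by (auto simp: G_def X_def)
      show "{\<omega> \<in> space (M n). \<bar>a n * S n (B n) \<omega> - r\<bar> < \<eta>} \<in> sets (M n)"
        unfolding X_def[symmetric] by measurable
    qed
    finally show ?case .
  qed
qed

end

section \<open>The functional moderate deviation principle for arrays with controlled exponential moments\<close>

text \<open>\<tau> counts the summands used up to time \<open>t\<close>, and by the weights it is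
  asymptotically a time change to unit speed. Outside the superexponentially small event
  \<open>N n\<close> the path is read off the bounded array.\<close>

locale mdp_array = exp_array a M Y k w C
  for a :: "nat \<Rightarrow> real" and M :: "nat \<Rightarrow> 'a measure" and Y k w C +
  fixes \<tau> :: "nat \<Rightarrow> real \<Rightarrow> nat" and Z :: "nat \<Rightarrow> 'a \<Rightarrow> cadlag" and N :: "nat \<Rightarrow> 'a set"
  assumes \<tau>_mono: "\<And>n s t. s \<le> t \<Longrightarrow> \<tau> n s \<le> \<tau> n t"
    and \<tau>_le: "\<And>n t. \<tau> n t \<le> k n"
    and \<tau>_w: "\<And>t. t \<in> {0..1} \<Longrightarrow> (\<lambda>n. \<Sum>j\<in>{1..\<tau> n t}. w n j) \<longlonglongrightarrow> t"
    and Z_measurable: "\<And>n. n \<ge> 1 \<Longrightarrow> Z n \<in> borel_measurable (M n)"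
    and N_sets: "\<And>n. n \<ge> 1 \<Longrightarrow> N n \<in> sets (M n)"
    and N_small: "\<And>R. exp_bound (\<lambda>n. measure (M n) (N n)) R"
    and path: "\<And>n \<omega> t. n \<ge> 1 \<Longrightarrow> \<omega> \<in> space (M n) - N n \<Longrightarrow> t \<in> {0..1} \<Longrightarrow>
      apply_cadlag (Z n \<omega>) t = a n * S n {1..\<tau> n t} \<omega>"
begin

text \<open>The summands with vanishing weight at time \<open>0\<close> are counted in the first block.\<close>

definition grid_index :: "nat \<Rightarrow> nat \<Rightarrow> nat \<Rightarrow> nat" where
  "grid_index m n i = (if i = 0 then 0 else \<tau> n (real i / real m))"

abbreviation block :: "nat \<Rightarrow> nat \<Rightarrow> nat \<Rightarrow> nat set" where
  "block m n i \<equiv> {grid_index m n i<..grid_index m n (Suc i)}"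

lemma grid_index_mono: "i \<le> j \<Longrightarrow> grid_index m n i \<le> grid_index m n j"
  unfolding grid_index_def by (auto intro!: \<tau>_mono divide_right_mono)

lemma grid_index_le: "grid_index m n i \<le> k n"
  unfolding grid_index_def using \<tau>_le by auto

lemma block_subset: "block m n i \<subseteq> {1..k n}"
  using grid_index_le[of m n "Suc i"] by auto

lemma grid_index_weight:
  assumes "i \<le> m"
  shows "(\<lambda>n. \<Sum>j\<in>{1..grid_index m n i}. w n j) \<longlonglongrightarrow> real i / real m"
proof (cases "i = 0")
  case False
  then have "real i / real m \<in> {0..1}" using assms by (auto simp: divide_le_eq)
  from \<tau>_w[OF this] show ?thesis using False by (simp add: grid_index_def)
qed (simp add: grid_index_def)

lemma block_weight:
  assumes "i < m"
  shows "(\<lambda>n. \<Sum>j\<in>block m n i. w n j) \<longlonglongrightarrow> 1 / real m"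
proof -
  have "(\<Sum>j\<in>block m n i. w n j) = (\<Sum>j\<in>{1..grid_index m n (Suc i)}. w n j) - (\<Sum>j\<in>{1..grid_index m n i}. w n j)" for n
  proof -
    have "{1..grid_index m n (Suc i)} = {1..grid_index m n i} \<union> block m n i" using grid_index_mono[of i "Suc i" m n] by auto
    moreover have "{1..grid_index m n i} \<inter> block m n i = {}" by auto
    ultimately show ?thesis by (simp add: sum.union_disjoint)
  qed
  moreover have "(\<lambda>n. (\<Sum>j\<in>{1..grid_index m n (Suc i)}. w n j) - (\<Sum>j\<in>{1..grid_index m n i}. w n j)) \<longlonglongrightarrow> real (Suc i) / real m - real i / real m"
    using assms by (intro tendsto_diff grid_index_weight) auto
  ultimately show ?thesis by (simp add: add_divide_distrib)
qed

section \<open>Oscillation between grid points\<close>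

definition osc :: "nat \<Rightarrow> real \<Rightarrow> nat \<Rightarrow> 'a set" where
  "osc m x n = {\<omega> \<in> space (M n). \<exists>i<m. \<exists>l\<in>{grid_index m n i..grid_index m n (Suc i)}. x \<le> \<bar>a n * S n {grid_index m n i<..l} \<omega>\<bar>}"

lemma osc_block_sets:
  assumes "n \<ge> 1"
  shows "{\<omega> \<in> space (M n). \<exists>l\<in>{grid_index m n i..grid_index m n (Suc i)}. x \<le> \<bar>a n * S n {grid_index m n i<..l} \<omega>\<bar>} \<in> sets (M n)"
proof (rule sets.sets_Collect_finite_Ex)
  fix l assume "l \<in> {grid_index m n i..grid_index m n (Suc i)}"
  then have "{grid_index m n i<..l} \<subseteq> {1..k n}" using grid_index_le[of m n "Suc i"] by auto
  then have "S n {grid_index m n i<..l} \<in> borel_measurable (M n)" by (rule S_measurable[OF assms])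
  then show "{\<omega> \<in> space (M n). x \<le> \<bar>a n * S n {grid_index m n i<..l} \<omega>\<bar>} \<in> sets (M n)" by measurable
qed simp

lemma osc_eq: "osc m x n = (\<Union>i<m. {\<omega> \<in> space (M n). \<exists>l\<in>{grid_index m n i..grid_index m n (Suc i)}. x \<le> \<bar>a n * S n {grid_index m n i<..l} \<omega>\<bar>})"
  by (auto simp: osc_def)

lemma osc_sets: "n \<ge> 1 \<Longrightarrow> osc m x n \<in> sets (M n)"
  unfolding osc_eq using osc_block_sets by (intro sets.finite_UN) auto

text \<open>\<theta> depends on \<open>R\<close> and \<open>x\<close> alone. A block has weight
  close to \<open>1 / m\<close>, so the loss \<open>\<theta>\<^sup>2 / m\<close> in Chernoff's
  exponent falls below 1 once \<open>m\<close> exceeds \<open>\<theta>\<^sup>2\<close>, and any rate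
  is reached by refining the grid.\<close>

lemma osc_small:
  assumes "x > 0"
  obtains m0 where "m0 > 0" "\<And>m. m \<ge> m0 \<Longrightarrow> exp_bound (\<lambda>n. measure (M n) (osc m x n)) R"
proof -
  \<comment> \<open>The maximal inequality bounds the event at level \<open>3 * y\<close> by tails
    at level \<open>y\<close>.\<close>
  define y where "y = x / 3"
  have "y > 0" using assms by (simp add: y_def)
  define \<theta> where "\<theta> = (\<bar>R\<bar> + 1) / y"
  have "\<theta> > 0" using \<open>y > 0\<close> by (simp add: \<theta>_def)
  obtain m0 :: nat where m0: "\<theta>\<^sup>2 < real m0" using reals_Archimedean2 by blast
  have "m0 > 0" using m0 by (metis gr0I less_le_not_le of_nat_0 zero_le_power2)
  moreover have "exp_bound (\<lambda>n. measure (M n) (osc m x n)) R" if "m \<ge> m0" for m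
  proof -
    have "m > 0" using that \<open>m0 > 0\<close> by simp
    have "\<theta>\<^sup>2 < real m" using m0 that by linarith
    let ?A = "\<lambda>n i. {\<omega> \<in> space (M n). \<exists>l\<in>{grid_index m n i..grid_index m n (Suc i)}. x \<le> \<bar>a n * S n {grid_index m n i<..l} \<omega>\<bar>}"
    define \<alpha> where "\<alpha> = \<theta> * y - \<theta>\<^sup>2 * (2 / real m) / 2"
    have "R \<le> \<alpha>"
    proof -
      have "\<theta>\<^sup>2 / real m < 1" using \<open>\<theta>\<^sup>2 < real m\<close> \<open>m > 0\<close> by simp
      moreover have "\<theta> * y = \<bar>R\<bar> + 1" using \<open>y > 0\<close> by (simp add: \<theta>_def)
      ultimately show ?thesis unfolding \<alpha>_def by simp
    qed
    have one: "exp_bound (\<lambda>n. measure (M n) (?A n i)) \<alpha>" if i: "i < m" for i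
    proof -
      \<comment> \<open>The factor \<open>1 / 4\<close> absorbs two factors 2, from the maximal
        inequality and from the two-sided tail.\<close>
      have "exp_bound (\<lambda>n. (1 / 4) * measure (M n) (?A n i)) \<alpha>"
        unfolding exp_bound_def
      proof (intro allI impI)
        fix \<delta> :: real assume "\<delta> > 0"
        \<comment> \<open>\<open>2 / m\<close> is a bound strictly above the limit
          \<open>1 / m\<close>, so it holds eventually.\<close>
        have "\<forall>\<^sub>F n in sequentially. (\<Sum>j\<in>block m n i. w n j) < 2 / real m"
          using \<open>m > 0\<close> by (intro order_tendstoD(2)[OF block_weight[OF i]]) (simp add: divide_strict_right_mono)
        then show "\<forall>\<^sub>F n in sequentially. (1 / 4) * measure (M n) (?A n i) \<le> exp ((\<delta> - \<alpha>) / a n)"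
          using tail_bound[OF less_imp_le[OF \<open>\<theta> > 0\<close>] \<open>\<delta> > 0\<close>, of "2 / real m" y] eventually_a_pos
        proof eventually_elim
          case (elim n)
          then have "n \<ge> 1" "a n > 0" by auto
          interpret prob_space "M n" using \<open>n \<ge> 1\<close> by (rule prob)
          have "prob {\<omega> \<in> space (M n). \<exists>l\<in>{grid_index m n i..grid_index m n (Suc i)}. 3 * (y / a n) \<le> \<bar>\<Sum>j\<in>{grid_index m n i<..l}. Y n j \<omega>\<bar>}
              \<le> 2 * (2 * exp ((\<delta> - \<alpha>) / a n))"
          proof (rule Etemadi_inequality)
            show "indep_vars (\<lambda>_. borel) (Y n) (block m n i)"
              using indep[OF \<open>n \<ge> 1\<close>] block_subset by (rule indep_vars_subset)
            show "grid_index m n i \<le> grid_index m n (Suc i)" by (rule grid_index_mono) simp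
            show "y / a n > 0" using \<open>y > 0\<close> \<open>a n > 0\<close> by simp
            fix l assume "l \<in> {grid_index m n i..grid_index m n (Suc i)}"
            then have sub: "{l<..grid_index m n (Suc i)} \<subseteq> block m n i" by auto
            then have "(\<Sum>j\<in>{l<..grid_index m n (Suc i)}. w n j) \<le> (\<Sum>j\<in>block m n i. w n j)"
              using w_nonneg by (intro sum_mono2) auto
            then have "(\<Sum>j\<in>{l<..grid_index m n (Suc i)}. w n j) \<le> 2 / real m" using elim(1) by simp
            then have "prob {\<omega> \<in> space (M n). y \<le> \<bar>a n * S n {l<..grid_index m n (Suc i)} \<omega>\<bar>} \<le> 2 * exp ((\<delta> - \<alpha>) / a n)"
              using elim(2) subset_trans[OF sub block_subset] unfolding \<alpha>_def by blast
            moreover have "{\<omega> \<in> space (M n). y \<le> \<bar>a n * S n {l<..grid_index m n (Suc i)} \<omega>\<bar>} =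
                {\<omega> \<in> space (M n). y / a n \<le> \<bar>\<Sum>j\<in>{l<..grid_index m n (Suc i)}. Y n j \<omega>\<bar>}"
              using \<open>a n > 0\<close> by (simp add: S_def abs_mult pos_divide_le_eq mult.commute)
            ultimately show "prob {\<omega> \<in> space (M n). y / a n \<le> \<bar>\<Sum>j\<in>{l<..grid_index m n (Suc i)}. Y n j \<omega>\<bar>} \<le> 2 * exp ((\<delta> - \<alpha>) / a n)"
              by simp
          qed
          moreover have "{\<omega> \<in> space (M n). \<exists>l\<in>{grid_index m n i..grid_index m n (Suc i)}. 3 * (y / a n) \<le> \<bar>\<Sum>j\<in>{grid_index m n i<..l}. Y n j \<omega>\<bar>} = ?A n i"
            using \<open>a n > 0\<close> by (simp add: S_def abs_mult pos_divide_le_eq mult.commute y_def)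
          ultimately show ?case by simp
        qed
      qed
      from exp_bound_cmult[OF this, of 4] show ?thesis by simp
    qed
    have "exp_bound (\<lambda>n. \<Sum>i<m. measure (M n) (?A n i)) \<alpha>"
      using one by (intro exp_bound_sum) auto
    then have "exp_bound (\<lambda>n. measure (M n) (osc m x n)) \<alpha>"
    proof (rule exp_bound_mono)
      show "\<forall>\<^sub>F n in sequentially. measure (M n) (osc m x n) \<le> (\<Sum>i<m. measure (M n) (?A n i))"
        using eventually_ge_at_top[of 1]
      proof eventually_elim
        case (elim n)
        then show ?case unfolding osc_eq using osc_block_sets by (intro measure_UNION_le) auto
      qed
    qed
    then show ?thesis using \<open>R \<le> \<alpha>\<close> by (rule exp_bound_antimono)
  qed
  ultimately show ?thesis by (rule that)
qed

section \<open>Exponential tails of the energy of the grid increments\<close>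

definition tail_exp :: "(nat \<Rightarrow> 'a \<Rightarrow> real) \<Rightarrow> bool" where
  "tail_exp U \<longleftrightarrow> (\<forall>x\<ge>0. exp_bound (\<lambda>n. measure (M n) {\<omega> \<in> space (M n). x \<le> U n \<omega>}) x)"

lemma prob_le_1_eventually: "\<forall>\<^sub>F n in sequentially. measure (M n) (A n) \<le> 1"
  using eventually_ge_at_top[of 1]
proof eventually_elim
  case (elim n)
  then interpret prob_space "M n" by (rule prob)
  show ?case by simp
qed

text \<open>Every split of \<open>x\<close> into \<open>y\<close> and \<open>x - y\<close> has the
  same cost \<open>y + (x - y)\<close>, so independence preserves the rate. Finitely many splits on
  a mesh \<open>h\<close> suffice, with a loss \<open>h\<close> that is arbitrarily small; no
  exponential moment at the critical exponent 1 is involved.\<close>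

lemma tail_exp_add:
  assumes "tail_exp U" "tail_exp V"
    and ind: "\<And>n. n \<ge> 1 \<Longrightarrow> prob_space.indep_var (M n) borel (U n) borel (V n)"
    and "\<And>n \<omega>. U n \<omega> \<ge> 0"
  shows "tail_exp (\<lambda>n \<omega>. U n \<omega> + V n \<omega>)"
  unfolding tail_exp_def
proof (intro allI impI)
  fix x :: real assume "x \<ge> 0"
  let ?P = "\<lambda>n. measure (M n) {\<omega> \<in> space (M n). x \<le> U n \<omega> + V n \<omega>}"
  have U: "exp_bound (\<lambda>n. measure (M n) {\<omega> \<in> space (M n). y \<le> U n \<omega>}) y"
    and V: "exp_bound (\<lambda>n. measure (M n) {\<omega> \<in> space (M n). y \<le> V n \<omega>}) y" if "y \<ge> 0" for y
    using assms(1,2) that by (auto simp: tail_exp_def)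
  show "exp_bound ?P x"
  proof (cases "x = 0")
    case True
    then show ?thesis using prob_le_1_eventually by (intro exp_bound_le_1) auto
  next
    case False
    then have "x > 0" using \<open>x \<ge> 0\<close> by simp
    show ?thesis
    proof (rule exp_bound_lift)
      fix \<beta> assume "\<beta> < x"
      \<comment> \<open>Chosen so that the mesh \<open>h = x / K\<close> is below the admissible
        loss \<open>x - \<beta>\<close>.\<close>
      obtain K :: nat where K: "x / (x - \<beta>) < real K" using reals_Archimedean2 by blast
      have "0 < x / (x - \<beta>)" using \<open>x > 0\<close> \<open>\<beta> < x\<close> by simp
      then have "K > 0" using K by (metis gr0I less_trans of_nat_0 order_less_irrefl)
      define h where "h = x / real K"
      have "h > 0" using \<open>K > 0\<close> \<open>x > 0\<close> by (simp add: h_def)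
      have Kh: "real K * h = x" using \<open>K > 0\<close> by (simp add: h_def)
      have "x < real K * (x - \<beta>)" using K \<open>\<beta> < x\<close> by (simp add: pos_divide_less_eq)
      then have "h < x - \<beta>" using \<open>K > 0\<close> by (simp add: h_def pos_divide_less_eq mult.commute)
      have summand: "exp_bound (\<lambda>n. measure (M n) {\<omega> \<in> space (M n). real i * h \<le> U n \<omega>} *
          measure (M n) {\<omega> \<in> space (M n). real (K - 1 - i) * h \<le> V n \<omega>}) (x - h)" if "i < K" for i
      proof -
        have "real i * h + real (K - 1 - i) * h = x - h"
          using that Kh by (simp add: of_nat_diff algebra_simps)
        then show ?thesis
          using exp_bound_mult[OF U[of "real i * h"] V[of "real (K - 1 - i) * h"]] \<open>h > 0\<close> by simp
      qed
      have "exp_bound (\<lambda>n. (\<Sum>i<K. measure (M n) {\<omega> \<in> space (M n). real i * h \<le> U n \<omega>} *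
          measure (M n) {\<omega> \<in> space (M n). real (K - 1 - i) * h \<le> V n \<omega>}) +
          measure (M n) {\<omega> \<in> space (M n). real K * h \<le> U n \<omega>}) (x - h)"
        using summand U[of "real K * h"] \<open>h > 0\<close> Kh \<open>x > 0\<close>
        by (intro exp_bound_add exp_bound_sum) (auto intro: exp_bound_antimono)
      then have "exp_bound ?P (x - h)"
      proof (rule exp_bound_mono)
        show "\<forall>\<^sub>F n in sequentially. ?P n \<le> (\<Sum>i<K. measure (M n) {\<omega> \<in> space (M n). real i * h \<le> U n \<omega>} *
          measure (M n) {\<omega> \<in> space (M n). real (K - 1 - i) * h \<le> V n \<omega>}) +
          measure (M n) {\<omega> \<in> space (M n). real K * h \<le> U n \<omega>}"
          using eventually_ge_at_top[of 1]
        proof eventually_elim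
          case (elim n)
          then interpret prob_space "M n" by (rule prob)
          show ?case
            using indep_sum_tail_le[OF ind[OF elim] assms(4) \<open>h > 0\<close>, of K] unfolding Kh by simp
        qed
      qed
      then show "exp_bound ?P \<beta>" by (rule exp_bound_antimono) (use \<open>h < x - \<beta>\<close> in simp)
    qed
  qed
qed

definition block_energy :: "nat \<Rightarrow> nat \<Rightarrow> nat \<Rightarrow> 'a \<Rightarrow> real" where
  "block_energy m i n \<omega> = real m / 2 * (a n * S n (block m n i) \<omega>)\<^sup>2"

text \<open>The factor \<open>m / 2\<close> in the energy is made for this: the block has limiting
  variance \<open>1 / m\<close>, so the Gaussian cost of reaching \<open>sqrt (2 * x / m)\<close> in
  absolute value is exactly \<open>x\<close>.\<close>

lemma tail_exp_block_energy:
  assumes "i < m"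
  shows "tail_exp (block_energy m i)"
  unfolding tail_exp_def
proof (intro allI impI)
  fix x :: real assume "x \<ge> 0"
  let ?P = "\<lambda>n. measure (M n) {\<omega> \<in> space (M n). x \<le> block_energy m i n \<omega>}"
  have "m > 0" using assms by simp
  show "exp_bound ?P x"
  proof (cases "x = 0")
    case True
    then show ?thesis using prob_le_1_eventually by (intro exp_bound_le_1) auto
  next
    case False
    then have "x > 0" using \<open>x \<ge> 0\<close> by simp
    define y where "y = sqrt (2 * x / real m)"
    \<comment> \<open>The optimal tilt \<open>y / v\<close> at the variance
      \<open>v = 1 / m\<close>.\<close>
    define \<theta> where "\<theta> = real m * y"
    have y2: "y\<^sup>2 = 2 * x / real m" using \<open>x > 0\<close> by (simp add: y_def)
    have "y \<ge> 0" using \<open>x > 0\<close> by (simp add: y_def)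
    have "\<theta> \<ge> 0" using \<open>y \<ge> 0\<close> by (simp add: \<theta>_def)
    have \<theta>y: "\<theta> * y = 2 * x" "\<theta>\<^sup>2 = 2 * x * real m"
    proof -
      have "\<theta> * y = real m * y\<^sup>2" "\<theta>\<^sup>2 = real m * (real m * y\<^sup>2)"
        by (simp_all add: \<theta>_def power2_eq_square ac_simps)
      then show "\<theta> * y = 2 * x" "\<theta>\<^sup>2 = 2 * x * real m" using \<open>m > 0\<close> by (simp_all add: y2)
    qed
    show ?thesis
    proof (rule exp_bound_lift)
      fix \<beta> assume "\<beta> < x"
      \<comment> \<open>A variance slightly above \<open>1 / m\<close>, tuned so that the exponent
        equals \<beta>.\<close>
      define v where "v = 1 / real m + (x - \<beta>) / (real m * x)"
      have "v > 1 / real m" using \<open>\<beta> < x\<close> \<open>x > 0\<close> \<open>m > 0\<close> by (simp add: v_def)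
      have exponent: "\<theta> * y - \<theta>\<^sup>2 * v / 2 = \<beta>"
        unfolding \<theta>y v_def using \<open>x > 0\<close> \<open>m > 0\<close> by (simp add: field_simps)
      have "exp_bound (\<lambda>n. (1 / 2) * ?P n) \<beta>"
        unfolding exp_bound_def
      proof (intro allI impI)
        fix \<delta> :: real assume "\<delta> > 0"
        have "\<forall>\<^sub>F n in sequentially. (\<Sum>j\<in>block m n i. w n j) < v"
          using \<open>v > 1 / real m\<close> by (rule order_tendstoD(2)[OF block_weight[OF assms]])
        then show "\<forall>\<^sub>F n in sequentially. (1 / 2) * ?P n \<le> exp ((\<delta> - \<beta>) / a n)"
          using tail_bound[OF \<open>\<theta> \<ge> 0\<close> \<open>\<delta> > 0\<close>, of v y] eventually_ge_at_top[of 1]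
        proof eventually_elim
          case (elim n)
          then interpret prob_space "M n" by (intro prob)
          have [measurable]: "S n (block m n i) \<in> borel_measurable (M n)"
            using elim(3) block_subset by (rule S_measurable)
          have "{\<omega> \<in> space (M n). x \<le> block_energy m i n \<omega>} \<subseteq> {\<omega> \<in> space (M n). y \<le> \<bar>a n * S n (block m n i) \<omega>\<bar>}"
          proof safe
            fix \<omega> assume "x \<le> block_energy m i n \<omega>"
            then have "y\<^sup>2 \<le> (a n * S n (block m n i) \<omega>)\<^sup>2"
              unfolding y2 block_energy_def using \<open>m > 0\<close> by (simp add: field_simps)
            then show "y \<le> \<bar>a n * S n (block m n i) \<omega>\<bar>"
              using \<open>y \<ge> 0\<close> by (simp add: abs_le_square_iff[symmetric])
          qed
          then have "?P n \<le> prob {\<omega> \<in> space (M n). y \<le> \<bar>a n * S n (block m n i) \<omega>\<bar>}"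
            by (intro finite_measure_mono) auto
          also have "\<dots> \<le> 2 * exp ((\<delta> - (\<theta> * y - \<theta>\<^sup>2 * v / 2)) / a n)"
            using elim(1,2) block_subset by (simp add: less_imp_le)
          finally show ?case unfolding exponent by simp
        qed
      qed
      from exp_bound_cmult[OF this, of 2] show "exp_bound ?P \<beta>" by simp
    qed
  qed
qed

lemma indep_block_sums:
  assumes "n \<ge> 1"
  shows "prob_space.indep_vars (M n) (\<lambda>_. borel) (\<lambda>i. S n (block m n i)) {..<m}"
proof -
  interpret prob_space "M n" using assms by (rule prob)
  have disj: "disjoint_family_on (block m n) {..<m}"
    unfolding disjoint_family_on_def
  proof (intro ballI impI)
    fix i j :: nat assume "i \<noteq> j"
    then have "Suc i \<le> j \<or> Suc j \<le> i" by linarith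
    then have "grid_index m n (Suc i) \<le> grid_index m n j \<or> grid_index m n (Suc j) \<le> grid_index m n i" using grid_index_mono by blast
    then show "block m n i \<inter> block m n j = {}" by auto
  qed
  have "indep_vars (\<lambda>i. PiM (block m n i) (\<lambda>_. borel)) (\<lambda>i \<omega>. restrict (\<lambda>j. Y n j \<omega>) (block m n i)) {..<m}"
    by (rule indep_vars_restrict[OF indep[OF assms] block_subset disj])
  then have "indep_vars (\<lambda>_. borel) (\<lambda>i \<omega>. (\<lambda>f. \<Sum>j\<in>block m n i. f j) (restrict (\<lambda>j. Y n j \<omega>) (block m n i))) {..<m}"
    by (rule indep_vars_compose2) (intro borel_measurable_sum measurable_component_singleton)
  then show ?thesis by (simp add: S_def[abs_def])
qed

lemma tail_exp_quadratic:
  assumes "j \<le> m"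
  shows "tail_exp (\<lambda>n \<omega>. \<Sum>i<j. block_energy m i n \<omega>)"
  using assms
proof (induction j)
  case 0
  show ?case
    unfolding tail_exp_def
  proof (intro allI impI)
    fix x :: real assume "x \<ge> 0"
    then consider "x = 0" | "x > 0" by linarith
    then show "exp_bound (\<lambda>n. measure (M n) {\<omega> \<in> space (M n). x \<le> (\<Sum>i<0. block_energy m i n \<omega>)}) x"
    proof cases
      case 1
      then show ?thesis using prob_le_1_eventually by (intro exp_bound_le_1) auto
    next
      case 2
      then show ?thesis by (simp add: exp_bound_zero)
    qed
  qed
next
  case (Suc j)
  have "tail_exp (\<lambda>n \<omega>. block_energy m j n \<omega> + (\<Sum>i<j. block_energy m i n \<omega>))"
  proof (rule tail_exp_add)
    show "tail_exp (block_energy m j)" using Suc.prems by (intro tail_exp_block_energy) simp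
    show "tail_exp (\<lambda>n \<omega>. \<Sum>i<j. block_energy m i n \<omega>)" using Suc by simp
    show "block_energy m j n \<omega> \<ge> 0" for n \<omega> by (simp add: block_energy_def)
    fix n :: nat assume "n \<ge> 1"
    then interpret prob_space "M n" by (rule prob)
    have "indep_vars (\<lambda>_. borel) (\<lambda>i. block_energy m i n) {..<m}"
      unfolding block_energy_def
      by (rule indep_vars_compose2[OF indep_block_sums[OF \<open>n \<ge> 1\<close>], of _ "\<lambda>i s. real m / 2 * (a n * s)\<^sup>2"]) measurable
    then have "indep_vars (\<lambda>_. borel) (\<lambda>i. block_energy m i n) (insert j {..<j})"
      by (rule indep_vars_subset) (use Suc.prems in auto)
    then show "indep_var borel (block_energy m j n) borel (\<lambda>\<omega>. \<Sum>i<j. block_energy m i n \<omega>)"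
      by (intro indep_vars_sum) auto
  qed
  then show ?case by (simp add: add.commute)
qed

section \<open>Comparison of the path with its grid values, and the two probability bounds\<close>

definition grid_value :: "nat \<Rightarrow> nat \<Rightarrow> 'a \<Rightarrow> nat \<Rightarrow> real" where
  "grid_value m n \<omega> i = a n * S n {1..grid_index m n i} \<omega>"

lemma S_diff:
  assumes "p \<le> q"
  shows "S n {1..q} \<omega> - S n {1..p} \<omega> = S n {p<..q} \<omega>"
proof -
  have "{1..q} = {1..p} \<union> {p<..q}" "{1..p} \<inter> {p<..q} = {}" using assms by auto
  then show ?thesis by (simp add: S_def sum.union_disjoint)
qed

lemma grid_value_0: "grid_value m n \<omega> 0 = 0"
  by (simp add: grid_value_def grid_index_def S_def)

lemma grid_value_diff: "grid_value m n \<omega> (Suc i) - grid_value m n \<omega> i = a n * S n (block m n i) \<omega>"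
  unfolding grid_value_def right_diff_distrib[symmetric] S_diff[OF grid_index_mono[OF le_SucI[OF order_refl]]] ..

text \<open>The path at a time in cell \<open>i\<close> and the next grid value differ from the left
  grid value by partial sums of the same block, which \<open>osc\<close> controls. In cell 0 the
  block starts at index 0, so summands already counted at time 0 are included.\<close>

lemma path_near:
  assumes "n \<ge> 1" "\<omega> \<in> space (M n) - N n" "\<omega> \<notin> osc m x n" "i < m"
    and t: "t \<in> {0..1}" "real i / real m \<le> t" "t \<le> (real i + 1) / real m"
  shows "\<bar>apply_cadlag (Z n \<omega>) t - grid_value m n \<omega> i\<bar> < x" "\<bar>grid_value m n \<omega> (Suc i) - grid_value m n \<omega> i\<bar> < x"
proof -
  have o: "\<bar>a n * S n {grid_index m n i<..l} \<omega>\<bar> < x" if "l \<in> {grid_index m n i..grid_index m n (Suc i)}" for l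
    using assms(2,3,4) that by (auto simp: osc_def not_le)
  have "grid_index m n i \<le> \<tau> n t" "\<tau> n t \<le> grid_index m n (Suc i)"
    using t \<tau>_mono[of "real i / real m" t n] \<tau>_mono[of t "real (Suc i) / real m" n] by (auto simp: grid_index_def add.commute)
  then have "\<bar>a n * S n {grid_index m n i<..\<tau> n t} \<omega>\<bar> < x" by (intro o) auto
  moreover have "apply_cadlag (Z n \<omega>) t - grid_value m n \<omega> i = a n * S n {grid_index m n i<..\<tau> n t} \<omega>"
    unfolding path[OF assms(1,2) t(1)] grid_value_def right_diff_distrib[symmetric] S_diff[OF \<open>grid_index m n i \<le> \<tau> n t\<close>] ..
  ultimately show "\<bar>apply_cadlag (Z n \<omega>) t - grid_value m n \<omega> i\<bar> < x" by simp
  show "\<bar>grid_value m n \<omega> (Suc i) - grid_value m n \<omega> i\<bar> < x"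
    unfolding grid_value_diff by (rule o) (simp add: grid_index_mono)
qed

theorem upper_bound:
  assumes F: "closed F" and "\<alpha> \<ge> 0" and rate: "\<And>z. z \<in> F \<Longrightarrow> ereal \<alpha> < mdp_rate z"
  shows "exp_bound (\<lambda>n. measure (M n) {\<omega> \<in> space (M n). Z n \<omega> \<in> F}) \<alpha>"
proof -
  have "compact {z. mdp_rate z \<le> ereal \<alpha>}"
    using good_mdp_rate by (simp add: good_rate_function_def)
  moreover have "{z. mdp_rate z \<le> ereal \<alpha>} \<inter> F = {}" using rate by (auto simp: not_le[symmetric])
  ultimately obtain d where "d > 0" and d: "\<And>x y. x \<in> {z. mdp_rate z \<le> ereal \<alpha>} \<Longrightarrow> y \<in> F \<Longrightarrow> d \<le> dist x y"
    using compact_closed_separated[OF _ F, of "{z. mdp_rate z \<le> ereal \<alpha>}"] by metis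
  \<comment> \<open>Path and polygon will differ by at most \<open>2 * x\<close>, which is below
    \<open>d\<close>.\<close>
  define x where "x = d / 3"
  have "x > 0" using \<open>d > 0\<close> by (simp add: x_def)
  obtain m where "m > 0" and m: "exp_bound (\<lambda>n. measure (M n) (osc m x n)) \<alpha>"
    using osc_small[OF \<open>x > 0\<close>, of \<alpha>] by (metis order_refl)
  let ?Q = "\<lambda>n. {\<omega> \<in> space (M n). \<alpha> \<le> (\<Sum>i<m. block_energy m i n \<omega>)}"
  have Q: "exp_bound (\<lambda>n. measure (M n) (?Q n)) \<alpha>"
    using tail_exp_quadratic[OF order_refl] \<open>\<alpha> \<ge> 0\<close> by (simp add: tail_exp_def)
  have "exp_bound (\<lambda>n. (measure (M n) (N n) + measure (M n) (osc m x n)) + measure (M n) (?Q n)) \<alpha>"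
    by (intro exp_bound_add N_small m Q)
  then show ?thesis
  proof (rule exp_bound_mono)
    show "\<forall>\<^sub>F n in sequentially. measure (M n) {\<omega> \<in> space (M n). Z n \<omega> \<in> F} \<le>
        (measure (M n) (N n) + measure (M n) (osc m x n)) + measure (M n) (?Q n)"
      using eventually_ge_at_top[of 1]
    proof eventually_elim
      case (elim n)
      then interpret prob_space "M n" by (rule prob)
      have "S n (block m n i) \<in> borel_measurable (M n)" for i using elim block_subset by (rule S_measurable)
      then have "(\<lambda>\<omega>. \<Sum>i<m. block_energy m i n \<omega>) \<in> borel_measurable (M n)" unfolding block_energy_def by measurable
      then have Qs: "?Q n \<in> sets (M n)" by measurable
      have sub: "{\<omega> \<in> space (M n). Z n \<omega> \<in> F} \<subseteq> (N n \<union> osc m x n) \<union> ?Q n"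
      proof
        fix \<omega> assume "\<omega> \<in> {\<omega> \<in> space (M n). Z n \<omega> \<in> F}"
        then have \<omega>: "\<omega> \<in> space (M n)" "Z n \<omega> \<in> F" by auto
        show "\<omega> \<in> (N n \<union> osc m x n) \<union> ?Q n"
        proof (rule ccontr)
          assume no: "\<omega> \<notin> (N n \<union> osc m x n) \<union> ?Q n"
          let ?p = "cadlag_of (polygon m (grid_value m n \<omega>))"
          have "dist (Z n \<omega>) ?p \<le> 2 * x"
          proof (rule dist_polygon_le[where c = "grid_value m n \<omega>", OF \<open>m > 0\<close> grid_value_0])
            fix i t assume "i < m" "t \<in> {0..1}" "real i / real m \<le> t" "t \<le> (real i + 1) / real m"
            then show "\<bar>apply_cadlag (Z n \<omega>) t - grid_value m n \<omega> i\<bar> + \<bar>grid_value m n \<omega> (Suc i) - grid_value m n \<omega> i\<bar> \<le> 2 * x"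
              using path_near[of n \<omega> m x i t] elim no \<omega> by simp
          qed
          then have "dist ?p (Z n \<omega>) < d" using \<open>d > 0\<close> by (simp add: x_def dist_commute)
          \<comment> \<open>The polygon is too close to \<open>F\<close> to lie in the level set, so
            its energy exceeds \<alpha>, contrary to the choice of \<omega> outside
            \<open>?Q n\<close>.\<close>
          then have "\<not> mdp_rate ?p \<le> ereal \<alpha>" using d[of ?p "Z n \<omega>"] \<omega> by auto
          then have "ereal \<alpha> < mdp_rate ?p" by simp
          also have "\<dots> \<le> ereal (real m / 2 * (\<Sum>i<m. (grid_value m n \<omega> (Suc i) - grid_value m n \<omega> i)\<^sup>2))"
            using \<open>m > 0\<close> grid_value_0 by (rule mdp_rate_polygon_le)
          also have "real m / 2 * (\<Sum>i<m. (grid_value m n \<omega> (Suc i) - grid_value m n \<omega> i)\<^sup>2) = (\<Sum>i<m. block_energy m i n \<omega>)"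
            by (simp add: grid_value_diff block_energy_def sum_distrib_left)
          finally show False using no \<omega> by simp
        qed
      qed
      have "prob {\<omega> \<in> space (M n). Z n \<omega> \<in> F} \<le> prob ((N n \<union> osc m x n) \<union> ?Q n)"
        using sub N_sets[OF elim] osc_sets[OF elim] Qs by (intro finite_measure_mono) auto
      also have "\<dots> \<le> prob (N n \<union> osc m x n) + prob (?Q n)"
        using N_sets[OF elim] osc_sets[OF elim] Qs by (intro measure_Un_le) auto
      also have "\<dots> \<le> (prob (N n) + prob (osc m x n)) + prob (?Q n)"
        using N_sets[OF elim] osc_sets[OF elim] by (intro add_right_mono measure_Un_le) auto
      finally show ?case .
    qed
  qed
qed

text \<open>Independence of the blocks turns the probability of matching all increments into a
  product, whose exponents add up to the grid energy of \<open>z\<close>, at most \<iota> up to a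
  small error.\<close>

theorem lower_bound:
  assumes "\<rho> > 0" and rate: "mdp_rate z \<le> ereal \<iota>" and "\<delta> > 0"
    and G: "ball z \<rho> \<subseteq> G" "\<And>n. n \<ge> 1 \<Longrightarrow> {\<omega> \<in> space (M n). Z n \<omega> \<in> G} \<in> sets (M n)"
  shows "\<forall>\<^sub>F n in sequentially. exp (- (\<iota> + \<delta>) / a n) \<le> measure (M n) {\<omega> \<in> space (M n). Z n \<omega> \<in> G}"
proof -
  define f where "f = apply_cadlag z"
  have f0: "f 0 = 0" and fe: "energy_le f \<iota>" using rate by (auto simp: mdp_rate_le_iff f_def)
  have "\<iota> \<ge> 0" using fe by (rule energy_le_nonneg)
  define x where "x = \<rho> / 4"
  have "x > 0" using assms(1) by (simp add: x_def)
  \<comment> \<open>The rate exceeds \<open>\<iota> + \<delta>\<close> by 1, which pays for the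
    slack in \<open>exp_boundD\<close>: the oscillation costs at most
    \<open>exp (- (\<iota> + \<delta>) / a n)\<close>, eventually no more than half of the
    probability of the main event.\<close>
  obtain m0 where m0: "m0 > 0" "\<And>m. m \<ge> m0 \<Longrightarrow> exp_bound (\<lambda>n. measure (M n) (osc m x n)) (\<iota> + \<delta> + 1)"
    using osc_small[OF \<open>x > 0\<close>] by blast
  obtain m1 :: nat where m1: "2 * \<iota> / x\<^sup>2 < real m1" using reals_Archimedean2 by blast
  \<comment> \<open>The second bound on \<open>m\<close> makes the target vary by less than
    \<open>x\<close> on each cell.\<close>
  define m where "m = max m0 (Suc m1)"
  have "m > 0" by (simp add: m_def)
  have osc: "exp_bound (\<lambda>n. measure (M n) (osc m x n)) (\<iota> + \<delta> + 1)" by (rule m0) (simp add: m_def)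
  have mod: "\<bar>f t - f (real i / real m)\<bar> < x" if "i < m" "t \<in> {0..1}" "real i / real m \<le> t" "t \<le> (real i + 1) / real m" for i t
  proof -
    have "real i / real m \<in> {0..1}" using that by auto
    then have "(f t - f (real i / real m))\<^sup>2 \<le> 2 * \<iota> * (t - real i / real m)"
      using that by (intro energy_le_increment[OF fe]) auto
    also have "\<dots> \<le> 2 * \<iota> * (1 / real m)"
      using that \<open>\<iota> \<ge> 0\<close> by (intro mult_left_mono) (auto simp: add_divide_distrib)
    also have "\<dots> < x\<^sup>2"
    proof -
      have "2 * \<iota> / x\<^sup>2 < real m" using m1 by (simp add: m_def)
      then show ?thesis using \<open>m > 0\<close> \<open>x > 0\<close> by (simp add: field_simps)
    qed
    finally have "\<bar>f t - f (real i / real m)\<bar>\<^sup>2 < x\<^sup>2" by simp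
    then show ?thesis using \<open>x > 0\<close> power2_less_imp_less[of "\<bar>f t - f (real i / real m)\<bar>" x] by simp
  qed
  define r where "r i = f ((real i + 1) / real m) - f (real i / real m)" for i
  \<comment> \<open>Gaussian cost of the increment \<open>r i\<close> for variance
    \<open>1 / m\<close>, plus an equal share of \<open>\<delta> / 2\<close>.\<close>
  define q where "q i = (r i)\<^sup>2 / (2 * (1 / real m)) + \<delta> / 2 / real m" for i
  \<comment> \<open>Errors of the increments accumulate over at most \<open>m\<close> cells, hence
    to at most \<open>x\<close>.\<close>
  define \<eta> where "\<eta> = x / real m"
  have "\<eta> > 0" using \<open>x > 0\<close> \<open>m > 0\<close> by (simp add: \<eta>_def)
  let ?E = "\<lambda>n i. {\<omega> \<in> space (M n). \<bar>a n * S n (block m n i) \<omega> - r i\<bar> < \<eta>}"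
  have "\<delta> / 2 / real m > 0" using \<open>\<delta> > 0\<close> \<open>m > 0\<close> by simp
  have one: "\<forall>\<^sub>F n in sequentially. exp (- q i / a n) \<le> measure (M n) (?E n i)"
    if "i < m" for i
    unfolding q_def using \<open>m > 0\<close> block_subset by (intro concentration_lower_bound block_weight that \<open>\<eta> > 0\<close> \<open>\<delta> / 2 / real m > 0\<close>) auto
  then have all: "\<forall>\<^sub>F n in sequentially. \<forall>i\<in>{..<m}. exp (- q i / a n) \<le> measure (M n) (?E n i)"
    by (intro eventually_ball_finite) auto
  have sum_r: "(\<Sum>i<m. q i) \<le> \<iota> + \<delta> / 2"
  proof -
    have "(\<Sum>i<m. (r i)\<^sup>2 / (2 * (1 / real m))) = (\<Sum>i<m. real m * (r i)\<^sup>2) / 2"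
      by (simp add: sum_divide_distrib mult.commute)
    also have "\<dots> \<le> \<iota>" using energy_le_grid[OF fe \<open>m > 0\<close>] by (simp add: r_def)
    finally show ?thesis using \<open>m > 0\<close> by (simp add: q_def sum.distrib)
  qed
  have small: "exp_bound (\<lambda>n. measure (M n) (N n) + measure (M n) (osc m x n)) (\<iota> + \<delta> + 1)"
    by (intro exp_bound_add N_small osc)
  have "\<delta> / 2 > 0" using \<open>\<delta> > 0\<close> by simp
  show ?thesis
    using all exp_boundD[OF small zero_less_one] eventually_le_exp[OF \<open>\<delta> / 2 > 0\<close>, of 2] eventually_a_pos
  proof eventually_elim
    case (elim n)
    then have n: "n \<ge> 1" "a n > 0" by auto
    interpret prob_space "M n" using n(1) by (rule prob)
    have Sm: "S n (block m n i) \<in> borel_measurable (M n)" for i using n(1) block_subset by (rule S_measurable)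
    have Es: "?E n i \<in> sets (M n)" for i using Sm[of i] by measurable
    define A where "A = (\<Inter>i\<in>{..<m}. ?E n i)"
    have As: "A \<in> sets (M n)" unfolding A_def using Es \<open>m > 0\<close> by (intro sets.finite_INT) auto
    have "exp (- (\<iota> + \<delta> / 2) / a n) \<le> exp (\<Sum>i<m. - q i / a n)"
    proof -
      have "- (\<iota> + \<delta> / 2) / a n \<le> - (\<Sum>i<m. q i) / a n"
        using sum_r n(2) by (intro divide_right_mono) auto
      then show ?thesis by (simp only: sum_divide_distrib[symmetric] sum_negf exp_le_cancel_iff)
    qed
    also have "\<dots> = (\<Prod>i<m. exp (- q i / a n))"
      by (simp add: exp_sum)
    also have "\<dots> \<le> (\<Prod>i<m. prob (?E n i))"
      using elim(1) by (intro prod_mono) auto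
    also have "\<dots> = prob A"
    proof -
      have eq: "?E n i = S n (block m n i) -` {s. \<bar>a n * s - r i\<bar> < \<eta>} \<inter> space (M n)" for i by auto
      have "{s. \<bar>a n * s - r i\<bar> < \<eta>} \<in> sets borel" for i by measurable
      then show ?thesis
        unfolding A_def eq using \<open>m > 0\<close>
        by (intro indep_varsD_finite[OF indep_block_sums[OF n(1)], symmetric]) auto
    qed
    finally have PA: "exp (- (\<iota> + \<delta> / 2) / a n) \<le> prob A" .
    have sub: "A \<subseteq> {\<omega> \<in> space (M n). Z n \<omega> \<in> G} \<union> (N n \<union> osc m x n)"
    proof
      fix \<omega> assume "\<omega> \<in> A"
      then have \<omega>: "\<omega> \<in> space (M n)" and E: "\<And>i. i < m \<Longrightarrow> \<bar>a n * S n (block m n i) \<omega> - r i\<bar> < \<eta>"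
        using \<open>m > 0\<close> by (auto simp: A_def)
      show "\<omega> \<in> {\<omega> \<in> space (M n). Z n \<omega> \<in> G} \<union> (N n \<union> osc m x n)"
      proof (rule ccontr)
        assume no: "\<omega> \<notin> {\<omega> \<in> space (M n). Z n \<omega> \<in> G} \<union> (N n \<union> osc m x n)"
        have grid_close: "\<bar>grid_value m n \<omega> i - f (real i / real m)\<bar> \<le> real i * \<eta>" if "i \<le> m" for i
          using that
        proof (induction i)
          case 0
          then show ?case by (simp add: grid_value_0 f0)
        next
          case (Suc i)
          have "grid_value m n \<omega> (Suc i) - f (real (Suc i) / real m) =
              (grid_value m n \<omega> i - f (real i / real m)) + (a n * S n (block m n i) \<omega> - r i)"
            unfolding grid_value_diff[symmetric] by (simp add: r_def add.commute)
          moreover have "\<bar>a n * S n (block m n i) \<omega> - r i\<bar> < \<eta>" using Suc.prems by (intro E) simp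
          moreover have "\<bar>grid_value m n \<omega> i - f (real i / real m)\<bar> \<le> real i * \<eta>" using Suc by simp
          moreover have "real (Suc i) * \<eta> = real i * \<eta> + \<eta>" by (simp add: algebra_simps)
          ultimately show ?case by linarith
        qed
        have "dist (Z n \<omega>) z \<le> 3 * x"
        proof (rule dist_cadlag_le)
          fix t :: real assume t: "t \<in> {0..1}"
          obtain i where i: "i < m" "real i / real m \<le> t" "t \<le> (real i + 1) / real m"
            using \<open>m > 0\<close> t by (rule grid_cellE)
          have "real i * \<eta> \<le> real m * \<eta>" using i \<open>\<eta> > 0\<close> by (intro mult_right_mono) auto
          then have "real i * \<eta> \<le> x" using \<open>m > 0\<close> by (simp add: \<eta>_def)
          then have 1: "\<bar>grid_value m n \<omega> i - f (real i / real m)\<bar> \<le> x" using grid_close[of i] i by simp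
          have 2: "\<bar>apply_cadlag (Z n \<omega>) t - grid_value m n \<omega> i\<bar> < x"
            using path_near(1)[of n \<omega> m x i t] n no \<omega> i t by simp
          have 3: "\<bar>f t - f (real i / real m)\<bar> < x" using mod[OF i(1) t i(2,3)] .
          show "\<bar>apply_cadlag (Z n \<omega>) t - apply_cadlag z t\<bar> \<le> 3 * x"
            unfolding f_def[symmetric] using 1 2 3 by linarith
        qed
        then have "dist z (Z n \<omega>) < \<rho>" using \<open>\<rho> > 0\<close> by (simp add: x_def dist_commute)
        then have "Z n \<omega> \<in> G" using G(1) by auto
        then show False using no \<omega> by simp
      qed
    qed
    have "prob A \<le> prob ({\<omega> \<in> space (M n). Z n \<omega> \<in> G} \<union> (N n \<union> osc m x n))"
      using sub G(2)[OF n(1)] N_sets[OF n(1)] osc_sets[OF n(1)] by (intro finite_measure_mono) auto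
    also have "\<dots> \<le> prob {\<omega> \<in> space (M n). Z n \<omega> \<in> G} + prob (N n \<union> osc m x n)"
      using G(2)[OF n(1)] N_sets[OF n(1)] osc_sets[OF n(1)] by (intro measure_Un_le) auto
    also have "prob (N n \<union> osc m x n) \<le> prob (N n) + prob (osc m x n)"
      using N_sets[OF n(1)] osc_sets[OF n(1)] by (intro measure_Un_le) auto
    finally have le: "prob A \<le> prob {\<omega> \<in> space (M n). Z n \<omega> \<in> G} + exp ((1 - (\<iota> + \<delta> + 1)) / a n)"
      using elim(2) by linarith
    have e1: "exp ((1 - (\<iota> + \<delta> + 1)) / a n) = exp (- (\<iota> + \<delta>) / a n)" by simp
    have "2 * exp (- (\<iota> + \<delta>) / a n) \<le> exp (\<delta> / 2 / a n) * exp (- (\<iota> + \<delta>) / a n)"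
      using elim(3) by (intro mult_right_mono) auto
    also have "\<dots> = exp (- (\<iota> + \<delta> / 2) / a n)"
      unfolding exp_add[symmetric] add_divide_distrib[symmetric] by (simp add: algebra_simps)
    finally show ?case using PA le unfolding e1 by linarith
  qed
qed

section \<open>From probability bounds to limits of scaled logarithms\<close>

lemma log_prob_le:
  assumes "p \<ge> 0" "c > 0" "p \<le> exp (s / c)"
  shows "ereal c * log_prob p \<le> ereal s"
proof (cases "p = 0")
  case True
  then show ?thesis using assms(2) by (simp add: log_prob_def)
next
  case False
  then have "p > 0" using assms(1) by simp
  then have "ln p \<le> s / c" using assms(3) by (metis ln_exp ln_le_cancel_iff exp_gt_zero)
  then have "c * ln p \<le> s" using assms(2) by (simp add: field_simps)
  then show ?thesis using False by (simp add: log_prob_def)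
qed

lemma log_prob_ge:
  assumes "c > 0" "exp (s / c) \<le> p"
  shows "ereal s \<le> ereal c * log_prob p"
proof -
  have "p > 0" using assms(2) by (meson exp_gt_zero less_le_trans)
  then have "s / c \<le> ln p" using assms(2) by (metis ln_exp ln_le_cancel_iff exp_gt_zero)
  then have "s \<le> c * ln p" using assms(1) by (simp add: field_simps)
  then show ?thesis using \<open>p > 0\<close> by (simp add: log_prob_def)
qed

text \<open>The lower bound is taken pointwise in the interior. The upper bound approaches the
  infimum over the closure by reals from below, which covers an infinite infimum as well; at
  negative levels the bound of a probability by 1 suffices.\<close>

theorem moderate_deviations:
  assumes "\<Gamma> \<in> sets borel"
  defines "L \<equiv> \<lambda>n. ereal (a n) * log_prob (measure (M n) {\<omega> \<in> space (M n). Z n \<omega> \<in> \<Gamma>})"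
  shows "- (INF z\<in>interior \<Gamma>. mdp_rate z) \<le> liminf L" "limsup L \<le> - (INF z\<in>closure \<Gamma>. mdp_rate z)"
proof -
  have \<Gamma>s: "{\<omega> \<in> space (M n). Z n \<omega> \<in> \<Delta>} \<in> sets (M n)" if "n \<ge> 1" "\<Delta> \<in> sets borel" for n \<Delta>
    using measurable_sets[OF Z_measurable[OF that(1)] that(2)] by (simp add: vimage_def Int_def conj_commute)
  have "- mdp_rate z \<le> liminf L" if "z \<in> interior \<Gamma>" for z
  proof (cases "mdp_rate z")
    case (real \<iota>)
    obtain \<rho> where "\<rho> > 0" "ball z \<rho> \<subseteq> \<Gamma>" using \<open>z \<in> interior \<Gamma>\<close> by (auto simp: mem_interior)
    have "ereal (- \<iota> - \<delta>) \<le> liminf L" if "\<delta> > 0" for \<delta>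
    proof (rule Liminf_bounded)
      from lower_bound[OF \<open>\<rho> > 0\<close> _ that \<open>ball z \<rho> \<subseteq> \<Gamma>\<close>, of \<iota>] \<Gamma>s[OF _ assms(1)] real
      have "\<forall>\<^sub>F n in sequentially. exp (- (\<iota> + \<delta>) / a n) \<le> measure (M n) {\<omega> \<in> space (M n). Z n \<omega> \<in> \<Gamma>}" by simp
      then show "\<forall>\<^sub>F n in sequentially. ereal (- \<iota> - \<delta>) \<le> L n"
        using eventually_a_pos
      proof eventually_elim
        case (elim n)
        then show ?case unfolding L_def by (intro log_prob_ge) simp_all
      qed
    qed
    then have "ereal (- \<iota> - \<delta>) + ereal \<delta> \<le> liminf L + ereal \<delta>" if "\<delta> > 0" for \<delta>
      using that by (intro add_right_mono)
    then have "ereal (- \<iota>) \<le> liminf L + ereal \<delta>" if "\<delta> > 0" for \<delta>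
      using that by simp
    then have "ereal (- \<iota>) \<le> liminf L" by (rule ereal_le_epsilon2[rule_format])
    then show ?thesis using real by simp
  qed (use mdp_rate_nonneg[of z] in auto)
  then have "- liminf L \<le> (INF z\<in>interior \<Gamma>. mdp_rate z)"
    by (intro INF_greatest) (simp add: ereal_uminus_le_reorder)
  then show "- (INF z\<in>interior \<Gamma>. mdp_rate z) \<le> liminf L"
    by (simp add: ereal_uminus_le_reorder)
  have "(INF z\<in>closure \<Gamma>. mdp_rate z) \<le> - limsup L"
  proof (rule dense_le)
    fix y assume y: "y < (INF z\<in>closure \<Gamma>. mdp_rate z)"
    show "y \<le> - limsup L"
    proof (cases y)
      case (real \<alpha>)
      have EB: "exp_bound (\<lambda>n. measure (M n) {\<omega> \<in> space (M n). Z n \<omega> \<in> closure \<Gamma>}) \<alpha>"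
      proof (cases "\<alpha> \<ge> 0")
        case True
        then show ?thesis
        proof (rule upper_bound[OF closed_closure])
          fix z assume "z \<in> closure \<Gamma>"
          then have "(INF z\<in>closure \<Gamma>. mdp_rate z) \<le> mdp_rate z" by (rule INF_lower)
          then show "ereal \<alpha> < mdp_rate z" using y real by (simp add: less_le_trans)
        qed
      next
        case False
        then show ?thesis using prob_le_1_eventually by (intro exp_bound_le_1) auto
      qed
      have "limsup L \<le> ereal (- \<alpha>) + ereal \<delta>" if "\<delta> > 0" for \<delta>
      proof -
        have "\<forall>\<^sub>F n in sequentially. L n \<le> ereal (\<delta> - \<alpha>)"
          using exp_boundD[OF EB \<open>\<delta> > 0\<close>] eventually_a_pos
        proof eventually_elim
          case (elim n)
          then interpret prob_space "M n" by (intro prob) simp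
          have "prob {\<omega> \<in> space (M n). Z n \<omega> \<in> \<Gamma>} \<le> prob {\<omega> \<in> space (M n). Z n \<omega> \<in> closure \<Gamma>}"
            using closure_subset[of \<Gamma>] elim \<Gamma>s[of n "closure \<Gamma>"] by (intro finite_measure_mono) auto
          then show ?case unfolding L_def using elim by (intro log_prob_le) auto
        qed
        then have "limsup L \<le> ereal (\<delta> - \<alpha>)" by (rule Limsup_bounded)
        then show ?thesis by simp
      qed
      then have "limsup L \<le> ereal (- \<alpha>)" by (rule ereal_le_epsilon2[rule_format])
      then have "- ereal (- \<alpha>) \<le> - limsup L" by (simp only: ereal_minus_le_minus)
      then show ?thesis using real by simp
    qed (use y in auto)
  qed
  then have "- (- limsup L) \<le> - (INF z\<in>closure \<Gamma>. mdp_rate z)" by (simp only: ereal_minus_le_minus)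
  then show "limsup L \<le> - (INF z\<in>closure \<Gamma>. mdp_rate z)" by simp
qed

end

section \<open>Exponential moments of truncated variables\<close>

lemma exp_second_order_bound:
  fixes u :: real
  shows "\<bar>exp u - (1 + u + u\<^sup>2 / 2)\<bar> \<le> \<bar>u\<bar> ^ 3 * exp \<bar>u\<bar>"
proof -
  obtain t where t: "\<bar>t\<bar> \<le> \<bar>u\<bar>" "exp u = (\<Sum>m<3. u ^ m / fact m) + exp t / fact 3 * u ^ 3"
    using Maclaurin_exp_le[of u 3] by blast
  have eq: "exp u - (1 + u + u\<^sup>2 / 2) = exp t / 6 * u ^ 3"
    unfolding t(2) by (simp add: numeral_3_eq_3 fact_numeral power2_eq_square)
  have "\<bar>exp u - (1 + u + u\<^sup>2 / 2)\<bar> = exp t / 6 * \<bar>u\<bar> ^ 3"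
    unfolding eq by (simp add: abs_mult power_abs)
  also have "\<dots> \<le> exp \<bar>u\<bar> * \<bar>u\<bar> ^ 3"
  proof (rule mult_right_mono)
    have "exp t \<le> exp \<bar>u\<bar>" using t(1) by simp
    then show "exp t / 6 \<le> exp \<bar>u\<bar>" using exp_ge_zero[of t] by linarith
  qed simp
  finally show ?thesis by (simp add: mult.commute)
qed

text \<open>Large values are replaced by 0 rather than by \<open>c\<close> or \<open>- c\<close>:
  the exponential then equals 1 there, and no tail probability of
  \<open>\<bar>x\<bar> \<ge> c\<close> enters the moment bounds.\<close>

definition truncate :: "real \<Rightarrow> real \<Rightarrow> real" where
  "truncate c x = (if \<bar>x\<bar> < c then x else 0)"

lemma truncate_measurable[measurable]: "truncate c \<in> borel_measurable borel"
  unfolding truncate_def by measurable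

lemma cubic_remainder_le:
  fixes x :: real
  assumes "\<bar>x\<bar> \<le> e" "e \<le> 1"
  shows "\<bar>\<theta> * x\<bar> ^ 3 * exp \<bar>\<theta> * x\<bar> \<le> \<bar>\<theta>\<bar> ^ 3 * exp \<bar>\<theta>\<bar> * e * x\<^sup>2"
proof -
  have "0 \<le> e" using assms(1) abs_ge_zero[of x] by linarith
  have "\<bar>\<theta>\<bar> * \<bar>x\<bar> \<le> \<bar>\<theta>\<bar> * 1" using assms by (intro mult_left_mono) auto
  then have "exp \<bar>\<theta> * x\<bar> \<le> exp \<bar>\<theta>\<bar>" by (simp add: abs_mult)
  moreover have "\<bar>x\<bar> ^ 3 \<le> e * x\<^sup>2"
    using assms(1) mult_right_mono[OF assms(1), of "x\<^sup>2"] by (simp add: power3_eq_cube power2_eq_square mult.assoc)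
  ultimately have "\<bar>\<theta>\<bar> ^ 3 * \<bar>x\<bar> ^ 3 * exp \<bar>\<theta> * x\<bar> \<le> \<bar>\<theta>\<bar> ^ 3 * (e * x\<^sup>2) * exp \<bar>\<theta>\<bar>"
    using \<open>0 \<le> e\<close> by (intro mult_mono mult_left_mono mult_nonneg_nonneg) auto
  then show ?thesis by (simp add: abs_mult power_mult_distrib ac_simps)
qed

text \<open>Each range of \<open>\<bar>x\<bar>\<close> has its own error term: below
  \<open>e\<close> the cubic remainder is at most a multiple of \<open>e * x\<^sup>2\<close>,
  between \<open>e\<close> and 1 it is charged to the Lindeberg term, between 1 and \<open>c\<close>
  to the exponential window, and beyond \<open>c\<close> the left side is 1. The added 1 in the
  exponent keeps the moment parameter positive.\<close>

lemma exp_truncate_le: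
  assumes "0 < e" "e \<le> 1"
  shows "exp (\<theta> * truncate c x) \<le> 1 + \<theta> * truncate c x + \<theta>\<^sup>2 / 2 * x\<^sup>2 +
    \<bar>\<theta>\<bar> ^ 3 * exp \<bar>\<theta>\<bar> * (e * x\<^sup>2 + x\<^sup>2 * indicator {x. e \<le> \<bar>x\<bar>} x) +
    exp ((\<bar>\<theta>\<bar> + 1) * \<bar>x\<bar>) * indicator {x. 1 < \<bar>x\<bar> \<and> \<bar>x\<bar> < c} x"
proof -
  define D where "D = \<bar>\<theta>\<bar> ^ 3 * exp \<bar>\<theta>\<bar>"
  have "D \<ge> 0" by (simp add: D_def)
  then have nn: "0 \<le> D * (e * x\<^sup>2 + x\<^sup>2 * indicator {x. e \<le> \<bar>x\<bar>} x)" using assms by (intro mult_nonneg_nonneg add_nonneg_nonneg) auto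
  consider "c \<le> \<bar>x\<bar>" | "\<bar>x\<bar> < c" "1 < \<bar>x\<bar>" | "\<bar>x\<bar> < c" "\<bar>x\<bar> \<le> 1" by linarith
  then have "exp (\<theta> * truncate c x) \<le> 1 + \<theta> * truncate c x + \<theta>\<^sup>2 / 2 * x\<^sup>2 +
    D * (e * x\<^sup>2 + x\<^sup>2 * indicator {x. e \<le> \<bar>x\<bar>} x) + exp ((\<bar>\<theta>\<bar> + 1) * \<bar>x\<bar>) * indicator {x. 1 < \<bar>x\<bar> \<and> \<bar>x\<bar> < c} x"
  proof cases
    case 1
    then have "truncate c x = 0" by (simp add: truncate_def)
    moreover have "0 \<le> \<theta>\<^sup>2 / 2 * x\<^sup>2" by simp
    moreover have "0 \<le> exp ((\<bar>\<theta>\<bar> + 1) * \<bar>x\<bar>) * indicator {x. 1 < \<bar>x\<bar> \<and> \<bar>x\<bar> < c} x" by simp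
    ultimately show ?thesis using nn by simp
  next
    case 2
    \<comment> \<open>The quadratic polynomial is nonnegative, so the exponential window term
      dominates alone.\<close>
    have "0 \<le> (\<theta> * x + 1)\<^sup>2" by simp
    then have sq: "0 \<le> 1 + \<theta> * x + \<theta>\<^sup>2 / 2 * x\<^sup>2"
      by (simp add: power2_eq_square algebra_simps)
    have le: "exp (\<theta> * x) \<le> exp ((\<bar>\<theta>\<bar> + 1) * \<bar>x\<bar>) * 1"
      using abs_ge_self[of "\<theta> * x"] by (simp add: abs_mult distrib_right)
    have tr: "truncate c x = x" "indicator {x. 1 < \<bar>x\<bar> \<and> \<bar>x\<bar> < c} x = (1 :: real)"
      using 2 by (simp_all add: truncate_def)
    show ?thesis unfolding tr using sq le nn by linarith
  next
    case 3
    define e' where "e' = (if e \<le> \<bar>x\<bar> then 1 else e)"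
    have "exp (\<theta> * x) \<le> 1 + \<theta> * x + (\<theta> * x)\<^sup>2 / 2 + \<bar>\<theta> * x\<bar> ^ 3 * exp \<bar>\<theta> * x\<bar>"
      using exp_second_order_bound[of "\<theta> * x"] by linarith
    also have "\<bar>\<theta> * x\<bar> ^ 3 * exp \<bar>\<theta> * x\<bar> \<le> D * e' * x\<^sup>2"
      unfolding D_def using 3 assms by (intro cubic_remainder_le) (auto simp: e'_def)
    also have "D * e' * x\<^sup>2 \<le> D * (e * x\<^sup>2 + x\<^sup>2 * indicator {x. e \<le> \<bar>x\<bar>} x)"
      unfolding mult.assoc using \<open>D \<ge> 0\<close> assms by (intro mult_left_mono) (auto simp: e'_def indicator_def)
    finally show ?thesis using 3 by (simp add: truncate_def power_mult_distrib)
  qed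
  then show ?thesis by (simp add: D_def)
qed

text \<open>Beyond \<open>e\<close> the tangent line suffices; the second-order expansion enters
  only for \<open>\<bar>x\<bar> < e\<close>, where truncation changes nothing.\<close>

lemma exp_truncate_ge:
  assumes "0 < e" "e \<le> 1" "e \<le> c"
  shows "1 + \<theta> * truncate c x + (\<theta>\<^sup>2 / 2 - \<bar>\<theta>\<bar> ^ 3 * exp \<bar>\<theta>\<bar> * e) * (x\<^sup>2 - x\<^sup>2 * indicator {x. e \<le> \<bar>x\<bar>} x) \<le> exp (\<theta> * truncate c x)"
proof (cases "e \<le> \<bar>x\<bar>")
  case True
  then show ?thesis using exp_ge_add_one_self[of "\<theta> * truncate c x"] by simp
next
  case False
  then have "truncate c x = x" using assms by (simp add: truncate_def)
  moreover have "1 + \<theta> * x + (\<theta> * x)\<^sup>2 / 2 - \<bar>\<theta> * x\<bar> ^ 3 * exp \<bar>\<theta> * x\<bar> \<le> exp (\<theta> * x)"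
    using exp_second_order_bound[of "\<theta> * x"] by linarith
  moreover have "\<bar>\<theta> * x\<bar> ^ 3 * exp \<bar>\<theta> * x\<bar> \<le> \<bar>\<theta>\<bar> ^ 3 * exp \<bar>\<theta>\<bar> * e * x\<^sup>2"
    using False assms by (intro cubic_remainder_le) auto
  ultimately show ?thesis using False by (simp add: power_mult_distrib algebra_simps)
qed

context prob_space
begin

context
  fixes Y :: "'a \<Rightarrow> real" and c e :: real
  assumes Y[measurable]: "Y \<in> borel_measurable M" and sq: "integrable M (\<lambda>\<omega>. (Y \<omega>)\<^sup>2)"
    and e: "0 < e" "e \<le> 1" and c: "1 \<le> c"
begin

lemma truncate_le: "\<bar>truncate c x\<bar> \<le> c"
  using c by (auto simp: truncate_def)

lemma integrable_truncate: "integrable M (\<lambda>\<omega>. truncate c (Y \<omega>))"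
  using truncate_le by (intro bounded_random_variable_integrable) auto

lemma integrable_exp_truncate: "integrable M (\<lambda>\<omega>. exp (\<theta> * truncate c (Y \<omega>)))"
  using truncate_le by (intro exp_bounded_integrable) auto

lemma integrable_large_square: "integrable M (\<lambda>\<omega>. (Y \<omega>)\<^sup>2 * indicator {x. e \<le> \<bar>x\<bar>} (Y \<omega>))"
  by (rule Bochner_Integration.integrable_bound[OF sq]) (auto simp: indicator_def)

lemma integrable_exp_window: "integrable M (\<lambda>\<omega>. exp (b * \<bar>Y \<omega>\<bar>) * indicator {x. 1 < \<bar>x\<bar> \<and> \<bar>x\<bar> < c} (Y \<omega>))"
proof (rule bounded_random_variable_integrable)
  show "\<bar>exp (b * \<bar>Y \<omega>\<bar>) * indicator {x. 1 < \<bar>x\<bar> \<and> \<bar>x\<bar> < c} (Y \<omega>)\<bar> \<le> exp (\<bar>b\<bar> * c)" for \<omega>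
  proof (cases "\<bar>Y \<omega>\<bar> < c")
    case True
    have "b * \<bar>Y \<omega>\<bar> \<le> \<bar>b\<bar> * \<bar>Y \<omega>\<bar>" by (intro mult_right_mono) auto
    also have "\<dots> \<le> \<bar>b\<bar> * c" using True by (intro mult_left_mono) auto
    finally show ?thesis by (auto simp: indicator_def)
  qed simp
qed measurable

lemma expectation_exp_truncate_le:
  "expectation (\<lambda>\<omega>. exp (\<theta> * truncate c (Y \<omega>))) \<le> 1 + \<theta> * expectation (\<lambda>\<omega>. truncate c (Y \<omega>)) +
    \<theta>\<^sup>2 / 2 * expectation (\<lambda>\<omega>. (Y \<omega>)\<^sup>2) +
    \<bar>\<theta>\<bar> ^ 3 * exp \<bar>\<theta>\<bar> * (e * expectation (\<lambda>\<omega>. (Y \<omega>)\<^sup>2) + expectation (\<lambda>\<omega>. (Y \<omega>)\<^sup>2 * indicator {x. e \<le> \<bar>x\<bar>} (Y \<omega>))) +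
    expectation (\<lambda>\<omega>. exp ((\<bar>\<theta>\<bar> + 1) * \<bar>Y \<omega>\<bar>) * indicator {x. 1 < \<bar>x\<bar> \<and> \<bar>x\<bar> < c} (Y \<omega>))"
proof -
  note [simp] = integrable_truncate integrable_large_square integrable_exp_window sq prob_space
  have "expectation (\<lambda>\<omega>. exp (\<theta> * truncate c (Y \<omega>))) \<le>
    expectation (\<lambda>\<omega>. 1 + \<theta> * truncate c (Y \<omega>) + \<theta>\<^sup>2 / 2 * (Y \<omega>)\<^sup>2 +
      \<bar>\<theta>\<bar> ^ 3 * exp \<bar>\<theta>\<bar> * (e * (Y \<omega>)\<^sup>2 + (Y \<omega>)\<^sup>2 * indicator {x. e \<le> \<bar>x\<bar>} (Y \<omega>)) +
      exp ((\<bar>\<theta>\<bar> + 1) * \<bar>Y \<omega>\<bar>) * indicator {x. 1 < \<bar>x\<bar> \<and> \<bar>x\<bar> < c} (Y \<omega>))"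
    by (intro integral_mono integrable_exp_truncate exp_truncate_le e Bochner_Integration.integrable_add integrable_mult_right) simp_all
  also have "\<dots> = 1 + \<theta> * expectation (\<lambda>\<omega>. truncate c (Y \<omega>)) +
    \<theta>\<^sup>2 / 2 * expectation (\<lambda>\<omega>. (Y \<omega>)\<^sup>2) +
    \<bar>\<theta>\<bar> ^ 3 * exp \<bar>\<theta>\<bar> * (e * expectation (\<lambda>\<omega>. (Y \<omega>)\<^sup>2) + expectation (\<lambda>\<omega>. (Y \<omega>)\<^sup>2 * indicator {x. e \<le> \<bar>x\<bar>} (Y \<omega>))) +
    expectation (\<lambda>\<omega>. exp ((\<bar>\<theta>\<bar> + 1) * \<bar>Y \<omega>\<bar>) * indicator {x. 1 < \<bar>x\<bar> \<and> \<bar>x\<bar> < c} (Y \<omega>))"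
    by (simp add: Bochner_Integration.integral_add)
  finally show ?thesis .
qed

lemma expectation_exp_truncate_ge:
  "1 + \<theta> * expectation (\<lambda>\<omega>. truncate c (Y \<omega>)) + (\<theta>\<^sup>2 / 2 - \<bar>\<theta>\<bar> ^ 3 * exp \<bar>\<theta>\<bar> * e) *
    (expectation (\<lambda>\<omega>. (Y \<omega>)\<^sup>2) - expectation (\<lambda>\<omega>. (Y \<omega>)\<^sup>2 * indicator {x. e \<le> \<bar>x\<bar>} (Y \<omega>))) \<le>
    expectation (\<lambda>\<omega>. exp (\<theta> * truncate c (Y \<omega>)))"
proof -
  note [simp] = integrable_truncate integrable_large_square sq prob_space
  have "expectation (\<lambda>\<omega>. 1 + \<theta> * truncate c (Y \<omega>) + (\<theta>\<^sup>2 / 2 - \<bar>\<theta>\<bar> ^ 3 * exp \<bar>\<theta>\<bar> * e) *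
      ((Y \<omega>)\<^sup>2 - (Y \<omega>)\<^sup>2 * indicator {x. e \<le> \<bar>x\<bar>} (Y \<omega>))) \<le> expectation (\<lambda>\<omega>. exp (\<theta> * truncate c (Y \<omega>)))"
    using e c
    by (intro integral_mono integrable_exp_truncate exp_truncate_ge Bochner_Integration.integrable_add
        integrable_mult_right Bochner_Integration.integrable_diff) simp_all
  also have "expectation (\<lambda>\<omega>. 1 + \<theta> * truncate c (Y \<omega>) + (\<theta>\<^sup>2 / 2 - \<bar>\<theta>\<bar> ^ 3 * exp \<bar>\<theta>\<bar> * e) *
      ((Y \<omega>)\<^sup>2 - (Y \<omega>)\<^sup>2 * indicator {x. e \<le> \<bar>x\<bar>} (Y \<omega>))) =
    1 + \<theta> * expectation (\<lambda>\<omega>. truncate c (Y \<omega>)) + (\<theta>\<^sup>2 / 2 - \<bar>\<theta>\<bar> ^ 3 * exp \<bar>\<theta>\<bar> * e) *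
    (expectation (\<lambda>\<omega>. (Y \<omega>)\<^sup>2) - expectation (\<lambda>\<omega>. (Y \<omega>)\<^sup>2 * indicator {x. e \<le> \<bar>x\<bar>} (Y \<omega>)))"
    by (simp add: Bochner_Integration.integral_add Bochner_Integration.integral_diff)
  finally show ?thesis .
qed

text \<open>By centring, the truncated mean is minus the mean of the removed part, on which
  \<open>\<bar>Y\<bar> \<le> Y\<^sup>2 / c\<close>. With \<open>c = 1 / a n\<close> this makes the
  drift of a whole row negligible.\<close>

lemma expectation_truncate_le:
  assumes "expectation Y = 0"
  shows "\<bar>expectation (\<lambda>\<omega>. truncate c (Y \<omega>))\<bar> \<le> expectation (\<lambda>\<omega>. (Y \<omega>)\<^sup>2 * indicator {x. e \<le> \<bar>x\<bar>} (Y \<omega>)) / c"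
proof -
  have int: "integrable M Y" using sq by (rule square_integrable_imp_integrable[OF Y])
  have "expectation (\<lambda>\<omega>. truncate c (Y \<omega>)) = expectation (\<lambda>\<omega>. truncate c (Y \<omega>) - Y \<omega>)"
    using integrable_truncate int assms by simp
  also have "\<bar>\<dots>\<bar> \<le> expectation (\<lambda>\<omega>. \<bar>truncate c (Y \<omega>) - Y \<omega>\<bar>)" by (rule integral_abs_bound)
  also have "\<dots> \<le> expectation (\<lambda>\<omega>. (Y \<omega>)\<^sup>2 * indicator {x. e \<le> \<bar>x\<bar>} (Y \<omega>) / c)"
  proof (rule integral_mono)
    fix \<omega>
    show "\<bar>truncate c (Y \<omega>) - Y \<omega>\<bar> \<le> (Y \<omega>)\<^sup>2 * indicator {x. e \<le> \<bar>x\<bar>} (Y \<omega>) / c"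
    proof (cases "\<bar>Y \<omega>\<bar> < c")
      case False
      then have "\<bar>Y \<omega>\<bar> * c \<le> \<bar>Y \<omega>\<bar> * \<bar>Y \<omega>\<bar>" by (intro mult_left_mono) auto
      then have "\<bar>Y \<omega>\<bar> \<le> (Y \<omega>)\<^sup>2 / c" using c by (simp add: pos_le_divide_eq power2_eq_square)
      then show ?thesis using False c e by (simp add: truncate_def)
    qed (use c in \<open>simp add: truncate_def\<close>)
  qed (use integrable_truncate int integrable_large_square in auto)
  also have "\<dots> = expectation (\<lambda>\<omega>. (Y \<omega>)\<^sup>2 * indicator {x. e \<le> \<bar>x\<bar>} (Y \<omega>)) / c" by simp
  finally show ?thesis .
qed

text \<open>The difference is the second moment below level \<open>e\<close>. Its bound
  \<open>e\<^sup>2\<close> keeps every single summand of a row small, which the expansion of the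
  logarithm requires.\<close>

lemma expectation_small_square:
  "expectation (\<lambda>\<omega>. (Y \<omega>)\<^sup>2) - expectation (\<lambda>\<omega>. (Y \<omega>)\<^sup>2 * indicator {x. e \<le> \<bar>x\<bar>} (Y \<omega>)) \<in> {0..e\<^sup>2}"
proof -
  have eq: "expectation (\<lambda>\<omega>. (Y \<omega>)\<^sup>2) - expectation (\<lambda>\<omega>. (Y \<omega>)\<^sup>2 * indicator {x. e \<le> \<bar>x\<bar>} (Y \<omega>)) =
      expectation (\<lambda>\<omega>. (Y \<omega>)\<^sup>2 - (Y \<omega>)\<^sup>2 * indicator {x. e \<le> \<bar>x\<bar>} (Y \<omega>))"
    using integrable_large_square sq by simp
  have b: "0 \<le> (Y \<omega>)\<^sup>2 - (Y \<omega>)\<^sup>2 * indicator {x. e \<le> \<bar>x\<bar>} (Y \<omega>)"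
    "(Y \<omega>)\<^sup>2 - (Y \<omega>)\<^sup>2 * indicator {x. e \<le> \<bar>x\<bar>} (Y \<omega>) \<le> e\<^sup>2" for \<omega>
    using e by (auto simp: indicator_def not_le power2_le_iff_abs_le)
  have "expectation (\<lambda>\<omega>. (Y \<omega>)\<^sup>2 - (Y \<omega>)\<^sup>2 * indicator {x. e \<le> \<bar>x\<bar>} (Y \<omega>)) \<le> expectation (\<lambda>\<omega>. e\<^sup>2)"
    using b integrable_large_square sq by (intro integral_mono) auto
  then show ?thesis unfolding eq using b(1) by (simp add: prob_space)
qed

end

end

text \<open>Summation over a row: the second-order terms give \<open>\<theta>\<^sup>2 / 2\<close> times the variance, all other terms are controlled by
  the two vanishing quantities \<open>a * sum q\<close> (Lindeberg) and \<open>a * sum r\<close> (exponential moments).\<close>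

lemma log_mgf_row_bound:
  fixes E \<sigma> q r \<mu> :: "'i \<Rightarrow> real" and \<theta> a D e :: real
  assumes J: "finite J" "B \<subseteq> J" and a: "0 < a" "a \<le> 1" and "D \<ge> 0" "e > 0"
    and up: "\<And>j. j \<in> J \<Longrightarrow> E j \<le> 1 + \<theta> * \<mu> j + \<theta>\<^sup>2 / 2 * \<sigma> j + D * (e * \<sigma> j + q j) + r j"
    and lo: "\<And>j. j \<in> J \<Longrightarrow> 1 + \<theta> * \<mu> j + (\<theta>\<^sup>2 / 2 - D * e) * (\<sigma> j - q j) \<le> E j"
    and \<mu>: "\<And>j. j \<in> J \<Longrightarrow> \<bar>\<mu> j\<bar> \<le> a * q j"
    and \<sigma>q: "\<And>j. j \<in> J \<Longrightarrow> \<sigma> j - q j \<in> {0..e\<^sup>2}"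
    and q0: "\<And>j. j \<in> J \<Longrightarrow> q j \<ge> 0" and r0: "\<And>j. j \<in> J \<Longrightarrow> r j \<ge> 0"
    and total: "a * (\<Sum>j\<in>J. \<sigma> j) \<le> 1"
    and Q: "a * (\<Sum>j\<in>J. q j) \<le> Q" and R: "a * (\<Sum>j\<in>J. r j) \<le> R"
    and De: "D * e \<le> \<theta>\<^sup>2 / 2" and \<rho>: "\<bar>\<theta>\<bar> * Q + \<theta>\<^sup>2 / 2 * e\<^sup>2 \<le> \<rho>" "\<rho> \<le> 1 / 2"
  shows "\<bar>a * (\<Sum>j\<in>B. ln (E j)) - \<theta>\<^sup>2 / 2 * (\<Sum>j\<in>B. a * \<sigma> j)\<bar> \<le>
    (\<bar>\<theta>\<bar> + D + \<theta>\<^sup>2 / 2) * Q + D * e + R + 2 * \<rho> * (\<bar>\<theta>\<bar> * Q + \<theta>\<^sup>2 / 2)"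
proof -
  have finB: "finite B" using J by (rule rev_finite_subset)
  \<comment> \<open>\<open>1 + p j\<close> is the lower bound \<open>lo\<close> for
    \<open>E j\<close>; it stays within \<rho> of 1 uniformly in \<open>j\<close>.\<close>
  define p where "p j = \<theta> * \<mu> j + (\<theta>\<^sup>2 / 2 - D * e) * (\<sigma> j - q j)" for j
  have aq: "a * q j \<le> Q" if "j \<in> J" for j
  proof -
    have "q j \<le> (\<Sum>j\<in>J. q j)" using that J q0 by (intro member_le_sum) auto
    then have "a * q j \<le> a * (\<Sum>j\<in>J. q j)" using a by (intro mult_left_mono) auto
    then show ?thesis using Q by linarith
  qed
  have \<theta>\<mu>: "\<bar>\<theta> * \<mu> j\<bar> \<le> \<bar>\<theta>\<bar> * (a * q j)" if "j \<in> J" for j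
    unfolding abs_mult using \<mu>[OF that] by (intro mult_left_mono) auto
  have \<sigma>0: "\<sigma> j \<ge> 0" if "j \<in> J" for j using \<sigma>q[OF that] q0[OF that] by simp
  have sumB: "a * (\<Sum>j\<in>B. g j) \<le> a * (\<Sum>j\<in>J. g j)" if "\<And>j. j \<in> J \<Longrightarrow> g j \<ge> 0" for g :: "'i \<Rightarrow> real"
    using J that a by (intro mult_left_mono sum_mono2) auto
  have QB: "a * (\<Sum>j\<in>B. q j) \<le> Q" and RB: "a * (\<Sum>j\<in>B. r j) \<le> R" and \<sigma>B: "a * (\<Sum>j\<in>B. \<sigma> j) \<le> 1"
    using sumB[of q] sumB[of r] sumB[of \<sigma>] q0 r0 \<sigma>0 Q R total by fastforce+
  have "0 \<le> a * (\<Sum>j\<in>J. q j)" using q0 a by (intro mult_nonneg_nonneg sum_nonneg) auto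
  then have "0 \<le> Q" using Q by linarith
  have qB0: "0 \<le> a * (\<Sum>j\<in>B. q j)" using q0 a J by (intro mult_nonneg_nonneg sum_nonneg) auto
  have "0 \<le> \<bar>\<theta>\<bar> * Q + \<theta>\<^sup>2 / 2 * e\<^sup>2" using \<open>0 \<le> Q\<close> by (intro add_nonneg_nonneg mult_nonneg_nonneg) auto
  then have "0 \<le> \<rho>" using \<rho>(1) by linarith
  have p_abs: "\<bar>p j\<bar> \<le> \<bar>\<theta>\<bar> * (a * q j) + \<theta>\<^sup>2 / 2 * (\<sigma> j - q j)" if "j \<in> J" for j
  proof -
    have "0 \<le> (\<theta>\<^sup>2 / 2 - D * e) * (\<sigma> j - q j)" using De \<sigma>q[OF that] by (intro mult_nonneg_nonneg) auto
    moreover have "(\<theta>\<^sup>2 / 2 - D * e) * (\<sigma> j - q j) \<le> \<theta>\<^sup>2 / 2 * (\<sigma> j - q j)"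
      using \<sigma>q[OF that] \<open>D \<ge> 0\<close> \<open>e > 0\<close> by (intro mult_right_mono) auto
    ultimately show ?thesis using \<theta>\<mu>[OF that] unfolding p_def by linarith
  qed
  have p_\<rho>: "\<bar>p j\<bar> \<le> \<rho>" if "j \<in> J" for j
  proof -
    have "\<bar>\<theta>\<bar> * (a * q j) \<le> \<bar>\<theta>\<bar> * Q" using aq[OF that] by (intro mult_left_mono) auto
    moreover have "\<theta>\<^sup>2 / 2 * (\<sigma> j - q j) \<le> \<theta>\<^sup>2 / 2 * e\<^sup>2" using \<sigma>q[OF that] by (intro mult_left_mono) auto
    ultimately show ?thesis using p_abs[OF that] \<rho>(1) by linarith
  qed
  have Epos: "1 + p j \<le> E j" "1 + p j > 0" if "j \<in> J" for j
    using lo[OF that] p_\<rho>[OF that] \<rho>(2) unfolding p_def by (simp, linarith)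
  have ln_up: "ln (E j) \<le> \<bar>\<theta>\<bar> * (a * q j) + \<theta>\<^sup>2 / 2 * \<sigma> j + D * (e * \<sigma> j + q j) + r j" if "j \<in> J" for j
  proof -
    have "ln (E j) \<le> E j - 1" using Epos[OF that] by (intro ln_le_minus_one) linarith
    then show ?thesis using up[OF that] \<theta>\<mu>[OF that] by linarith
  qed
  \<comment> \<open>The quadratic error of the logarithm is a uniformly small factor times
    \<open>\<bar>p j\<bar>\<close>, whose sum over the row, multiplied by \<open>a\<close>, is
    bounded.\<close>
  have ln_lo: "p j - 2 * \<rho> * \<bar>p j\<bar> \<le> ln (E j)" if "j \<in> J" for j
  proof -
    have "\<bar>ln (1 + p j) - p j\<bar> \<le> 2 * (p j)\<^sup>2"
      using p_\<rho>[OF that] \<rho>(2) by (intro abs_ln_one_plus_x_minus_x_bound) linarith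
    moreover have "(p j)\<^sup>2 \<le> \<rho> * \<bar>p j\<bar>"
      using mult_right_mono[OF p_\<rho>[OF that], of "\<bar>p j\<bar>"] by (simp add: power2_eq_square)
    moreover have "ln (1 + p j) \<le> ln (E j)" using Epos[OF that] by simp
    ultimately show ?thesis by linarith
  qed
  have "a * (\<Sum>j\<in>B. ln (E j)) \<le> a * (\<Sum>j\<in>B. \<bar>\<theta>\<bar> * (a * q j) + \<theta>\<^sup>2 / 2 * \<sigma> j + D * (e * \<sigma> j + q j) + r j)"
    using ln_up J a by (intro mult_left_mono sum_mono) auto
  also have "\<dots> = \<bar>\<theta>\<bar> * (a * (a * (\<Sum>j\<in>B. q j))) + \<theta>\<^sup>2 / 2 * (\<Sum>j\<in>B. a * \<sigma> j) +
      D * e * (a * (\<Sum>j\<in>B. \<sigma> j)) + D * (a * (\<Sum>j\<in>B. q j)) + a * (\<Sum>j\<in>B. r j)"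
  proof -
    have "a * (\<Sum>j\<in>B. \<bar>\<theta>\<bar> * (a * q j) + K * \<sigma> j + D * (e * \<sigma> j + q j) + r j) =
      \<bar>\<theta>\<bar> * (a * (a * (\<Sum>j\<in>B. q j))) + K * (\<Sum>j\<in>B. a * \<sigma> j) +
      D * e * (a * (\<Sum>j\<in>B. \<sigma> j)) + D * (a * (\<Sum>j\<in>B. q j)) + a * (\<Sum>j\<in>B. r j)" for K
      by (simp add: sum.distrib sum_distrib_left[symmetric] algebra_simps)
    then show ?thesis .
  qed
  also have "\<dots> \<le> \<bar>\<theta>\<bar> * (1 * Q) + \<theta>\<^sup>2 / 2 * (\<Sum>j\<in>B. a * \<sigma> j) + D * e * 1 + D * Q + R"
    using QB RB \<sigma>B \<open>D \<ge> 0\<close> \<open>e > 0\<close> a qB0 by (intro add_mono mult_left_mono mult_mono order_refl) auto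
  finally have upper: "a * (\<Sum>j\<in>B. ln (E j)) \<le> \<theta>\<^sup>2 / 2 * (\<Sum>j\<in>B. a * \<sigma> j) + \<bar>\<theta>\<bar> * Q + D * e + D * Q + R" by simp
  have "a * (\<Sum>j\<in>B. \<bar>p j\<bar>) \<le> a * (\<Sum>j\<in>B. \<bar>\<theta>\<bar> * (a * q j) + \<theta>\<^sup>2 / 2 * \<sigma> j)"
  proof (intro mult_left_mono sum_mono)
    fix j assume "j \<in> B"
    then have "j \<in> J" using J by blast
    have "\<theta>\<^sup>2 / 2 * (\<sigma> j - q j) \<le> \<theta>\<^sup>2 / 2 * \<sigma> j" using q0[OF \<open>j \<in> J\<close>] by (intro mult_left_mono) auto
    then show "\<bar>p j\<bar> \<le> \<bar>\<theta>\<bar> * (a * q j) + \<theta>\<^sup>2 / 2 * \<sigma> j" using p_abs[OF \<open>j \<in> J\<close>] by linarith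
  qed (use a in simp)
  also have "\<dots> = \<bar>\<theta>\<bar> * (a * (a * (\<Sum>j\<in>B. q j))) + \<theta>\<^sup>2 / 2 * (a * (\<Sum>j\<in>B. \<sigma> j))"
  proof -
    have "a * (\<Sum>j\<in>B. \<bar>\<theta>\<bar> * (a * q j) + K * \<sigma> j) = \<bar>\<theta>\<bar> * (a * (a * (\<Sum>j\<in>B. q j))) + K * (a * (\<Sum>j\<in>B. \<sigma> j))" for K
      by (simp add: sum.distrib sum_distrib_left[symmetric] algebra_simps)
    then show ?thesis .
  qed
  also have "\<dots> \<le> \<bar>\<theta>\<bar> * (1 * Q) + \<theta>\<^sup>2 / 2 * 1"
    using QB \<sigma>B a qB0 by (intro add_mono mult_left_mono mult_mono) auto
  finally have "2 * \<rho> * (a * (\<Sum>j\<in>B. \<bar>p j\<bar>)) \<le> 2 * \<rho> * (\<bar>\<theta>\<bar> * Q + \<theta>\<^sup>2 / 2)"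
    using \<open>0 \<le> \<rho>\<close> by (intro mult_left_mono) auto
  moreover have "a * (\<Sum>j\<in>B. p j - 2 * \<rho> * \<bar>p j\<bar>) \<le> a * (\<Sum>j\<in>B. ln (E j))"
    using ln_lo J a by (intro mult_left_mono sum_mono) auto
  moreover have "a * (\<Sum>j\<in>B. p j - 2 * \<rho> * \<bar>p j\<bar>) = a * (\<Sum>j\<in>B. p j) - 2 * \<rho> * (a * (\<Sum>j\<in>B. \<bar>p j\<bar>))"
    by (simp add: sum_subtractf sum_distrib_left mult.assoc mult.left_commute right_diff_distrib)
  moreover have "a * (\<Sum>j\<in>B. - (\<bar>\<theta>\<bar> * (a * q j)) + (\<theta>\<^sup>2 / 2 - D * e) * (\<sigma> j - q j)) \<le> a * (\<Sum>j\<in>B. p j)"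
  proof (intro mult_left_mono sum_mono)
    fix j assume "j \<in> B"
    then have "j \<in> J" using J by blast
    then show "- (\<bar>\<theta>\<bar> * (a * q j)) + (\<theta>\<^sup>2 / 2 - D * e) * (\<sigma> j - q j) \<le> p j"
      using \<theta>\<mu>[OF \<open>j \<in> J\<close>] unfolding p_def by linarith
  qed (use a in simp)
  moreover have "a * (\<Sum>j\<in>B. - (\<bar>\<theta>\<bar> * (a * q j)) + (\<theta>\<^sup>2 / 2 - D * e) * (\<sigma> j - q j)) =
      - (\<bar>\<theta>\<bar> * (a * (a * (\<Sum>j\<in>B. q j)))) + (\<theta>\<^sup>2 / 2 * (\<Sum>j\<in>B. a * \<sigma> j) - D * e * (a * (\<Sum>j\<in>B. \<sigma> j))) -
      (\<theta>\<^sup>2 / 2 - D * e) * (a * (\<Sum>j\<in>B. q j))"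
  proof -
    have "a * (\<Sum>j\<in>B. - (\<bar>\<theta>\<bar> * (a * q j)) + (K - D * e) * (\<sigma> j - q j)) =
      - (\<bar>\<theta>\<bar> * (a * (a * (\<Sum>j\<in>B. q j)))) + (K * (\<Sum>j\<in>B. a * \<sigma> j) - D * e * (a * (\<Sum>j\<in>B. \<sigma> j))) -
      (K - D * e) * (a * (\<Sum>j\<in>B. q j))" for K
      by (simp add: sum.distrib sum_subtractf sum_negf sum_distrib_left[symmetric] algebra_simps)
    then show ?thesis .
  qed
  moreover have "\<bar>\<theta>\<bar> * (a * (a * (\<Sum>j\<in>B. q j))) \<le> \<bar>\<theta>\<bar> * (1 * Q)"
    using QB a qB0 by (intro mult_left_mono mult_mono) auto
  moreover have "D * e * (a * (\<Sum>j\<in>B. \<sigma> j)) \<le> D * e * 1"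
    using \<sigma>B \<open>D \<ge> 0\<close> \<open>e > 0\<close> by (intro mult_left_mono) auto
  moreover have "(\<theta>\<^sup>2 / 2 - D * e) * (a * (\<Sum>j\<in>B. q j)) \<le> \<theta>\<^sup>2 / 2 * Q"
    using QB qB0 De \<open>D \<ge> 0\<close> \<open>e > 0\<close> by (intro mult_mono) auto
  ultimately have lower: "\<theta>\<^sup>2 / 2 * (\<Sum>j\<in>B. a * \<sigma> j) - \<bar>\<theta>\<bar> * Q - D * e - \<theta>\<^sup>2 / 2 * Q - 2 * \<rho> * (\<bar>\<theta>\<bar> * Q + \<theta>\<^sup>2 / 2) \<le> a * (\<Sum>j\<in>B. ln (E j))"
    by linarith
  have "0 \<le> a * (\<Sum>j\<in>J. r j)" using r0 a by (intro mult_nonneg_nonneg sum_nonneg) auto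
  then have "R \<ge> 0" using R by linarith
  have "0 \<le> D * Q" "0 \<le> \<theta>\<^sup>2 / 2 * Q" "0 \<le> 2 * \<rho> * (\<bar>\<theta>\<bar> * Q + \<theta>\<^sup>2 / 2)"
    using \<open>0 \<le> Q\<close> \<open>0 \<le> \<rho>\<close> \<open>D \<ge> 0\<close> by (intro mult_nonneg_nonneg add_nonneg_nonneg; simp)+
  then show ?thesis
    using upper lower \<open>R \<ge> 0\<close> unfolding distrib_right[of "\<bar>\<theta>\<bar> + D"] distrib_right[of "\<bar>\<theta>\<bar>" D]
    by (intro abs_leI) linarith+
qed

section \<open>The partial sum process\<close>

lemma apply_cadlag_sum: "apply_cadlag (\<Sum>i\<in>A. f i) t = (\<Sum>i\<in>A. apply_cadlag (f i) t)"
  by (induction A rule: infinite_finite_induct) (auto simp: zero_cadlag.rep_eq plus_cadlag.rep_eq)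

text \<open>Measurability is not automatic because \<open>D[0,1]\<close> with the uniform topology is not second countable: the process
  is factored through a continuous linear map defined on real sequences.\<close>

lemma partial_sum_process_measurable:
  assumes X: "\<And>j. j \<in> {1..k} \<Longrightarrow> X j \<in> borel_measurable M"
  shows "partial_sum_process M X k \<in> borel_measurable M"
proof -
  define v where "v i = var_sum M X i / var_sum M X k" for i
  have v: "0 \<le> v i" "i \<le> k \<Longrightarrow> v i \<le> 1" for i
    using var_sum_ratio_le_1[of i k M X] by (auto simp: v_def var_sum_nonneg)
  \<comment> \<open>Slot 0 carries the value at time 1, slot \<open>i\<close> the
    \<open>i\<close>-th interval.\<close>
  define E where "E i = (if i = 0 then Cadlag (indicator {1}) else Cadlag (indicator {v (i - 1)..<v i}))" for i
  define c where "c \<omega> i = (if i = 0 then partial_sum X k \<omega> / sd_sum M X k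
    else if i \<le> k then partial_sum X (i - 1) \<omega> / sd_sum M X k else 0)" for \<omega> i
  define \<Phi> where "\<Phi> x = (\<Sum>i\<le>k. x i *\<^sub>R E i)" for x
  have E0: "apply_cadlag (E 0) = indicator {1}"
  proof -
    have "(\<lambda>_. 0)(1 := 1) = (indicator {1} :: real \<Rightarrow> real)" by (auto simp: indicator_def)
    moreover have "is_cadlag (\<lambda>_. 0)" by (auto simp: is_cadlag_def)
    ultimately have "is_cadlag (indicator {1})" using is_cadlag_upd_1[of "\<lambda>_. 0" 1] by simp
    then show ?thesis unfolding E_def by (auto intro!: Cadlag_inverse simp: indicator_def)
  qed
  have Ei: "apply_cadlag (E i) = indicator {v (i - 1)..<v i}" if "i \<in> {1..k}" for i
  proof -
    have "indicator {v (i - 1)..<v i} t = (0 :: real)" if "t \<notin> {0..1}" for t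
      using v(1)[of "i - 1"] v(2)[of i] that \<open>i \<in> {1..k}\<close> by (auto simp: indicator_def)
    then show ?thesis using that unfolding E_def by (auto intro!: Cadlag_inverse is_cadlag_indicator)
  qed
  have "partial_sum_process M X k \<omega> = \<Phi> (c \<omega>)" for \<omega>
  proof (rule cadlag_eqI)
    fix t :: real assume "t \<in> {0..1}"
    have "apply_cadlag (\<Phi> (c \<omega>)) t = (\<Sum>i\<in>{0..k}. c \<omega> i * apply_cadlag (E i) t)"
      by (simp add: \<Phi>_def apply_cadlag_sum scaleR_cadlag.rep_eq atMost_atLeast0)
    also have "\<dots> = c \<omega> 0 * indicator {1} t + (\<Sum>i\<in>{1..k}. c \<omega> i * apply_cadlag (E i) t)"
      by (simp add: sum.atLeast_Suc_atMost E0)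
    also have "(\<Sum>i\<in>{1..k}. c \<omega> i * apply_cadlag (E i) t) =
        (\<Sum>i\<in>{1..k}. partial_sum X (i - 1) \<omega> / sd_sum M X k * indicator {v (i - 1)..<v i} t)"
      by (intro sum.cong refl) (simp add: Ei c_def)
    also have "c \<omega> 0 * indicator {1} t + (\<Sum>i\<in>{1..k}. partial_sum X (i - 1) \<omega> / sd_sum M X k * indicator {v (i - 1)..<v i} t) =
        apply_cadlag (partial_sum_process M X k \<omega>) t"
    proof (cases "t = 1")
      case True
      have "(\<Sum>i\<in>{1..k}. partial_sum X (i - 1) \<omega> / sd_sum M X k * indicator {v (i - 1)..<v i} 1) = 0"
        using v(2) by (intro sum.neutral) (auto simp: indicator_def not_less)
      then show ?thesis using True by (simp add: partial_sum_process_1 c_def)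
    next
      case False
      then show ?thesis by (simp add: partial_sum_process.rep_eq v_def)
    qed
    finally show "apply_cadlag (partial_sum_process M X k \<omega>) t = apply_cadlag (\<Phi> (c \<omega>)) t" ..
  qed
  moreover have "\<Phi> \<in> borel_measurable borel"
    unfolding \<Phi>_def by (intro borel_measurable_continuous_onI continuous_intros continuous_on_product_coordinates)
  \<comment> \<open>On real sequences with the product topology measurability can be checked
    coordinatewise.\<close>
  moreover have "c \<in> borel_measurable M"
  proof (rule measurable_coordinatewise_then_product)
    have ps: "partial_sum X l \<in> borel_measurable M" if "l \<le> k" for l
      unfolding partial_sum_def using that by (intro borel_measurable_sum X) auto
    fix i
    consider "i = 0" | "i \<noteq> 0" "i \<le> k" | "i \<noteq> 0" "k < i" by linarith
    then show "(\<lambda>\<omega>. c \<omega> i) \<in> borel_measurable M"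
      by cases (auto simp: c_def intro!: borel_measurable_divide ps)
  qed
  ultimately show ?thesis
    using measurable_compose[of c M borel \<Phi> borel] by (simp cong: measurable_cong)
qed

text \<open>On the \<open>i\<close>-th interval of the process this number is \<open>i - 1\<close>;
  summands of variance 0 are counted along with their predecessors. Counting avoids a maximum over a
  possibly empty set.\<close>

definition clock :: "'a measure \<Rightarrow> (nat \<Rightarrow> 'a \<Rightarrow> real) \<Rightarrow> nat \<Rightarrow> real \<Rightarrow> nat" where
  "clock M X k t = card {l \<in> {1..k}. var_sum M X l \<le> t * var_sum M X k}"

lemma clock_le: "clock M X k t \<le> k"
proof -
  have "clock M X k t \<le> card {1..k}" unfolding clock_def by (intro card_mono) auto
  then show ?thesis by simp
qed

lemma clock_mono: "s \<le> t \<Longrightarrow> clock M X k s \<le> clock M X k t"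
  unfolding clock_def
  by (intro card_mono) (auto intro: order_trans mult_right_mono[OF _ var_sum_nonneg])

lemma clock_set: "{l \<in> {1..k}. var_sum M X l \<le> t * var_sum M X k} = {1..clock M X k t}" (is "?A = _")
proof (cases "?A = {}")
  case True
  have "clock M X k t = 0" unfolding clock_def True by simp
  then show ?thesis using True by simp
next
  case False
  define m where "m = Max ?A"
  have fin: "finite ?A" by simp
  have m: "m \<in> ?A" unfolding m_def using fin False by (rule Max_in)
  have "?A = {1..m}"
  proof (intro equalityI subsetI)
    fix l assume "l \<in> ?A"
    then show "l \<in> {1..m}" using Max_ge[OF fin, of l] by (auto simp: m_def)
  next
    fix l assume "l \<in> {1..m}"
    then show "l \<in> ?A" using m var_sum_mono[of l m M X] by auto
  qed
  then show ?thesis unfolding clock_def by simp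
qed

lemma partial_sum_process_clock:
  assumes pos: "var_sum M X k > 0" and t: "t \<in> {0..1}"
  shows "apply_cadlag (partial_sum_process M X k \<omega>) t = partial_sum X (clock M X k t) \<omega> / sd_sum M X k"
proof (cases "t = 1")
  case True
  have "{l \<in> {1..k}. var_sum M X l \<le> t * var_sum M X k} = {1..k}"
    using True var_sum_mono[of _ k M X] by auto
  then have "clock M X k t = k" unfolding clock_def by simp
  then show ?thesis using True by (simp add: partial_sum_process_1)
next
  case False
  then obtain i where i: "1 \<le> i" "i \<le> k"
    "t \<in> {var_sum M X (i - 1) / var_sum M X k ..< var_sum M X i / var_sum M X k}"
    using var_sum_intervals_cover[OF pos, of t] t by auto
  have lo: "var_sum M X (i - 1) \<le> t * var_sum M X k" and hi: "t * var_sum M X k < var_sum M X i"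
    using i(3) pos by (simp_all add: pos_divide_le_eq pos_less_divide_eq)
  have "{l \<in> {1..k}. var_sum M X l \<le> t * var_sum M X k} = {1..i - 1}"
  proof (intro equalityI subsetI)
    fix l assume l: "l \<in> {l \<in> {1..k}. var_sum M X l \<le> t * var_sum M X k}"
    then have "\<not> i \<le> l" using hi var_sum_mono[of i l M X] by auto
    then show "l \<in> {1..i - 1}" using l by auto
  next
    fix l assume "l \<in> {1..i - 1}"
    then show "l \<in> {l \<in> {1..k}. var_sum M X l \<le> t * var_sum M X k}"
      using lo i var_sum_mono[of l "i - 1" M X] by auto
  qed
  then have "clock M X k t = i - 1" unfolding clock_def by simp
  then show ?thesis using partial_sum_process_interval[OF i] by simp
qed

text \<open>The accumulated variance passes \<open>t\<close> within one summand, so the error is at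
  most the largest relative variance.\<close>

lemma var_sum_clock:
  assumes pos: "var_sum M X k > 0" and t: "t \<in> {0..1}"
    and d: "\<And>j. j \<in> {1..k} \<Longrightarrow> prob_space.variance M (X j) \<le> d * var_sum M X k" and "d \<ge> 0"
  shows "\<bar>var_sum M X (clock M X k t) / var_sum M X k - t\<bar> \<le> d"
proof -
  define l where "l = clock M X k t"
  have "var_sum M X l \<le> t * var_sum M X k"
  proof (cases "l = 0")
    case True
    then show ?thesis using pos t by simp
  next
    case False
    then have "l \<in> {1..clock M X k t}" by (simp add: l_def)
    then show ?thesis unfolding clock_set[symmetric] by simp
  qed
  moreover have "t * var_sum M X k \<le> var_sum M X l + d * var_sum M X k"
  proof (cases "l = k")
    case True
    have "t * var_sum M X k \<le> 1 * var_sum M X k" using t pos by (intro mult_right_mono) auto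
    moreover have "0 \<le> d * var_sum M X k" using \<open>d \<ge> 0\<close> pos by simp
    ultimately show ?thesis using True by simp
  next
    case False
    then have "Suc l \<in> {1..k}" "Suc l \<notin> {1..clock M X k t}" using clock_le[of M X k t] by (auto simp: l_def)
    then have "t * var_sum M X k < var_sum M X (Suc l)" unfolding clock_set[symmetric] by auto
    also have "\<dots> = var_sum M X l + prob_space.variance M (X (Suc l))" by (simp add: var_sum_def)
    also have "\<dots> \<le> var_sum M X l + d * var_sum M X k" using d[OF \<open>Suc l \<in> {1..k}\<close>] by simp
    finally show ?thesis by simp
  qed
  ultimately have "var_sum M X l / var_sum M X k \<le> t" "t \<le> var_sum M X l / var_sum M X k + d"
    using pos by (simp_all add: field_simps)
  then show ?thesis unfolding l_def[symmetric] using \<open>d \<ge> 0\<close> by linarith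
qed

lemma limsup_zero_nonneg_tendsto:
  fixes f :: "nat \<Rightarrow> real"
  assumes "limsup (\<lambda>n. ereal (f n)) = 0" "\<forall>\<^sub>F n in sequentially. f n \<ge> 0"
  shows "f \<longlonglongrightarrow> 0"
proof -
  have "0 \<le> liminf (\<lambda>n. ereal (f n))"
    using assms(2) by (intro Liminf_bounded) (simp add: zero_ereal_def)
  moreover have "liminf (\<lambda>n. ereal (f n)) \<le> limsup (\<lambda>n. ereal (f n))" by (rule Liminf_le_Limsup) simp
  ultimately have "liminf (\<lambda>n. ereal (f n)) = 0" using assms(1) by simp
  with assms(1) have "(\<lambda>n. ereal (f n)) \<longlonglongrightarrow> 0" by (intro Liminf_eq_Limsup) auto
  then show ?thesis by (simp add: zero_ereal_def)
qed

theorem theorem3: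
  fixes M :: "nat \<Rightarrow> 'a measure"
    and X :: "nat \<Rightarrow> nat \<Rightarrow> 'a \<Rightarrow> real"
    and k :: "nat \<Rightarrow> nat"
    and a :: "nat \<Rightarrow> real"
    and s :: "nat \<Rightarrow> real"
  defines "s \<equiv> \<lambda>n. sd_sum (M n) (X n) (k n)"
  assumes prob: "\<And>n. n \<ge> 1 \<Longrightarrow> prob_space (M n)"
    and k_pos: "\<And>n. n \<ge> 1 \<Longrightarrow> k n \<ge> 1"
    and indep: "\<And>n. n \<ge> 1 \<Longrightarrow>
          prob_space.indep_vars (M n) (\<lambda>_. borel) (X n) {1..k n}"
    and square_integrable: "\<And>n j. n \<ge> 1 \<Longrightarrow> j \<in> {1..k n} \<Longrightarrow>
          integrable (M n) (\<lambda>\<omega>. (X n j \<omega>)\<^sup>2)"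
    and centered: "\<And>n j. n \<ge> 1 \<Longrightarrow> j \<in> {1..k n} \<Longrightarrow>
          prob_space.expectation (M n) (X n j) = 0"
    and var_pos: "\<And>n. n \<ge> 1 \<Longrightarrow> var_sum (M n) (X n) (k n) > 0"
    and a_pos: "\<And>n. n \<ge> 1 \<Longrightarrow> a n > 0"
    and a_lim: "a \<longlonglongrightarrow> 0"
    and exp_moments: "\<And>\<beta>::real. \<beta> > 0 \<Longrightarrow>
          limsup (\<lambda>n. ereal (a n * (\<Sum>j=1..k n.
            prob_space.expectation (M n) (\<lambda>\<omega>.
              exp (\<beta> * (\<bar>X n j \<omega>\<bar> / (sqrt (a n) * s n))) *
              indicator {\<omega>. sqrt (a n) * s n < \<bar>X n j \<omega>\<bar> \<and> \<bar>X n j \<omega>\<bar> < s n / sqrt (a n)} \<omega>)))) = 0"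
    and max_negligible:
          "limsup (\<lambda>n. ereal (a n) * log_prob (measure (M n)
             {\<omega> \<in> space (M n). (MAX j\<in>{1..k n}. \<bar>X n j \<omega>\<bar>) \<ge> s n / sqrt (a n)})) = - \<infinity>"
    and lindeberg: "\<And>\<epsilon>::real. \<epsilon> > 0 \<Longrightarrow>
          (\<lambda>n. 1 / (s n)\<^sup>2 * (\<Sum>j=1..k n.
             prob_space.expectation (M n) (\<lambda>\<omega>.
               (X n j \<omega>)\<^sup>2 * indicator {\<omega>. \<bar>X n j \<omega>\<bar> \<ge> \<epsilon> * s n * sqrt (a n)} \<omega>))) \<longlonglongrightarrow> 0"
  shows "moderate_deviation_principle M
           (\<lambda>n. partial_sum_process (M n) (X n) (k n)) a mdp_rate"
proof -
  interpret speed a using a_pos a_lim by unfold_locales auto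
  \<comment> \<open>In units of \<open>b n\<close> the factor \<open>sqrt (a n) / s n\<close> of the
    process becomes \<open>a n\<close>, the cut becomes \<open>1 / a n\<close>, and the exponential
    window and the Lindeberg condition start at the fixed levels 1 and \<epsilon>.\<close>
  define b where "b n = sqrt (a n) * s n" for n
  have s_pos: "s n > 0" and s_sq: "(s n)\<^sup>2 = var_sum (M n) (X n) (k n)" if "n \<ge> 1" for n
    using var_pos[OF that] by (simp_all add: s_def sd_sum_def)
  have b_pos: "b n > 0" and b_sq: "(b n)\<^sup>2 = a n * (s n)\<^sup>2" if "n \<ge> 1" for n
    using s_pos[OF that] a_pos[OF that] by (simp_all add: b_def power_mult_distrib)
  have s_div: "s n / sqrt (a n) = b n / a n" if "n \<ge> 1" for n
    using a_pos[OF that] by (simp add: b_def real_div_sqrt field_simps)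
  define y where "y n j \<omega> = X n j \<omega> / b n" for n j \<omega>
  define \<xi> where "\<xi> n j \<omega> = truncate (1 / a n) (y n j \<omega>)" for n j \<omega>
  define w where "w n j = prob_space.variance (M n) (X n j) / (s n)\<^sup>2" for n j
  define \<sigma> where "\<sigma> n j = prob_space.expectation (M n) (\<lambda>\<omega>. (y n j \<omega>)\<^sup>2)" for n j
  define q where "q e n j = prob_space.expectation (M n) (\<lambda>\<omega>. (y n j \<omega>)\<^sup>2 * indicator {x. e \<le> \<bar>x\<bar>} (y n j \<omega>))" for e n j
  define r where "r \<beta> n j = prob_space.expectation (M n) (\<lambda>\<omega>. exp (\<beta> * \<bar>y n j \<omega>\<bar>) *
      indicator {x. 1 < \<bar>x\<bar> \<and> \<bar>x\<bar> < 1 / a n} (y n j \<omega>))" for \<beta> n j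
  define Q where "Q e n = a n * (\<Sum>j\<in>{1..k n}. q e n j)" for e n
  define R where "R \<beta> n = a n * (\<Sum>j\<in>{1..k n}. r \<beta> n j)" for \<beta> n

  \<comment> \<open>Moments of the normalised summands\<close>
  have X_meas: "X n j \<in> borel_measurable (M n)" if "n \<ge> 1" "j \<in> {1..k n}" for n j
  proof -
    interpret prob_space "M n" using that(1) by (rule prob)
    show ?thesis using indep[OF that(1)] that(2) by (simp add: indep_vars_def)
  qed
  have y_meas: "y n j \<in> borel_measurable (M n)" if "n \<ge> 1" "j \<in> {1..k n}" for n j
    unfolding y_def using X_meas[OF that] by measurable
  have y_sq: "integrable (M n) (\<lambda>\<omega>. (y n j \<omega>)\<^sup>2)" if "n \<ge> 1" "j \<in> {1..k n}" for n j
    unfolding y_def power_divide using square_integrable[OF that] by simp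
  have y_mean: "prob_space.expectation (M n) (y n j) = 0" if "n \<ge> 1" "j \<in> {1..k n}" for n j
    unfolding y_def using centered[OF that] by simp
  have w_eq: "w n j = a n * \<sigma> n j" if "n \<ge> 1" "j \<in> {1..k n}" for n j
  proof -
    have "\<sigma> n j = prob_space.expectation (M n) (\<lambda>\<omega>. (X n j \<omega>)\<^sup>2) / (b n)\<^sup>2"
      by (simp add: \<sigma>_def y_def power_divide)
    then show ?thesis
      using centered[OF that] a_pos[OF that(1)] s_pos[OF that(1)] by (simp add: w_def b_sq[OF that(1)])
  qed
  have w_sum: "(\<Sum>j\<in>{1..l}. w n j) = var_sum (M n) (X n) l / var_sum (M n) (X n) (k n)" if "n \<ge> 1" for n l
    unfolding w_def s_sq[OF that] var_sum_def by (simp add: sum_divide_distrib)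
  have w_nonneg: "w n j \<ge> 0" for n j by (simp add: w_def)
  have q_nonneg: "q e n j \<ge> 0" and r_nonneg: "r \<beta> n j \<ge> 0" for e \<beta> n j
    unfolding q_def r_def by (rule Bochner_Integration.integral_nonneg; simp)+
  have Q_lim: "Q e \<longlonglongrightarrow> 0" if "e > 0" for e
  proof (rule Lim_transform_eventually[OF lindeberg[OF that]])
    show "\<forall>\<^sub>F n in sequentially. 1 / (s n)\<^sup>2 * (\<Sum>j=1..k n. prob_space.expectation (M n) (\<lambda>\<omega>.
        (X n j \<omega>)\<^sup>2 * indicator {\<omega>. \<bar>X n j \<omega>\<bar> \<ge> e * s n * sqrt (a n)} \<omega>)) = Q e n"
      using eventually_ge_at_top[of 1]
    proof eventually_elim
      case (elim n)
      have "prob_space.expectation (M n) (\<lambda>\<omega>. (X n j \<omega>)\<^sup>2 * indicator {\<omega>. \<bar>X n j \<omega>\<bar> \<ge> e * s n * sqrt (a n)} \<omega>) =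
          (b n)\<^sup>2 * q e n j" for j
      proof -
        have "(\<lambda>\<omega>. (X n j \<omega>)\<^sup>2 * indicator {\<omega>. \<bar>X n j \<omega>\<bar> \<ge> e * s n * sqrt (a n)} \<omega>) =
            (\<lambda>\<omega>. (b n)\<^sup>2 * ((y n j \<omega>)\<^sup>2 * indicator {x. e \<le> \<bar>x\<bar>} (y n j \<omega>)))"
          using b_pos[OF elim]
          by (auto simp: fun_eq_iff y_def power_divide indicator_def pos_le_divide_eq b_def ac_simps)
        then show ?thesis by (simp add: q_def)
      qed
      then show ?case
        using s_pos[OF elim] by (simp add: Q_def b_sq[OF elim] sum_distrib_left[symmetric])
    qed
  qed
  have R_lim: "R \<beta> \<longlonglongrightarrow> 0" if "\<beta> > 0" for \<beta>
  proof (rule limsup_zero_nonneg_tendsto)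
    show "\<forall>\<^sub>F n in sequentially. R \<beta> n \<ge> 0"
      using eventually_a_pos
      by eventually_elim (auto simp: R_def intro!: mult_nonneg_nonneg sum_nonneg r_nonneg)
    have "\<forall>\<^sub>F n in sequentially. ereal (R \<beta> n) = ereal (a n * (\<Sum>j=1..k n. prob_space.expectation (M n) (\<lambda>\<omega>.
              exp (\<beta> * (\<bar>X n j \<omega>\<bar> / (sqrt (a n) * s n))) *
              indicator {\<omega>. sqrt (a n) * s n < \<bar>X n j \<omega>\<bar> \<and> \<bar>X n j \<omega>\<bar> < s n / sqrt (a n)} \<omega>)))"
      using eventually_ge_at_top[of 1]
    proof eventually_elim
      case (elim n)
      have "(\<lambda>\<omega>. exp (\<beta> * (\<bar>X n j \<omega>\<bar> / (sqrt (a n) * s n))) *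
              indicator {\<omega>. sqrt (a n) * s n < \<bar>X n j \<omega>\<bar> \<and> \<bar>X n j \<omega>\<bar> < s n / sqrt (a n)} \<omega>) =
          (\<lambda>\<omega>. exp (\<beta> * \<bar>y n j \<omega>\<bar>) * indicator {x. 1 < \<bar>x\<bar> \<and> \<bar>x\<bar> < 1 / a n} (y n j \<omega>))" for j
        unfolding s_div[OF elim] b_def[symmetric] using b_pos[OF elim] a_pos[OF elim]
        by (auto simp: fun_eq_iff y_def indicator_def field_simps)
      then show ?case by (simp add: R_def r_def)
    qed
    then have "limsup (\<lambda>n. ereal (R \<beta> n)) = limsup (\<lambda>n. ereal (a n * (\<Sum>j=1..k n. prob_space.expectation (M n) (\<lambda>\<omega>.
              exp (\<beta> * (\<bar>X n j \<omega>\<bar> / (sqrt (a n) * s n))) *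
              indicator {\<omega>. sqrt (a n) * s n < \<bar>X n j \<omega>\<bar> \<and> \<bar>X n j \<omega>\<bar> < s n / sqrt (a n)} \<omega>))))"
      by (rule Limsup_eq)
    then show "limsup (\<lambda>n. ereal (R \<beta> n)) = 0" using exp_moments[OF that] by simp
  qed
  have a_le_1: "\<forall>\<^sub>F n in sequentially. n \<ge> 1 \<and> a n \<le> 1"
    using order_tendstoD(2)[OF a_lim zero_less_one] eventually_ge_at_top[of 1] by eventually_elim simp
  have small_square: "\<sigma> n j - q e n j \<in> {0..e\<^sup>2}"
    if "n \<ge> 1" "j \<in> {1..k n}" "0 < e" "e \<le> 1" for n j e
  proof -
    interpret prob_space "M n" using that(1) by (rule prob)
    show ?thesis
      unfolding \<sigma>_def q_def by (rule expectation_small_square[OF y_meas y_sq _ _ order_refl]) (use that in auto)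
  qed
  \<comment> \<open>Lindeberg at level 1 makes single summands negligible:
    \<open>\<sigma> n j \<le> 1 + q 1 n j\<close>, hence
    \<open>w n j \<le> a n + Q 1 n\<close>.\<close>
  have w_small: "\<forall>\<^sub>F n in sequentially. n \<ge> 1 \<and> (\<forall>j\<in>{1..k n}. w n j \<le> d)" if "d > 0" for d
  proof -
    have "(\<lambda>n. a n + Q 1 n) \<longlonglongrightarrow> 0 + 0" by (intro tendsto_add a_lim Q_lim) simp
    then have "\<forall>\<^sub>F n in sequentially. a n + Q 1 n < d" using that by (intro order_tendstoD(2)) auto
    then show ?thesis using eventually_ge_at_top[of 1]
    proof eventually_elim
      case (elim n)
      have "w n j \<le> d" if j: "j \<in> {1..k n}" for j
      proof -
        have "\<sigma> n j \<le> 1 + q 1 n j" using small_square[OF elim(2) j, of 1] by simp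
        also have "q 1 n j \<le> (\<Sum>j\<in>{1..k n}. q 1 n j)" using j q_nonneg by (intro member_le_sum) auto
        finally have "a n * \<sigma> n j \<le> a n * (1 + (\<Sum>j\<in>{1..k n}. q 1 n j))"
          using a_pos[OF elim(2)] by (intro mult_left_mono) auto
        then show ?thesis using elim w_eq[OF elim(2) j] by (simp add: Q_def distrib_left)
      qed
      then show ?case using elim by simp
    qed
  qed
  \<comment> \<open>The event that some summand is cut; its complement matches the strict inequality
    in \<open>truncate\<close>.\<close>
  define N where "N n = {\<omega> \<in> space (M n). \<exists>j\<in>{1..k n}. s n / sqrt (a n) \<le> \<bar>X n j \<omega>\<bar>}" for n
  have N_max: "N n = {\<omega> \<in> space (M n). (MAX j\<in>{1..k n}. \<bar>X n j \<omega>\<bar>) \<ge> s n / sqrt (a n)}" if "n \<ge> 1" for n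
    using k_pos[OF that] by (auto simp: N_def Max_ge_iff)

  \<comment> \<open>Gaussian limit of the logarithmic moment generating functions\<close>
  interpret exp_array a M \<xi> k w "\<lambda>n. max 1 (1 / a n)"
  proof (intro exp_array.intro exp_array_axioms.intro speed_axioms)
    show "prob_space (M n)" if "n \<ge> 1" for n using that by (rule prob)
    show "prob_space.indep_vars (M n) (\<lambda>_. borel) (\<xi> n) {1..k n}" if "n \<ge> 1" for n
    proof -
      interpret prob_space "M n" using that by (rule prob)
      show ?thesis
        unfolding \<xi>_def y_def
        by (rule indep_vars_compose2[OF indep[OF that], of "\<lambda>_ x. truncate (1 / a n) (x / b n)"]) measurable
    qed
    \<comment> \<open>\<open>max 1\<close> keeps the bound valid in row 0 too, where the sign of
      \<open>a 0\<close> is not prescribed.\<close>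
    show "\<bar>\<xi> n j \<omega>\<bar> \<le> max 1 (1 / a n)" for n j \<omega>
      by (auto simp: \<xi>_def truncate_def)
    show "w n j \<ge> 0" for n j by (rule w_nonneg)
    show "\<forall>\<^sub>F n in sequentially. \<forall>B\<subseteq>{1..k n}.
      \<bar>a n * (\<Sum>j\<in>B. ln (prob_space.expectation (M n) (\<lambda>\<omega>. exp (\<theta> * \<xi> n j \<omega>)))) - \<theta>\<^sup>2 / 2 * (\<Sum>j\<in>B. w n j)\<bar> \<le> \<delta>"
      if "\<delta> > 0" for \<theta> \<delta>
    \<comment> \<open>Separated because the choice of \<open>e\<close> below needs
      \<open>\<theta>\<^sup>2 / 2 > 0\<close>.\<close>
    proof (cases "\<theta> = 0")
      case True
      show ?thesis
        using eventually_ge_at_top[of 1]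
      proof eventually_elim
        case (elim n)
        then interpret prob_space "M n" by (rule prob)
        show ?case using True \<open>\<delta> > 0\<close> by (simp add: prob_space)
      qed
    next
      case False
      define D where "D = \<bar>\<theta>\<bar> ^ 3 * exp \<bar>\<theta>\<bar>"
      have "D \<ge> 0" by (simp add: D_def)
      \<comment> \<open>\<open>e\<close> is fixed so small that the error terms surviving the limit,
        those without \<open>Q\<close> and \<open>R\<close>, stay below \<delta>; only afterwards is
        \<open>n\<close> taken large.\<close>
      have "\<forall>\<^sub>F e in at_right 0. D * e < \<theta>\<^sup>2 / 2"
        using False by (intro order_tendstoD(2)[of _ 0]) (auto intro!: tendsto_eq_intros)
      moreover have "\<forall>\<^sub>F e in at_right 0. \<theta>\<^sup>2 / 2 * e\<^sup>2 < 1 / 2"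
        by (intro order_tendstoD(2)[of _ 0]) (auto intro!: tendsto_eq_intros)
      moreover have "\<forall>\<^sub>F e in at_right 0. D * e + 2 * (\<theta>\<^sup>2 / 2 * e\<^sup>2) * (\<theta>\<^sup>2 / 2) < \<delta>"
        using \<open>\<delta> > 0\<close> by (intro order_tendstoD(2)[of _ 0]) (auto intro!: tendsto_eq_intros)
      moreover have "\<forall>\<^sub>F e in at_right 0. (e :: real) \<in> {0<..<1}"
        by (rule eventually_at_rightI[of 0 1]) auto
      ultimately have "\<forall>\<^sub>F e in at_right 0. D * e < \<theta>\<^sup>2 / 2 \<and> \<theta>\<^sup>2 / 2 * e\<^sup>2 < 1 / 2 \<and>
          D * e + 2 * (\<theta>\<^sup>2 / 2 * e\<^sup>2) * (\<theta>\<^sup>2 / 2) < \<delta> \<and> e \<in> {0<..<1}"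
        by eventually_elim simp
      then obtain e where e: "D * e < \<theta>\<^sup>2 / 2" "\<theta>\<^sup>2 / 2 * e\<^sup>2 < 1 / 2"
        "D * e + 2 * (\<theta>\<^sup>2 / 2 * e\<^sup>2) * (\<theta>\<^sup>2 / 2) < \<delta>" "0 < e" "e < 1"
        using eventually_happens'[OF trivial_limit_at_right_real] by fastforce
      define \<rho> where "\<rho> n = \<bar>\<theta>\<bar> * Q e n + \<theta>\<^sup>2 / 2 * e\<^sup>2" for n
      have \<rho>_lim: "\<rho> \<longlonglongrightarrow> \<bar>\<theta>\<bar> * 0 + \<theta>\<^sup>2 / 2 * e\<^sup>2"
        unfolding \<rho>_def by (intro tendsto_intros Q_lim e)
      define \<beta> where "\<beta> = \<bar>\<theta>\<bar> + 1"
      have "(\<lambda>n. (\<bar>\<theta>\<bar> + D + \<theta>\<^sup>2 / 2) * Q e n + D * e + R \<beta> n + 2 * \<rho> n * (\<bar>\<theta>\<bar> * Q e n + \<theta>\<^sup>2 / 2)) \<longlonglongrightarrow>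
          (\<bar>\<theta>\<bar> + D + \<theta>\<^sup>2 / 2) * 0 + D * e + 0 + 2 * (\<bar>\<theta>\<bar> * 0 + \<theta>\<^sup>2 / 2 * e\<^sup>2) * (\<bar>\<theta>\<bar> * 0 + \<theta>\<^sup>2 / 2)"
        by (intro tendsto_intros Q_lim R_lim \<rho>_lim e) (simp add: \<beta>_def)
      then have ev: "\<forall>\<^sub>F n in sequentially. (\<bar>\<theta>\<bar> + D + \<theta>\<^sup>2 / 2) * Q e n + D * e + R \<beta> n + 2 * \<rho> n * (\<bar>\<theta>\<bar> * Q e n + \<theta>\<^sup>2 / 2) < \<delta>"
        by (rule order_tendstoD(2)) (use e in simp)
      have "\<forall>\<^sub>F n in sequentially. \<rho> n < 1 / 2"
        using \<rho>_lim by (rule order_tendstoD(2)) (use e in simp)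
      then show ?thesis using ev a_le_1
      proof eventually_elim
        case (elim n)
        then have n: "n \<ge> 1" "a n \<le> 1" by auto
        have "a n > 0" using a_pos[OF n(1)] .
        interpret prob_space "M n" using n(1) by (rule prob)
        have c: "1 \<le> 1 / a n" using \<open>a n > 0\<close> n(2) by simp
        have e': "0 < e" "e \<le> 1" using e by auto
        show ?case
        proof (intro allI impI)
          fix B assume B: "B \<subseteq> {1..k n}"
          have "\<bar>a n * (\<Sum>j\<in>B. ln (expectation (\<lambda>\<omega>. exp (\<theta> * \<xi> n j \<omega>)))) - \<theta>\<^sup>2 / 2 * (\<Sum>j\<in>B. a n * \<sigma> n j)\<bar> \<le>
              (\<bar>\<theta>\<bar> + D + \<theta>\<^sup>2 / 2) * Q e n + D * e + R \<beta> n + 2 * \<rho> n * (\<bar>\<theta>\<bar> * Q e n + \<theta>\<^sup>2 / 2)"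
          proof (rule log_mgf_row_bound[where J = "{1..k n}" and q = "q e n" and r = "r \<beta> n" and \<mu> = "\<lambda>j. expectation (\<xi> n j)"])
            fix j assume j: "j \<in> {1..k n}"
            note ym = y_meas[OF n(1) j] and ys = y_sq[OF n(1) j]
            show "expectation (\<lambda>\<omega>. exp (\<theta> * \<xi> n j \<omega>)) \<le> 1 + \<theta> * expectation (\<xi> n j) + \<theta>\<^sup>2 / 2 * \<sigma> n j + D * (e * \<sigma> n j + q e n j) + r \<beta> n j"
              using expectation_exp_truncate_le[OF ym ys e' c, of \<theta>]
              unfolding \<xi>_def \<sigma>_def q_def r_def D_def \<beta>_def .
            show "1 + \<theta> * expectation (\<xi> n j) + (\<theta>\<^sup>2 / 2 - D * e) * (\<sigma> n j - q e n j) \<le> expectation (\<lambda>\<omega>. exp (\<theta> * \<xi> n j \<omega>))"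
              using expectation_exp_truncate_ge[OF ym ys e' c, of \<theta>]
              unfolding \<xi>_def \<sigma>_def q_def D_def .
            show "\<bar>expectation (\<xi> n j)\<bar> \<le> a n * q e n j"
              using expectation_truncate_le[OF ym ys e' c y_mean[OF n(1) j]]
              unfolding \<xi>_def q_def by (simp add: mult.commute)
            show "\<sigma> n j - q e n j \<in> {0..e\<^sup>2}" using n(1) j e' by (rule small_square)
            show "q e n j \<ge> 0" "r \<beta> n j \<ge> 0" by (rule q_nonneg, rule r_nonneg)
          next
            have "a n * (\<Sum>j\<in>{1..k n}. \<sigma> n j) = (\<Sum>j\<in>{1..k n}. w n j)"
              unfolding sum_distrib_left by (intro sum.cong refl) (simp add: w_eq[OF n(1)])
            also have "\<dots> = 1" unfolding w_sum[OF n(1)] using var_pos[OF n(1)] by simp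
            finally show "a n * (\<Sum>j\<in>{1..k n}. \<sigma> n j) \<le> 1" by simp
          qed (use B \<open>a n > 0\<close> n(2) \<open>D \<ge> 0\<close> e elim in \<open>auto simp: Q_def R_def \<rho>_def\<close>)
          moreover have "(\<Sum>j\<in>B. a n * \<sigma> n j) = (\<Sum>j\<in>B. w n j)"
            using B w_eq[OF n(1)] by (intro sum.cong refl) (auto simp: subset_iff)
          ultimately show "\<bar>a n * (\<Sum>j\<in>B. ln (expectation (\<lambda>\<omega>. exp (\<theta> * \<xi> n j \<omega>)))) - \<theta>\<^sup>2 / 2 * (\<Sum>j\<in>B. w n j)\<bar> \<le> \<delta>"
            using elim(2) by simp
        qed
      qed
    qed
  qed

  \<comment> \<open>Time change, measurability and the truncation event\<close>
  interpret mdp_array a M \<xi> k w "\<lambda>n. max 1 (1 / a n)" "\<lambda>n. clock (M n) (X n) (k n)"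
    "\<lambda>n \<omega>. sqrt (a n) *\<^sub>R partial_sum_process (M n) (X n) (k n) \<omega>" N
  proof (intro mdp_array.intro mdp_array_axioms.intro exp_array_axioms)
    show "clock (M n) (X n) (k n) t \<le> clock (M n) (X n) (k n) u" if "t \<le> u" for n t u
      using that by (rule clock_mono)
    show "clock (M n) (X n) (k n) t \<le> k n" for n t by (rule clock_le)
    show "(\<lambda>n. \<Sum>j\<in>{1..clock (M n) (X n) (k n) t}. w n j) \<longlonglongrightarrow> t" if t: "t \<in> {0..1}" for t
    proof (rule tendstoI)
      fix \<epsilon> :: real assume "\<epsilon> > 0"
      then have "\<epsilon> / 2 > 0" by simp
      from w_small[OF this] show "\<forall>\<^sub>F n in sequentially. dist (\<Sum>j\<in>{1..clock (M n) (X n) (k n) t}. w n j) t < \<epsilon>"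
      proof eventually_elim
        case (elim n)
        then have n: "n \<ge> 1" by simp
        have "prob_space.variance (M n) (X n j) \<le> \<epsilon> / 2 * var_sum (M n) (X n) (k n)" if "j \<in> {1..k n}" for j
        proof -
          have "w n j \<le> \<epsilon> / 2" using elim that by simp
          then show ?thesis unfolding w_def s_sq[OF n] using var_pos[OF n] by (simp add: pos_divide_le_eq)
        qed
        then have "\<bar>var_sum (M n) (X n) (clock (M n) (X n) (k n) t) / var_sum (M n) (X n) (k n) - t\<bar> \<le> \<epsilon> / 2"
          using var_pos[OF n] t \<open>\<epsilon> > 0\<close> by (intro var_sum_clock) auto
        then show ?case unfolding w_sum[OF n] dist_real_def using \<open>\<epsilon> > 0\<close> by simp
      qed
    qed
    show "(\<lambda>\<omega>. sqrt (a n) *\<^sub>R partial_sum_process (M n) (X n) (k n) \<omega>) \<in> borel_measurable (M n)" if "n \<ge> 1" for n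
    proof (rule measurable_compose[OF partial_sum_process_measurable])
      show "X n j \<in> borel_measurable (M n)" if "j \<in> {1..k n}" for j using \<open>n \<ge> 1\<close> that by (rule X_meas)
      show "(\<lambda>z :: cadlag. sqrt (a n) *\<^sub>R z) \<in> borel_measurable borel"
        by (intro borel_measurable_continuous_onI continuous_intros)
    qed
    show "N n \<in> sets (M n)" if "n \<ge> 1" for n
      unfolding N_def
    proof (rule sets.sets_Collect_finite_Ex)
      fix j assume "j \<in> {1..k n}"
      then have "X n j \<in> borel_measurable (M n)" by (rule X_meas[OF that])
      then show "{\<omega> \<in> space (M n). s n / sqrt (a n) \<le> \<bar>X n j \<omega>\<bar>} \<in> sets (M n)" by measurable
    qed simp
    show "exp_bound (\<lambda>n. measure (M n) (N n)) \<alpha>" for \<alpha>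
      unfolding exp_bound_def
    proof (intro allI impI)
      fix \<delta> :: real assume "\<delta> > 0"
      \<comment> \<open>The limsup is minus infinity, so it lies below \<open>- \<alpha>\<close> for
        every \<alpha>.\<close>
      have "limsup (\<lambda>n. ereal (a n) * log_prob (measure (M n)
             {\<omega> \<in> space (M n). (MAX j\<in>{1..k n}. \<bar>X n j \<omega>\<bar>) \<ge> s n / sqrt (a n)})) < ereal (- \<alpha>)"
        unfolding max_negligible by simp
      from Limsup_lessD[OF this] eventually_a_pos
      show "\<forall>\<^sub>F n in sequentially. measure (M n) (N n) \<le> exp ((\<delta> - \<alpha>) / a n)"
      proof eventually_elim
        case (elim n)
        then have n: "n \<ge> 1" "a n > 0" by auto
        show ?case
        proof (cases "measure (M n) (N n) = 0")
          case False
          then have pos: "measure (M n) (N n) > 0" using measure_nonneg[of "M n" "N n"] by linarith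
          have "ereal (a n) * log_prob (measure (M n) (N n)) < ereal (- \<alpha>)"
            using elim(1) unfolding N_max[OF n(1), symmetric] .
          then have "a n * ln (measure (M n) (N n)) < - \<alpha>" using False by (simp add: log_prob_def)
          then have "ln (measure (M n) (N n)) \<le> (\<delta> - \<alpha>) / a n"
            using n(2) \<open>\<delta> > 0\<close> by (simp add: pos_le_divide_eq mult.commute)
          then have "exp (ln (measure (M n) (N n))) \<le> exp ((\<delta> - \<alpha>) / a n)" by simp
          then show ?thesis using pos by simp
        qed simp
      qed
    qed
    show "apply_cadlag (sqrt (a n) *\<^sub>R partial_sum_process (M n) (X n) (k n) \<omega>) t =
        a n * S n {1..clock (M n) (X n) (k n) t} \<omega>"
      if n: "n \<ge> 1" and \<omega>: "\<omega> \<in> space (M n) - N n" and t: "t \<in> {0..1}" for n \<omega> t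
    proof -
      define l where "l = clock (M n) (X n) (k n) t"
      have "l \<le> k n" unfolding l_def by (rule clock_le)
      have "a n > 0" "s n > 0" using a_pos s_pos n by auto
      have "\<xi> n j \<omega> = X n j \<omega> / b n" if "j \<in> {1..l}" for j
      proof -
        \<comment> \<open>Off \<open>N n\<close> no summand is cut.\<close>
        have "\<bar>X n j \<omega>\<bar> < s n / sqrt (a n)" using \<omega> that \<open>l \<le> k n\<close> by (auto simp: N_def not_le)
        then have "\<bar>y n j \<omega>\<bar> < 1 / a n"
          unfolding s_div[OF n] y_def using b_pos[OF n] by (simp add: pos_divide_less_eq)
        then show ?thesis by (simp add: \<xi>_def truncate_def y_def)
      qed
      then have "S n {1..l} \<omega> = partial_sum (X n) l \<omega> / b n"
        unfolding S_def partial_sum_def sum_divide_distrib by (intro sum.cong) auto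
      moreover have "a n / b n = sqrt (a n) / s n"
        using \<open>a n > 0\<close> \<open>s n > 0\<close> by (simp add: b_def frac_eq_eq flip: real_sqrt_mult)
      then have "a n * (partial_sum (X n) l \<omega> / b n) = sqrt (a n) * (partial_sum (X n) l \<omega> / s n)"
        by (metis times_divide_eq_left times_divide_eq_right mult.commute)
      ultimately show ?thesis
        using partial_sum_process_clock[OF var_pos[OF n] t, of \<omega>]
        by (simp add: scaleR_cadlag.rep_eq l_def s_def)
    qed
  qed
  show ?thesis
    unfolding moderate_deviation_principle_def Let_def
    using partial_sum_process_measurable[OF X_meas] good_mdp_rate moderate_deviations
    by (auto intro!: Liminf_le_Limsup)
qed

end
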